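(* Let $\Omega\subset\mathbb{R}^N$ be an open set with finite measure. Set \[ \mathcal{A}(\Omega)=\Big\{(f,\phi)\in L^1_{\rm loc}(\Omega)\times L^2_{\rm loc}(\Omega;\mathbb{R}^N)\, :\, -\mathrm{div}\, \phi+f\ge 1 \mbox{ in }\Omega\Big\}. \] Then \[ \frac{1}{\lambda_1(\Omega)}=\inf_{(f,\phi)\in \mathcal{A}(\Omega)}\Big\|G_2(f,\phi)\Big\|_{L^\infty(\Omega)}. \] Moreover, if $U\in W^{1,2}_0(\Omega)$ denotes any positive first eigenfunction of $\Omega$, then the pair $(f_0,\phi_0)$ defined by \[ \phi_0=\frac{1}{\lambda_1(\Omega)}\,\frac{\nabla U}{U}\qquad \mbox{ and }\qquad f_0=-\frac{1}{\lambda_1(\Omega)}\,\frac{|\nabla U|^2}{U^2} \] is a minimizer for the infimum \[ \inf_{(f,\phi)\in \mathcal{A}(\Omega)}\Big\|G_2(f,\phi)\Big\|_{L^\infty(\Omega)}. \]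
   Context: $W^{1,2}_0(\Omega)$ is the closure of $C^\infty_0(\Omega)$ in the Sobolev norm $\|\varphi\|_{L^2(\Omega)}+\|\nabla\varphi\|_{L^2(\Omega;\mathbb{R}^N)}$. The quantity \[ \lambda_1(\Omega)=\min_{\varphi\in W^{1,2}_0(\Omega)\setminus\{0\}} \frac{\int_\Omega |\nabla \varphi|^2\,dx}{\int_\Omega |\varphi|^2\,dx} \] is the first eigenvalue of the Dirichlet-Laplacian on $\Omega$; a first eigenfunction is a nontrivial weak solution $U\in W^{1,2}_0(\Omega)$ of $-\Delta U=\lambda_1(\Omega)\,U$ in $\Omega$ (equivalently, a minimizer of this quotient). The function $G_2:\mathbb{R}\times\mathbb{R}^N\to[0,+\infty]$ is defined by $G_2(s,\xi)=\dfrac{|\xi|^2}{|s|}$ if $s<0$ and $\xi\in\mathbb{R}^N$; $G_2(0,0)=0$; and $G_2(s,\xi)=+\infty$ otherwise. The norm $\|G_2(f,\phi)\|_{L^\infty(\Omega)}$ may take the value $+\infty$. The condition $-\mathrm{div}\,\phi+f\ge 1$ in $\Omega$ is understood in the distributional sense: \[ \int_\Omega \big[\langle \nabla \psi,\phi\rangle+f\,\psi\big]\,dx\ge \int_\Omega \psi\,dx\qquad \mbox{for every } \psi\in C^1_0(\Omega) \mbox{ with } \psi\ge 0, \] where $C^1_0(\Omega)$ denotes the $C^1$ functions with compact support in $\Omega$. *)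

theory Defs
  imports "HOL-Analysis.Analysis" "HOL-Probability.Essential_Supremum"
begin

text \<open>Functions on an open set \<open>\<Omega>\<close> are represented by total functions on the ambient Euclidean
  space \<open>'a\<close> (so \<open>N = DIM('a)\<close>). Only their values on \<open>\<Omega>\<close> matter, and these only up to null sets of
  \<open>lebesgue_on \<Omega>\<close>. Functions with compact support in \<open>\<Omega>\<close> are extended by zero.\<close>

section \<open>Test functions\<close>

definition gradient :: "('a::real_inner \<Rightarrow> real) \<Rightarrow> 'a \<Rightarrow> 'a" where
  "gradient \<psi> x = (THE D. GDERIV \<psi> x :> D)"

text \<open>\<open>Ck k f\<close>: the function \<open>f\<close> is of class \<open>C\<^sup>k\<close> on the whole space.\<close>

primrec Ck :: "nat \<Rightarrow> ('a::real_normed_vector \<Rightarrow> real) \<Rightarrow> bool" where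
  "Ck 0 f \<longleftrightarrow> continuous_on UNIV f"
| "Ck (Suc k) f \<longleftrightarrow>
     f differentiable_on UNIV \<and> (\<forall>v. Ck k (\<lambda>x. frechet_derivative f (at x) v))"

definition compactly_supported_in :: "'a::euclidean_space set \<Rightarrow> ('a \<Rightarrow> real) \<Rightarrow> bool" where
  "compactly_supported_in \<Omega> \<psi> \<longleftrightarrow>
     compact (closure {x. \<psi> x \<noteq> 0}) \<and> closure {x. \<psi> x \<noteq> 0} \<subseteq> \<Omega>"

definition C1_0 :: "'a::euclidean_space set \<Rightarrow> ('a \<Rightarrow> real) set" where
  "C1_0 \<Omega> = {\<psi>. Ck 1 \<psi> \<and> compactly_supported_in \<Omega> \<psi>}"

definition Cinf_0 :: "'a::euclidean_space set \<Rightarrow> ('a \<Rightarrow> real) set" where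
  "Cinf_0 \<Omega> = {\<psi>. (\<forall>k. Ck k \<psi>) \<and> compactly_supported_in \<Omega> \<psi>}"

section \<open>Lebesgue spaces\<close>

definition L1_loc :: "'a::euclidean_space set \<Rightarrow> ('a \<Rightarrow> 'b::euclidean_space) set" where
  "L1_loc \<Omega> = {f. \<forall>K. compact K \<and> K \<subseteq> \<Omega> \<longrightarrow> integrable (lebesgue_on K) f}"

definition L2 :: "'a::euclidean_space set \<Rightarrow> ('a \<Rightarrow> 'b::euclidean_space) set" where
  "L2 \<Omega> = {f. f \<in> borel_measurable (lebesgue_on \<Omega>) \<and>
              integrable (lebesgue_on \<Omega>) (\<lambda>x. (norm (f x))\<^sup>2)}"

definition L2_loc :: "'a::euclidean_space set \<Rightarrow> ('a \<Rightarrow> 'b::euclidean_space) set" where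
  "L2_loc \<Omega> = {f. \<forall>K. compact K \<and> K \<subseteq> \<Omega> \<longrightarrow> f \<in> L2 K}"

definition L2_norm :: "'a::euclidean_space set \<Rightarrow> ('a \<Rightarrow> 'b::euclidean_space) \<Rightarrow> real" where
  "L2_norm \<Omega> f = sqrt (\<integral>x. (norm (f x))\<^sup>2 \<partial>lebesgue_on \<Omega>)"

text \<open>The \<open>L\<^sup>\<infinity>\<close> norm of a function with values in \<open>[0, \<infinity>]\<close>.\<close>

definition Linf_norm :: "'a::euclidean_space set \<Rightarrow> ('a \<Rightarrow> ennreal) \<Rightarrow> ennreal" where
  "Linf_norm \<Omega> h = esssup (lebesgue_on \<Omega>) h"

section \<open>The Sobolev space and the first Dirichlet eigenvalue\<close>

definition weak_gradient :: "'a::euclidean_space set \<Rightarrow> ('a \<Rightarrow> real) \<Rightarrow> ('a \<Rightarrow> 'a) \<Rightarrow> bool" where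
  "weak_gradient \<Omega> u Du \<longleftrightarrow> u \<in> L1_loc \<Omega> \<and> Du \<in> L1_loc \<Omega> \<and>
     (\<forall>\<psi> \<in> Cinf_0 \<Omega>. (\<integral>x. u x *\<^sub>R gradient \<psi> x \<partial>lebesgue_on \<Omega>)
                      = - (\<integral>x. \<psi> x *\<^sub>R Du x \<partial>lebesgue_on \<Omega>))"

text \<open>Sobolev functions are paired with a representative of their weak gradient, which is unique
  up to null sets: \<open>(u, Du) \<in> W12_0 \<Omega>\<close> says that \<open>u\<close> belongs to \<open>W\<^sup>1\<^sup>,\<^sup>2\<close>, that \<open>\<nabla>u = Du\<close>, and that \<open>u\<close>
  is a limit of smooth compactly supported functions in the Sobolev norm.\<close>

definition W12_0 :: "'a::euclidean_space set \<Rightarrow> (('a \<Rightarrow> real) \<times> ('a \<Rightarrow> 'a)) set" where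
  "W12_0 \<Omega> = {(u, Du). u \<in> L2 \<Omega> \<and> Du \<in> L2 \<Omega> \<and> weak_gradient \<Omega> u Du \<and>
     (\<forall>\<epsilon>>0. \<exists>\<psi> \<in> Cinf_0 \<Omega>.
        L2_norm \<Omega> (\<lambda>x. u x - \<psi> x) + L2_norm \<Omega> (\<lambda>x. Du x - gradient \<psi> x) < \<epsilon>)}"

text \<open>For a nonempty open set of finite measure the infimum is finite and attained, i.e. it is the
  minimum of the Rayleigh quotient. For the empty set its value is \<open>\<infinity>\<close>.\<close>

definition first_eigenvalue :: "'a::euclidean_space set \<Rightarrow> ennreal" where
  "first_eigenvalue \<Omega> =
     (INF (u, Du) \<in> {(u, Du) \<in> W12_0 \<Omega>. \<not> (AE x in lebesgue_on \<Omega>. u x = 0)}.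
        ennreal ((\<integral>x. (norm (Du x))\<^sup>2 \<partial>lebesgue_on \<Omega>) / (\<integral>x. \<bar>u x\<bar>\<^sup>2 \<partial>lebesgue_on \<Omega>)))"

definition first_eigenfunction ::
    "'a::euclidean_space set \<Rightarrow> ('a \<Rightarrow> real) \<Rightarrow> ('a \<Rightarrow> 'a) \<Rightarrow> bool" where
  "first_eigenfunction \<Omega> U DU \<longleftrightarrow>
     (U, DU) \<in> W12_0 \<Omega> \<and> \<not> (AE x in lebesgue_on \<Omega>. U x = 0) \<and>
     (\<forall>\<psi> \<in> Cinf_0 \<Omega>. (\<integral>x. DU x \<bullet> gradient \<psi> x \<partial>lebesgue_on \<Omega>)
                      = enn2real (first_eigenvalue \<Omega>) * (\<integral>x. U x * \<psi> x \<partial>lebesgue_on \<Omega>))"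

section \<open>The dual problem\<close>

definition G2 :: "real \<Rightarrow> 'a::euclidean_space \<Rightarrow> ennreal" where
  "G2 s \<xi> = (if s < 0 then ennreal ((norm \<xi>)\<^sup>2 / \<bar>s\<bar>)
             else if s = 0 \<and> \<xi> = 0 then 0 else \<infinity>)"

text \<open>The pairs \<open>(f, \<phi>)\<close> with \<open>- div \<phi> + f \<ge> 1\<close> in \<open>\<Omega>\<close> in the distributional sense.\<close>

definition admissible :: "'a::euclidean_space set \<Rightarrow> (('a \<Rightarrow> real) \<times> ('a \<Rightarrow> 'a)) set" where
  "admissible \<Omega> = {(f, \<phi>). f \<in> L1_loc \<Omega> \<and> \<phi> \<in> L2_loc \<Omega> \<and>
     (\<forall>\<psi> \<in> C1_0 \<Omega>. (\<forall>x. \<psi> x \<ge> 0) \<longrightarrow>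
        (\<integral>x. (gradient \<psi> x \<bullet> \<phi> x + f x * \<psi> x) \<partial>lebesgue_on \<Omega>) \<ge> (\<integral>x. \<psi> x \<partial>lebesgue_on \<Omega>))}"

end

theory Submission
  imports Defs
begin

text \<open>The lower bound is a square completion. If \<open>(f, \<phi>)\<close> is admissible and \<open>G2 f \<phi> \<le> m\<close>, then \<open>f \<le> 0\<close> and
  \<open>(norm \<phi>)\<^sup>2 \<le> m * \<bar>f\<bar>\<close>. Testing admissibility with \<open>\<psi>\<^sup>2\<close> bounds the integral of \<open>\<psi>\<^sup>2\<close> by that of
  \<open>2 * \<psi> * (gradient \<psi> \<bullet> \<phi>) + f * \<psi>\<^sup>2\<close>, and Young's inequality bounds this integrand by
  \<open>m * (norm (gradient \<psi>))\<^sup>2\<close>. So \<open>m\<close> is a Poincare constant and \<open>1 / \<lambda>\<^sub>1 \<le> m\<close>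
  (\<open>inverse_eigenvalue_le_Linf_norm\<close>).

  Equality is attained by logarithmic gradients. If \<open>w > 0\<close> solves \<open>- \<Delta> w = \<mu> * w\<close>, then testing with
  \<open>\<zeta> / w\<close> shows that \<open>\<phi> = \<nabla>w / (\<mu> w)\<close> and \<open>f = - (norm \<nabla>w)\<^sup>2 / (\<mu> w\<^sup>2)\<close> satisfy \<open>- div \<phi> + f = 1\<close>, and
  \<open>G2 f \<phi> \<le> 1 / \<mu>\<close>. The function \<open>w\<close> may have any boundary values, which gives the upper bound at every
  level \<open>lam < \<lambda>\<^sub>1\<close>: the form \<open>\<integral> (norm \<nabla>u)\<^sup>2 - lam * u\<^sup>2\<close> is coercive there, so a nonnegative \<open>u\<close> with zero
  boundary values and \<open>- \<Delta> u = lam * u + 1\<close> is obtained by minimizing an energy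
  (\<open>torsion_function_exists\<close>), and \<open>w = u + 1 / lam\<close> solves \<open>- \<Delta> w = lam * w\<close> and is bounded away from
  zero (\<open>dual_value_le_inverse\<close>). Letting \<open>lam\<close> increase to \<open>\<lambda>\<^sub>1\<close> closes the gap
  (\<open>inverse_eigenvalue_eq_dual_value\<close>).

  For a positive eigenfunction \<open>U\<close> the same computation is carried out with \<open>U + e\<close> in place of \<open>w\<close> and
  \<open>e \<rightarrow> 0\<close> (\<open>log_gradient_equation\<close>). The logarithmic Caccioppoli estimate
  (\<open>eigenfunction_Caccioppoli\<close>) shows that \<open>DU / U\<close> is locally square-integrable, which both justifies the
  limit and puts the pair into the required spaces. That \<open>\<lambda>\<^sub>1\<close> is finite and positive in this situation is
  \<open>eigenvalue_finite_pos\<close>.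

  Two approximation results make the formal computations rigorous. Smooth test functions are dense among
  \<open>C\<^sup>1\<close> test functions (\<open>Cinf_0_dense_C1_0\<close>, by mollification), so that equations known for the former may be
  tested with the latter; and testing with a function of a Sobolev solution is reduced to its \<open>C\<^sup>1\<close>
  approximations (\<open>equation_tested_with_composite\<close>).\<close>

section \<open>Functions of class \<open>C\<^sup>k\<close> and smooth bumps\<close>

lemma gradient_eqI: "GDERIV f x :> D \<Longrightarrow> gradient f x = D"
  unfolding gradient_def
proof (rule the_equality)
  fix D' assume *: "GDERIV f x :> D" "GDERIV f x :> D'"
  then have "(\<lambda>h. h \<bullet> D) = (\<lambda>h. h \<bullet> D')"
    unfolding gderiv_def by (rule has_derivative_unique)
  then show "D' = D"
    by (metis vector_eq_ldot)
qed auto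

lemma GDERIV_frechet:
  fixes f :: "'a::euclidean_space \<Rightarrow> real"
  assumes "f differentiable (at x)"
  shows "GDERIV f x :> (\<Sum>b\<in>Basis. frechet_derivative f (at x) b *\<^sub>R b)"
proof -
  interpret bounded_linear "frechet_derivative f (at x)"
    using assms by (simp add: frechet_derivative_works has_derivative_bounded_linear)
  have eq: "frechet_derivative f (at x) h = h \<bullet> (\<Sum>b\<in>Basis. frechet_derivative f (at x) b *\<^sub>R b)" for h
  proof -
    have "frechet_derivative f (at x) h = frechet_derivative f (at x) (\<Sum>b\<in>Basis. (h \<bullet> b) *\<^sub>R b)"
      by (simp add: euclidean_representation)
    also have "\<dots> = (\<Sum>b\<in>Basis. (h \<bullet> b) * frechet_derivative f (at x) b)"
      by (simp add: sum scaleR)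
    finally show ?thesis
      by (simp add: inner_sum_right mult.commute)
  qed
  have "(\<lambda>h. h \<bullet> (\<Sum>b\<in>Basis. frechet_derivative f (at x) b *\<^sub>R b)) = frechet_derivative f (at x)"
    by (rule ext) (rule eq[symmetric])
  then show ?thesis
    unfolding gderiv_def using assms frechet_derivative_works by metis
qed

lemma GDERIV_gradient:
  fixes f :: "'a::euclidean_space \<Rightarrow> real"
  assumes "f differentiable (at x)"
  shows "GDERIV f x :> gradient f x"
  using GDERIV_frechet[OF assms] gradient_eqI by metis

lemma frechet_eq_gradient:
  fixes f :: "'a::euclidean_space \<Rightarrow> real"
  assumes "GDERIV f x :> D"
  shows "frechet_derivative f (at x) v = v \<bullet> D"
  using frechet_derivative_at[of f "\<lambda>h. h \<bullet> D" x] assms unfolding gderiv_def by metis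

lemma C1_I:
  fixes f :: "'a::euclidean_space \<Rightarrow> real"
  assumes "\<And>x. GDERIV f x :> D x" "continuous_on UNIV D"
  shows "Ck 1 f" "gradient f = D"
proof -
  have "f differentiable_on UNIV"
    using assms(1) unfolding differentiable_on_def gderiv_def differentiable_def by auto
  moreover have "(\<lambda>x. frechet_derivative f (at x) v) = (\<lambda>x. v \<bullet> D x)" for v
    using frechet_eq_gradient[OF assms(1)] by auto
  ultimately show "Ck 1 f"
    using assms(2) by (auto intro!: continuous_intros)
  show "gradient f = D"
    using gradient_eqI[OF assms(1)] by auto
qed

lemma C1_GDERIV:
  fixes f :: "'a::euclidean_space \<Rightarrow> real"
  assumes "Ck 1 f"
  shows "GDERIV f x :> gradient f x"
  by (rule GDERIV_gradient) (use assms in \<open>auto simp: differentiable_on_def\<close>)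

lemma C1_continuous_gradient:
  fixes f :: "'a::euclidean_space \<Rightarrow> real"
  assumes "Ck 1 f"
  shows "continuous_on S (gradient f)"
proof -
  have "gradient f = (\<lambda>x. \<Sum>b\<in>Basis. frechet_derivative f (at x) b *\<^sub>R b)"
    using assms gradient_eqI[OF GDERIV_frechet]
    by (auto simp: differentiable_on_def)
  then show ?thesis
    using assms by (auto intro!: continuous_intros intro: continuous_on_subset)
qed

lemma Ck_continuous:
  assumes "Ck k f" shows "continuous_on S f"
proof -
  have "continuous_on UNIV f"
    using assms by (cases k) (auto intro: differentiable_imp_continuous_on)
  then show ?thesis by (rule continuous_on_subset) auto
qed

lemma Ck_Suc_D: "Ck (Suc k) f \<Longrightarrow> Ck k f"
proof (induction k arbitrary: f)
  case 0 then show ?case by (simp add: Ck_continuous[of 1])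
next
  case (Suc k) then show ?case by (metis Ck.simps(2))
qed

lemma Ck_const: "Ck k (\<lambda>x::'a::euclidean_space. c)"
  by (induction k arbitrary: c) (auto simp: frechet_derivative_const)

lemma Ck_SucI:
  fixes f :: "'a::real_normed_vector \<Rightarrow> real"
  assumes "\<And>x. (f has_derivative (\<lambda>v. D v x)) (at x)" "\<And>v. Ck k (D v)"
  shows "Ck (Suc k) f"
proof -
  have "frechet_derivative f (at x) v = D v x" for x v
    using frechet_derivative_at[OF assms(1)[of x]] by metis
  then show ?thesis
    using assms by (auto simp: differentiable_on_def differentiable_def)
qed

lemma Ck_Suc_derivative:
  assumes "Ck (Suc k) f"
  shows "(f has_derivative (\<lambda>v. frechet_derivative f (at x) v)) (at x)"
  using assms frechet_derivative_works unfolding Ck.simps differentiable_on_def by auto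

lemma Ck_add: "Ck k f \<Longrightarrow> Ck k g \<Longrightarrow> Ck k (\<lambda>x. f x + g x)"
proof (induction k arbitrary: f g)
  case 0 then show ?case by (auto intro!: continuous_intros)
next
  case (Suc k)
  show ?case
    by (rule Ck_SucI[OF has_derivative_add[OF Suc.prems[THEN Ck_Suc_derivative]]])
       (use Suc in auto)
qed

lemma Ck_mult: "Ck k f \<Longrightarrow> Ck k g \<Longrightarrow> Ck k (\<lambda>x. f x * g x)"
proof (induction k arbitrary: f g)
  case 0 then show ?case by (auto intro!: continuous_intros)
next
  case (Suc k)
  show ?case
    by (rule Ck_SucI[OF has_derivative_mult[OF Suc.prems[THEN Ck_Suc_derivative]]])
       (use Suc Ck_Suc_D[of k] in \<open>auto intro!: Ck_add\<close>)
qed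

lemma Ck_sum: "(\<And>i. i \<in> I \<Longrightarrow> Ck k (f i)) \<Longrightarrow> Ck k (\<lambda>x::'a::euclidean_space. \<Sum>i\<in>I. f i x)"
  by (induction I rule: infinite_finite_induct) (auto intro: Ck_const Ck_add)

lemma Ck_inner: "Ck k (\<lambda>x::'a::euclidean_space. x \<bullet> c)"
proof (cases k)
  case (Suc n)
  show ?thesis unfolding Suc
    by (rule Ck_SucI[where D="\<lambda>v x. v \<bullet> c"]) (auto intro!: derivative_eq_intros Ck_const)
qed (auto intro!: continuous_intros)

text \<open>The outer function is given together with all its derivatives, because the induction on the order
  passes from \<open>g n \<circ> f\<close> to a product with the factor \<open>g (Suc n) \<circ> f\<close>.\<close>

lemma Ck_compose:
  fixes g :: "nat \<Rightarrow> real \<Rightarrow> real"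
  assumes "\<And>n t. (g n has_real_derivative g (Suc n) t) (at t)"
  shows "Ck k f \<Longrightarrow> Ck k (\<lambda>x. g n (f x))"
proof (induction k arbitrary: n)
  case 0
  have "continuous_on UNIV (g n)"
    by (intro continuous_at_imp_continuous_on ballI DERIV_isCont[OF assms])
  with 0 show ?case
    using continuous_on_compose2[of UNIV "g n" UNIV f] by simp
next
  case (Suc k)
  show ?case
  proof (rule Ck_SucI)
    show "((\<lambda>x. g n (f x)) has_derivative
        (\<lambda>v. frechet_derivative f (at x) v * g (Suc n) (f x))) (at x)" for x
      by (rule has_derivative_compose[OF Ck_Suc_derivative[OF Suc.prems]
          assms[unfolded has_field_derivative_def], THEN has_derivative_eq_rhs])
         auto
    show "Ck k (\<lambda>x. frechet_derivative f (at x) v * g (Suc n) (f x))" for v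
      using Suc Ck_Suc_D by (intro Ck_mult) auto
  qed
qed

text \<open>The \<open>n\<close>-th derivative of \<open>exp (-1/t)\<close> on the positive axis is a polynomial in \<open>1/t\<close> times
  \<open>exp (-1/t)\<close>; with \<open>s = 1/t\<close> differentiation turns the polynomial \<open>p s\<close> into
  \<open>s\<^sup>2 * (p s - p' s)\<close>.\<close>

fun bump_poly :: "nat \<Rightarrow> real poly" where
  "bump_poly 0 = 1"
| "bump_poly (Suc n) = [:0,0,1:] * (bump_poly n - pderiv (bump_poly n))"

definition bump_profile :: "nat \<Rightarrow> real \<Rightarrow> real" where
  "bump_profile n t = (if t > 0 then poly (bump_poly n) (1/t) * exp (-(1/t)) else 0)"

lemma poly_exp_tendsto: "((\<lambda>x::real. poly p x * exp (-x)) \<longlongrightarrow> 0) at_top"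
proof -
  have "(\<lambda>x::real. poly p x * exp (-x)) = (\<lambda>x. \<Sum>i\<le>degree p. coeff p i * (x ^ i / exp x))"
    by (auto simp: poly_altdef exp_minus sum_distrib_right divide_inverse mult.assoc)
  moreover have "((\<lambda>x. \<Sum>i\<le>degree p. coeff p i * (x ^ i / exp x)) \<longlongrightarrow> (\<Sum>i\<le>degree p. coeff p i * 0)) at_top"
    by (intro tendsto_intros tendsto_power_div_exp_0)
  ultimately show ?thesis by simp
qed

text \<open>At the origin the difference quotient from the right is \<open>s * p s * exp (-s)\<close> with \<open>s \<rightarrow> \<infinity>\<close>,
  and the exponential beats the polynomial.\<close>

lemma bump_profile_deriv: "(bump_profile n has_real_derivative bump_profile (Suc n) t) (at t)"
proof -
  consider "t > 0" | "t < 0" | "t = 0" by linarith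
  then show ?thesis
  proof cases
    case 1
    have "((\<lambda>t. poly (bump_poly n) (1/t) * exp (-(1/t))) has_real_derivative bump_profile (Suc n) t) (at t)"
      unfolding divide_inverse mult_1
      by (rule DERIV_cong[OF DERIV_mult[OF DERIV_chain2[OF poly_DERIV DERIV_inverse]
              DERIV_chain2[OF DERIV_exp DERIV_minus[OF DERIV_inverse]]]])
        (use 1 in \<open>auto simp: bump_profile_def algebra_simps power2_eq_square divide_inverse\<close>)
    then show ?thesis
      by (rule has_field_derivative_transform_within_open[where S="{0<..}"])
        (use 1 in \<open>auto simp: bump_profile_def\<close>)
  next
    case 2
    have "((\<lambda>t. 0) has_real_derivative bump_profile (Suc n) t) (at t)"
      using 2 by (auto simp: bump_profile_def)
    then show ?thesis
      by (rule has_field_derivative_transform_within_open[where S="{..<0}"])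
        (use 2 in \<open>auto simp: bump_profile_def\<close>)
  next
    case 3
    have "((\<lambda>h. bump_profile n h / h) \<longlongrightarrow> 0) (at_left 0)"
      by (rule tendsto_eventually) (auto simp: bump_profile_def eventually_at_left_field intro!: exI[of _ "-1"])
    moreover have "((\<lambda>h. bump_profile n h / h) \<longlongrightarrow> 0) (at_right 0)"
      unfolding filterlim_at_right_to_top
    proof (rule filterlim_cong[THEN iffD1, OF refl refl _ poly_exp_tendsto[of "pCons 0 (bump_poly n)"]])
      show "\<forall>\<^sub>F x in at_top. poly (pCons 0 (bump_poly n)) x * exp (- x)
          = bump_profile n (inverse x) / inverse x"
        using eventually_gt_at_top[of 0]
        by eventually_elim (auto simp: bump_profile_def field_simps)
    qed
    ultimately have "((\<lambda>h. bump_profile n h / h) \<longlongrightarrow> 0) (at 0)"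
      by (simp add: filterlim_at_split)
    then show ?thesis
      using 3 by (simp add: has_field_derivative_iff bump_profile_def)
  qed
qed

definition bump :: "'a::euclidean_space \<Rightarrow> real \<Rightarrow> 'a \<Rightarrow> real" where
  "bump c r x = bump_profile 0 (r\<^sup>2 - (norm (x - c))\<^sup>2)"

lemma bump_nonneg: "bump c r x \<ge> 0"
  by (auto simp: bump_def bump_profile_def)

lemma bump_pos: "norm (x - c) < r \<Longrightarrow> bump c r x > 0"
  by (auto simp: bump_def bump_profile_def power_strict_mono)

lemma bump_zero: "r \<ge> 0 \<Longrightarrow> norm (x - c) \<ge> r \<Longrightarrow> bump c r x = 0"
  by (auto simp: bump_def bump_profile_def power_mono not_less)

lemma bump_smooth: "Ck k (bump c r)"
proof -
  have eq: "r\<^sup>2 - (norm (x - c))\<^sup>2 = (r\<^sup>2 - c \<bullet> c) + (x \<bullet> (2 *\<^sub>R c) + (\<Sum>b\<in>Basis. (-1) * ((x \<bullet> b) * (x \<bullet> b))))" for x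
  proof -
    have "(\<Sum>b\<in>Basis. (-1) * ((x \<bullet> b) * (x \<bullet> b))) = - (x \<bullet> x)"
      unfolding euclidean_inner[of x x] by (simp add: sum_negf)
    then show ?thesis
      by (simp add: power2_norm_eq_inner inner_diff_left inner_diff_right inner_commute)
  qed
  have "Ck k (\<lambda>x. r\<^sup>2 - (norm (x - c))\<^sup>2)"
    unfolding eq by (intro Ck_add Ck_const Ck_inner Ck_sum Ck_mult)
  then show ?thesis
    unfolding bump_def by (rule Ck_compose[of bump_profile, OF bump_profile_deriv])
qed

section \<open>Test functions\<close>

lemma compactly_supportedI:
  assumes "compact K" "K \<subseteq> \<Omega>" "\<And>x. x \<notin> K \<Longrightarrow> \<psi> x = 0"
  shows "compactly_supported_in \<Omega> \<psi>"
proof -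
  have "closure {x. \<psi> x \<noteq> 0} \<subseteq> K"
    using assms compact_imp_closed by (intro closure_minimal) auto
  moreover from this have "compact (closure {x. \<psi> x \<noteq> 0})"
    using compact_Int_closed[OF assms(1) closed_closure, of "{x. \<psi> x \<noteq> 0}"]
    by (simp add: Int_absorb1)
  ultimately show ?thesis
    using assms(2) unfolding compactly_supported_in_def by simp
qed

lemma compactly_supportedE:
  assumes "compactly_supported_in \<Omega> \<psi>"
  obtains K where "compact K" "K \<subseteq> \<Omega>" "\<And>x. x \<notin> K \<Longrightarrow> \<psi> x = 0"
proof (rule that)
  show "compact (closure {x. \<psi> x \<noteq> 0})" "closure {x. \<psi> x \<noteq> 0} \<subseteq> \<Omega>"
    using assms unfolding compactly_supported_in_def by auto
  show "\<psi> x = 0" if "x \<notin> closure {x. \<psi> x \<noteq> 0}" for x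
    using that closure_subset[of "{x. \<psi> x \<noteq> 0}"] by auto
qed

lemma gradient_zero_outside:
  assumes "closed K" "\<And>x. x \<notin> K \<Longrightarrow> f x = 0" "x \<notin> K"
  shows "gradient f x = 0"
proof (rule gradient_eqI)
  have "((\<lambda>_. 0) has_derivative (\<lambda>h. h \<bullet> 0)) (at x)" by simp
  then show "GDERIV f x :> 0" unfolding gderiv_def
    by (rule has_derivative_transform_within_open[where s="-K"]) (use assms in auto)
qed

lemma C1_0_D:
  assumes "\<psi> \<in> C1_0 \<Omega>"
  shows "Ck 1 \<psi>" "GDERIV \<psi> x :> gradient \<psi> x" "continuous_on S \<psi>" "continuous_on S (gradient \<psi>)"
proof -
  show "Ck 1 \<psi>" using assms unfolding C1_0_def by blast
  then show "GDERIV \<psi> x :> gradient \<psi> x" "continuous_on S \<psi>" "continuous_on S (gradient \<psi>)"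
    by (rule C1_GDERIV, rule Ck_continuous, rule C1_continuous_gradient)
qed

lemma C1_0_E:
  assumes "\<psi> \<in> C1_0 \<Omega>"
  obtains K where "compact K" "K \<subseteq> \<Omega>" "\<And>x. x \<notin> K \<Longrightarrow> \<psi> x = 0" "\<And>x. x \<notin> K \<Longrightarrow> gradient \<psi> x = 0"
proof -
  from assms obtain K where "compact K" "K \<subseteq> \<Omega>" "\<And>x. x \<notin> K \<Longrightarrow> \<psi> x = 0"
    using compactly_supportedE[of \<Omega> \<psi>] unfolding C1_0_def by (metis (lifting) mem_Collect_eq)
  with that[of K] gradient_zero_outside[of K \<psi>] compact_imp_closed show ?thesis by auto
qed

lemma C1_0_I:
  fixes f :: "'a::euclidean_space \<Rightarrow> real"
  assumes "\<And>x. GDERIV f x :> D x" "continuous_on UNIV D"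
    "compact K" "K \<subseteq> \<Omega>" "\<And>x. x \<notin> K \<Longrightarrow> f x = 0"
  shows "f \<in> C1_0 \<Omega>" "gradient f = D"
  using C1_I[OF assms(1,2)] compactly_supportedI[OF assms(3-5)] by (auto simp: C1_0_def)

lemma Cinf_0_subset: "Cinf_0 \<Omega> \<subseteq> C1_0 \<Omega>"
  unfolding Cinf_0_def C1_0_def by blast

lemma compact_support_bounded:
  fixes f :: "'a::euclidean_space \<Rightarrow> 'b::real_normed_vector"
  assumes "compact K" "\<And>x. x \<notin> K \<Longrightarrow> f x = 0" "continuous_on UNIV f"
  obtains B where "B > 0" "\<And>x. norm (f x) \<le> B"
proof -
  have "bounded (f ` K)"
    using assms by (intro compact_imp_bounded compact_continuous_image)
      (auto intro: continuous_on_subset)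
  then obtain B where "B > 0" "\<forall>x\<in>K. norm (f x) \<le> B"
    by (auto simp: bounded_pos)
  then show ?thesis
    using that[of B] assms(2) by (metis less_imp_le norm_zero)
qed

lemma C1_0_bounded:
  assumes "\<psi> \<in> C1_0 \<Omega>"
  obtains B where "B > 0" "\<And>x. \<bar>\<psi> x\<bar> \<le> B" "\<And>x. norm (gradient \<psi> x) \<le> B"
proof -
  from C1_0_E[OF assms] obtain K where K: "compact K" "K \<subseteq> \<Omega>" "\<And>x. x \<notin> K \<Longrightarrow> \<psi> x = 0" "\<And>x. x \<notin> K \<Longrightarrow> gradient \<psi> x = 0"
    by metis
  obtain B1 where "B1 > 0" "\<And>x. norm (\<psi> x) \<le> B1"
    using compact_support_bounded[of K \<psi>] K C1_0_D(3)[OF assms] by metis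
  moreover obtain B2 where "B2 > 0" "\<And>x. norm (gradient \<psi> x) \<le> B2"
    using compact_support_bounded[of K "gradient \<psi>"] K C1_0_D(4)[OF assms] by metis
  ultimately show ?thesis
    using that[of "max B1 B2"] by (auto simp: max.coboundedI1 max.coboundedI2)
qed

text \<open>The condition \<open>g 0 = 0\<close> keeps the support compact.\<close>

lemma C1_0_compose:
  assumes "\<psi> \<in> C1_0 \<Omega>" "\<And>t. (g has_real_derivative g' t) (at t)" "continuous_on UNIV g'"
    and "\<eta> = (\<lambda>x. g (\<psi> x))" "g 0 = 0"
  shows "\<eta> \<in> C1_0 \<Omega>" "gradient \<eta> = (\<lambda>x. g' (\<psi> x) *\<^sub>R gradient \<psi> x)"
proof -
  from C1_0_E[OF assms(1)] obtain K where K: "compact K" "K \<subseteq> \<Omega>" "\<And>x. x \<notin> K \<Longrightarrow> \<psi> x = 0" by metis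
  have 1: "GDERIV \<eta> x :> g' (\<psi> x) *\<^sub>R gradient \<psi> x" for x
    unfolding assms(4) by (intro GDERIV_DERIV_compose assms C1_0_D(2)[OF assms(1)])
  have 2: "continuous_on UNIV (\<lambda>x. g' (\<psi> x) *\<^sub>R gradient \<psi> x)"
    by (intro continuous_intros continuous_on_compose2[OF assms(3)] C1_0_D(3,4)[OF assms(1)]) auto
  show "\<eta> \<in> C1_0 \<Omega>" "gradient \<eta> = (\<lambda>x. g' (\<psi> x) *\<^sub>R gradient \<psi> x)"
    using C1_0_I[OF 1 2 K(1,2)] K(3) assms(4,5) by auto
qed

lemma C1_mult_C1_0:
  assumes "\<psi> \<in> C1_0 \<Omega>" "Ck 1 f"
  shows "(\<lambda>x. \<psi> x * f x) \<in> C1_0 \<Omega>"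
    "gradient (\<lambda>x. \<psi> x * f x) = (\<lambda>x. \<psi> x *\<^sub>R gradient f x + f x *\<^sub>R gradient \<psi> x)"
proof -
  from C1_0_E[OF assms(1)] obtain K where K: "compact K" "K \<subseteq> \<Omega>" "\<And>x. x \<notin> K \<Longrightarrow> \<psi> x = 0" by metis
  have 1: "GDERIV (\<lambda>x. \<psi> x * f x) x :> \<psi> x *\<^sub>R gradient f x + f x *\<^sub>R gradient \<psi> x" for x
    by (intro GDERIV_mult C1_GDERIV assms C1_0_D(2)[OF assms(1)])
  have 2: "continuous_on UNIV (\<lambda>x. \<psi> x *\<^sub>R gradient f x + f x *\<^sub>R gradient \<psi> x)"
    by (intro continuous_intros C1_continuous_gradient Ck_continuous[OF assms(2)] assms C1_0_D(3,4)[OF assms(1)])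
  show "(\<lambda>x. \<psi> x * f x) \<in> C1_0 \<Omega>"
    "gradient (\<lambda>x. \<psi> x * f x) = (\<lambda>x. \<psi> x *\<^sub>R gradient f x + f x *\<^sub>R gradient \<psi> x)"
    using C1_0_I[OF 1 2 K(1,2)] K(3) by auto
qed

lemma C1_0_lincomb:
  assumes "\<psi> \<in> C1_0 \<Omega>" "\<eta> \<in> C1_0 \<Omega>"
  shows "(\<lambda>x. a * \<psi> x + b * \<eta> x) \<in> C1_0 \<Omega>"
    "gradient (\<lambda>x. a * \<psi> x + b * \<eta> x) = (\<lambda>x. a *\<^sub>R gradient \<psi> x + b *\<^sub>R gradient \<eta> x)"
proof -
  from C1_0_E[OF assms(1)] obtain K where K: "compact K" "K \<subseteq> \<Omega>" "\<And>x. x \<notin> K \<Longrightarrow> \<psi> x = 0" by metis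
  from C1_0_E[OF assms(2)] obtain L where L: "compact L" "L \<subseteq> \<Omega>" "\<And>x. x \<notin> L \<Longrightarrow> \<eta> x = 0" by metis
  have 1: "GDERIV (\<lambda>x. a * \<psi> x + b * \<eta> x) x :> a *\<^sub>R gradient \<psi> x + b *\<^sub>R gradient \<eta> x" for x
    using C1_0_D(2)[OF assms(1), of x] C1_0_D(2)[OF assms(2), of x]
    unfolding gderiv_def by (auto intro!: derivative_eq_intros simp: inner_add_right)
  have 2: "continuous_on UNIV (\<lambda>x. a *\<^sub>R gradient \<psi> x + b *\<^sub>R gradient \<eta> x)"
    by (intro continuous_intros C1_0_D(4)[OF assms(1)] C1_0_D(4)[OF assms(2)])
  show "(\<lambda>x. a * \<psi> x + b * \<eta> x) \<in> C1_0 \<Omega>"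
    "gradient (\<lambda>x. a * \<psi> x + b * \<eta> x) = (\<lambda>x. a *\<^sub>R gradient \<psi> x + b *\<^sub>R gradient \<eta> x)"
    using C1_0_I[OF 1 2, of "K \<union> L" \<Omega>] K L by (auto simp: compact_Un)
qed

text \<open>Finitely many bumps centred in \<open>K\<close> add up to a function that is positive on \<open>K\<close>, hence bounded
  below there by compactness; dividing by that bound gives the cutoff.\<close>

lemma cutoff_exists:
  fixes \<Omega> :: "'a::euclidean_space set"
  assumes "open \<Omega>" "compact K" "K \<subseteq> \<Omega>"
  obtains \<kappa> where "\<kappa> \<in> C1_0 \<Omega>" "\<And>x. x \<in> K \<Longrightarrow> \<kappa> x \<ge> 1"
proof -
  obtain d where d: "d > 0" "(\<Union>x\<in>K. cball x d) \<subseteq> \<Omega>"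
    using compact_subset_open_imp_cball_epsilon_subset[OF assms(2,1,3)] by blast
  have "K \<subseteq> (\<Union>c\<in>K. ball c d)" using d by auto
  then obtain C where C: "C \<subseteq> K" "finite C" "K \<subseteq> (\<Union>c\<in>C. ball c d)"
    by (rule compactE_image[OF assms(2), of K "\<lambda>c. ball c d", rotated]) auto
  define \<sigma> where "\<sigma> x = (\<Sum>c\<in>C. bump c d x)" for x
  have \<sigma>C: "Ck k \<sigma>" for k unfolding \<sigma>_def[abs_def] by (intro Ck_sum bump_smooth)
  have \<sigma>pos: "\<sigma> x > 0" if x: "x \<in> K" for x
  proof -
    obtain c where c: "c \<in> C" "x \<in> ball c d" using C(3) x by auto
    have "0 < bump c d x" using c(2) by (intro bump_pos) (simp add: dist_norm norm_minus_commute)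
    also have "\<dots> \<le> \<sigma> x" unfolding \<sigma>_def using C(2) c(1) by (intro member_le_sum) (auto simp: bump_nonneg)
    finally show ?thesis .
  qed
  have "\<exists>b>0. \<forall>x\<in>K. \<sigma> x \<ge> b"
  proof (cases "K = {}")
    case False
    obtain z where "z \<in> K" "\<forall>x\<in>K. \<sigma> z \<le> \<sigma> x"
      using continuous_attains_inf[OF assms(2) False Ck_continuous[OF \<sigma>C]] by blast
    then show ?thesis using \<sigma>pos by blast
  qed (auto intro: exI[of _ 1])
  then obtain b where b: "b > 0" "\<And>x. x \<in> K \<Longrightarrow> \<sigma> x \<ge> b" by blast
  define \<kappa> where "\<kappa> = (\<lambda>x. (1 / b) * \<sigma> x)"
  have "Ck 1 \<kappa>" unfolding \<kappa>_def by (rule Ck_mult[OF Ck_const \<sigma>C])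
  moreover have "compactly_supported_in \<Omega> \<kappa>"
  proof (rule compactly_supportedI)
    show "compact (\<Union>c\<in>C. cball c d)" using C(2) by (intro compact_UN) auto
    show "(\<Union>c\<in>C. cball c d) \<subseteq> \<Omega>" using d(2) C(1) by blast
    fix x assume x: "x \<notin> (\<Union>c\<in>C. cball c d)"
    have "bump c d x = 0" if "c \<in> C" for c
      using x that d(1) by (intro bump_zero) (auto simp: dist_norm norm_minus_commute)
    then show "\<kappa> x = 0" by (simp add: \<kappa>_def \<sigma>_def)
  qed
  ultimately have "\<kappa> \<in> C1_0 \<Omega>" unfolding C1_0_def by blast
  moreover have "\<kappa> x \<ge> 1" if "x \<in> K" for x using b(2)[OF that] b(1) by (simp add: \<kappa>_def field_simps)
  ultimately show ?thesis by (rule that)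
qed

section \<open>Integration by parts\<close>

lemma integrable_compact_support:
  fixes f :: "'a::euclidean_space \<Rightarrow> 'b::euclidean_space"
  assumes "compact K" "\<And>x. x \<notin> K \<Longrightarrow> f x = 0" "continuous_on UNIV f"
  shows "integrable lborel f"
proof -
  have "(\<lambda>x. indicator K x *\<^sub>R f x) = f"
    using assms(2) by (auto simp: indicator_def)
  then show ?thesis
    using borel_integrable_compact[OF assms(1), of f] assms(3) continuous_on_subset by fastforce
qed

lemma integral_lborel_translate:
  fixes f :: "'a::euclidean_space \<Rightarrow> 'b::euclidean_space"
  assumes "f \<in> borel_measurable borel"
  shows "(\<integral>x. f (c + x) \<partial>lborel) = (\<integral>x. f x \<partial>lborel)"
  using integral_distr[of "(+) c" lborel borel f] assms by (simp add: lborel_distr_plus)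

lemma C1_lipschitz:
  fixes f :: "'a::euclidean_space \<Rightarrow> real"
  assumes "\<And>x. GDERIV f x :> D x" "\<And>x. norm (D x) \<le> B"
  shows "\<bar>f y - f x\<bar> \<le> B * norm (y - x)"
proof -
  have "norm (f y - f x) \<le> B * norm (y - x)"
  proof (rule differentiable_bound[of UNIV])
    show "(f has_derivative (\<lambda>h. h \<bullet> D z)) (at z within UNIV)" for z
      using assms(1) by (simp add: gderiv_def)
    show "onorm (\<lambda>h. h \<bullet> D z) \<le> B" for z
    proof (rule onorm_le)
      fix h show "norm (h \<bullet> D z) \<le> B * norm h"
        using Cauchy_Schwarz_ineq2[of h "D z"] mult_right_mono[OF assms(2), of "norm h" z]
        by (simp add: mult.commute)
    qed
  qed auto
  then show ?thesis by simp
qed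

text \<open>Translation invariance makes the integral of every difference quotient of \<open>f\<close> vanish. The quotients
  in direction \<open>v\<close> converge to \<open>v \<bullet> gradient f\<close> and are dominated by a multiple of the indicator of a
  ball, since \<open>f\<close> is Lipschitz with compact support.\<close>

lemma integral_gradient_zero:
  fixes f :: "'a::euclidean_space \<Rightarrow> real"
  assumes "f \<in> C1_0 \<Omega>"
  shows "integrable lborel (gradient f)" "(\<integral>x. gradient f x \<partial>lborel) = 0"
proof -
  from C1_0_E[OF assms] obtain K where K: "compact K" "\<And>x. x \<notin> K \<Longrightarrow> f x = 0" "\<And>x. x \<notin> K \<Longrightarrow> gradient f x = 0" by metis
  obtain B where B: "\<And>x. norm (gradient f x) \<le> B" "B > 0"
    using C1_0_bounded[OF assms] by metis
  note D = C1_0_D[OF assms]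
  have fi: "integrable lborel f" using integrable_compact_support[OF K(1,2) D(3)] .
  show gi: "integrable lborel (gradient f)" using integrable_compact_support[OF K(1,3) D(4)] .
  have fm[measurable]: "f \<in> borel_measurable borel" "gradient f \<in> borel_measurable borel"
    using D(3,4) by (auto intro: borel_measurable_continuous_onI)
  obtain R where R: "\<And>x. x \<in> K \<Longrightarrow> norm x \<le> R"
    using compact_imp_bounded[OF K(1)] unfolding bounded_iff by auto
  have "v \<bullet> (\<integral>x. gradient f x \<partial>lborel) = 0" for v
  proof -
    define q where "q n x = real (Suc n) * (f ((1 / real (Suc n)) *\<^sub>R v + x) - f x)" for n x
    have q0: "(\<integral>x. q n x \<partial>lborel) = 0" for n
    proof -
      have "integrable lborel (\<lambda>x. f ((1 / real (Suc n)) *\<^sub>R v + x))"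
        using integrable_distr[of "(+) ((1 / real (Suc n)) *\<^sub>R v)" lborel borel f] fi
        by (simp add: lborel_distr_plus)
      then show ?thesis
        using fi integral_lborel_translate[OF fm(1)] by (simp add: q_def)
    qed
    have "(\<lambda>n. \<integral>x. q n x \<partial>lborel) \<longlonglongrightarrow> (\<integral>x. v \<bullet> gradient f x \<partial>lborel)"
    proof (rule integral_dominated_convergence[where w="\<lambda>x. indicator (cball 0 (R + norm v)) x *\<^sub>R (B * norm v)"])
      show "integrable lborel (\<lambda>x::'a. indicator (cball 0 (R + norm v)) x *\<^sub>R (B * norm v))"
        by (rule borel_integrable_compact) auto
      show "AE x in lborel. norm (q n x) \<le> indicator (cball 0 (R + norm v)) x *\<^sub>R (B * norm v)" for n
      proof (rule AE_I2)
        fix x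
        show "norm (q n x) \<le> indicator (cball 0 (R + norm v)) x *\<^sub>R (B * norm v)"
        proof (cases "norm x \<le> R + norm v")
          case True
          have "\<bar>q n x\<bar> \<le> real (Suc n) * (B * norm ((1 / real (Suc n)) *\<^sub>R v))"
            using C1_lipschitz[OF D(2) B(1), of "(1 / real (Suc n)) *\<^sub>R v + x" x]
            unfolding q_def abs_mult by (intro mult_mono) auto
          also have "\<dots> = B * norm v" by (simp add: field_simps)
          finally show ?thesis using True by simp
        next
          case False
          have "norm v * (1 / real (Suc n)) \<le> norm v"
            by (rule mult_left_le) auto
          then have "norm ((1 / real (Suc n)) *\<^sub>R v) \<le> norm v"
            by (simp add: divide_inverse mult.commute)
          moreover have "norm x \<le> norm ((1 / real (Suc n)) *\<^sub>R v + x) + norm ((1 / real (Suc n)) *\<^sub>R v)"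
            by (metis add_diff_cancel_left' norm_triangle_ineq4)
          ultimately have "R < norm ((1 / real (Suc n)) *\<^sub>R v + x)" 
            using False by linarith
          moreover have "R < norm x" using False norm_ge_zero[of v] by linarith
          ultimately have "f ((1 / real (Suc n)) *\<^sub>R v + x) = 0" "f x = 0"
            using K(2) R by (meson leD)+
          then show ?thesis using B(2) by (simp add: q_def)
        qed
      qed
      show "AE x in lborel. (\<lambda>n. q n x) \<longlonglongrightarrow> v \<bullet> gradient f x"
      proof (rule AE_I2)
        fix x
        have "((\<lambda>t. f (x + t *\<^sub>R v)) has_derivative (\<lambda>t. (t *\<^sub>R v) \<bullet> gradient f (x + 0 *\<^sub>R v))) (at 0)"
          by (rule has_derivative_compose[of "\<lambda>t. x + t *\<^sub>R v", OF _ D(2)[unfolded gderiv_def]])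
            (auto intro!: derivative_eq_intros)
        then have "((\<lambda>t. f (x + t *\<^sub>R v)) has_real_derivative v \<bullet> gradient f x) (at 0)"
          by (simp add: has_field_derivative_def mult_commute_abs)
        then have 1: "(\<lambda>t. (f (x + t *\<^sub>R v) - f x) / t) \<midarrow>0\<rightarrow> v \<bullet> gradient f x"
          by (simp add: has_field_derivative_iff)
        have "filterlim (\<lambda>n. 1 / real (Suc n)) (at 0) sequentially"
          using LIMSEQ_inverse_real_of_nat unfolding filterlim_at by (auto simp: divide_inverse)
        from filterlim_compose[OF 1 this] show "(\<lambda>n. q n x) \<longlonglongrightarrow> v \<bullet> gradient f x"
          by (simp add: q_def add.commute mult.commute)
      qed
    qed (auto simp: q_def)
    then have "(\<integral>x. v \<bullet> gradient f x \<partial>lborel) = 0"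
      using q0 LIMSEQ_unique[OF tendsto_const] by fastforce
    then show ?thesis using gi by simp
  qed
  then show "(\<integral>x. gradient f x \<partial>lborel) = 0"
    by (metis inner_eq_zero_iff)
qed

lemma integration_by_parts_lborel:
  fixes \<psi> f :: "'a::euclidean_space \<Rightarrow> real"
  assumes "\<psi> \<in> C1_0 \<Omega>" "Ck 1 f"
  shows "(\<integral>x. f x *\<^sub>R gradient \<psi> x \<partial>lborel) = - (\<integral>x. \<psi> x *\<^sub>R gradient f x \<partial>lborel)"
proof -
  from C1_0_E[OF assms(1)] obtain K where K: "compact K" "\<And>x. x \<notin> K \<Longrightarrow> \<psi> x = 0" "\<And>x. x \<notin> K \<Longrightarrow> gradient \<psi> x = 0" by metis
  have "integrable lborel (\<lambda>x. f x *\<^sub>R gradient \<psi> x)" "integrable lborel (\<lambda>x. \<psi> x *\<^sub>R gradient f x)"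
    by (rule integrable_compact_support[OF K(1)]; 
        use K C1_0_D[OF assms(1)] C1_continuous_gradient[OF assms(2)] Ck_continuous[OF assms(2)] in
        \<open>auto intro!: continuous_intros\<close>)+
  then show ?thesis
    using integral_gradient_zero(2)[OF C1_mult_C1_0(1)[OF assms]]
    by (simp add: C1_mult_C1_0(2)[OF assms] add_eq_0_iff)
qed

lemma integral_lebesgue_on_eq_lborel:
  fixes g :: "'a::euclidean_space \<Rightarrow> 'b::euclidean_space"
  assumes "open \<Omega>" "continuous_on UNIV g" "\<And>x. x \<notin> \<Omega> \<Longrightarrow> g x = 0"
  shows "(\<integral>x. g x \<partial>lebesgue_on \<Omega>) = (\<integral>x. g x \<partial>lborel)"
proof -
  have "(\<integral>x. g x \<partial>lebesgue_on \<Omega>) = (\<integral>x. (if x \<in> \<Omega> then g x else 0) \<partial>lebesgue)"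
    using assms(1) by (intro Lebesgue_Measure.integral_restrict_UNIV[symmetric]) auto
  also have "(\<lambda>x. if x \<in> \<Omega> then g x else 0) = g"
    using assms(3) by auto
  finally show ?thesis
    using assms(2) by (simp add: integral_completion borel_measurable_continuous_onI)
qed

lemma integration_by_parts:
  fixes \<psi> f :: "'a::euclidean_space \<Rightarrow> real"
  assumes "open \<Omega>" "\<psi> \<in> C1_0 \<Omega>" "Ck 1 f"
  shows "(\<integral>x. f x *\<^sub>R gradient \<psi> x \<partial>lebesgue_on \<Omega>) = - (\<integral>x. \<psi> x *\<^sub>R gradient f x \<partial>lebesgue_on \<Omega>)"
proof -
  have z: "x \<notin> \<Omega> \<Longrightarrow> \<psi> x = 0 \<and> gradient \<psi> x = 0" for x
    using C1_0_E[OF assms(2)] by (metis subsetD)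
  have 1: "(\<integral>x. f x *\<^sub>R gradient \<psi> x \<partial>lebesgue_on \<Omega>) = (\<integral>x. f x *\<^sub>R gradient \<psi> x \<partial>lborel)"
    by (rule integral_lebesgue_on_eq_lborel[OF assms(1)])
      (use z in \<open>auto intro!: continuous_intros C1_0_D(4)[OF assms(2)] Ck_continuous[OF assms(3)]\<close>)
  have 2: "(\<integral>x. \<psi> x *\<^sub>R gradient f x \<partial>lebesgue_on \<Omega>) = (\<integral>x. \<psi> x *\<^sub>R gradient f x \<partial>lborel)"
    by (rule integral_lebesgue_on_eq_lborel[OF assms(1)])
      (use z in \<open>auto intro!: continuous_intros C1_0_D(3)[OF assms(2)] C1_continuous_gradient[OF assms(3)]\<close>)
  show ?thesis
    unfolding 1 2 by (rule integration_by_parts_lborel[OF assms(2,3)])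
qed

section \<open>Mollification\<close>

text \<open>Differentiation under the integral sign. The support of \<open>\<psi>\<close> restricts the integral to a box, where
  the Leibniz rule for the gauge integral applies; all derivatives fall on the kernel \<open>w\<close>.\<close>

lemma convolution_has_derivative:
  fixes \<psi> w :: "'a::euclidean_space \<Rightarrow> real"
  assumes K: "compact K" "\<And>x. x \<notin> K \<Longrightarrow> \<psi> x = 0" and c: "continuous_on UNIV \<psi>" and w: "Ck 1 w"
  shows "((\<lambda>x. \<integral>y. \<psi> y * w (x - y) \<partial>lborel) has_derivative
          (\<lambda>v. \<integral>y. \<psi> y * (v \<bullet> gradient w (x - y)) \<partial>lborel)) (at x)"
proof -
  obtain a b where ab: "K \<subseteq> cbox a b"
    using bounded_subset_cbox_symmetric[OF compact_imp_bounded[OF K(1)]] by metis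
  have wc: "continuous_on S w" "continuous_on S (gradient w)" for S
    by (rule Ck_continuous[OF w], rule C1_continuous_gradient[OF w])
  have to_HK: "(\<integral>y. \<psi> y * k y \<partial>lborel) = integral (cbox a b) (\<lambda>y. \<psi> y * k y)"
    if "continuous_on UNIV k" for k :: "'a \<Rightarrow> real"
  proof -
    have "integrable lborel (\<lambda>y. \<psi> y * k y)"
      by (rule integrable_compact_support[OF K(1)]) (use that K c in \<open>auto intro!: continuous_intros\<close>)
    then have "(\<integral>y. \<psi> y * k y \<partial>lborel) = integral UNIV (\<lambda>y. \<psi> y * k y)"
      by (rule integral_lborel[symmetric])
    also have "\<dots> = integral UNIV (\<lambda>y. if y \<in> cbox a b then \<psi> y * k y else 0)"
      by (rule Henstock_Kurzweil_Integration.integral_cong) (use K(2) ab in auto)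
    also have "\<dots> = integral (cbox a b) (\<lambda>y. \<psi> y * k y)"
      by (rule Henstock_Kurzweil_Integration.integral_restrict_UNIV)
    finally show ?thesis .
  qed
  define D where "D x y = blinfun_inner_left (\<psi> y *\<^sub>R gradient w (x - y))" for x y
  have Dc: "continuous_on S (\<lambda>(x, y). D x y)" for S
    unfolding D_def split_beta
    by (intro bounded_linear.continuous_on[OF bounded_linear_blinfun_inner_left] continuous_intros
        continuous_on_compose2[OF c] continuous_on_compose2[OF wc(2)[of UNIV]]) auto
  have Dc': "D x integrable_on cbox a b"
    unfolding D_def
    by (intro integrable_continuous bounded_linear.continuous_on[OF bounded_linear_blinfun_inner_left]
        continuous_intros
        continuous_on_compose2[OF c] continuous_on_compose2[OF wc(2)[of UNIV]]) auto
  have "((\<lambda>x. integral (cbox a b) (\<lambda>y. \<psi> y * w (x - y))) has_derivative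
      blinfun_apply (integral (cbox a b) (D x))) (at x within UNIV)"
  proof (rule leibniz_rule)
    fix x y
    show "((\<lambda>x. \<psi> y * w (x - y)) has_derivative blinfun_apply (D x y)) (at x within UNIV)"
      unfolding D_def
      by (rule has_derivative_compose[of "\<lambda>x. x - y" "\<lambda>v. v", OF _ C1_GDERIV[OF w, unfolded gderiv_def],
           THEN has_derivative_mult_right, THEN has_derivative_eq_rhs])
         (auto intro!: derivative_eq_intros)
    show "(\<lambda>y. \<psi> y * w (x - y)) integrable_on cbox a b"
      by (intro integrable_continuous continuous_intros continuous_on_compose2[OF c]
          continuous_on_compose2[OF wc(1)[of UNIV]]) auto
  qed (auto simp: Dc)
  moreover have "blinfun_apply (integral (cbox a b) (D x)) = (\<lambda>v. \<integral>y. \<psi> y * (v \<bullet> gradient w (x - y)) \<partial>lborel)"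
  proof
    fix v
    show "blinfun_apply (integral (cbox a b) (D x)) v = (\<integral>y. \<psi> y * (v \<bullet> gradient w (x - y)) \<partial>lborel)"
      by (subst blinfun_apply_integral[OF Dc'], subst to_HK)
        (auto simp: D_def intro!: continuous_intros continuous_on_compose2[OF wc(2)[of UNIV]])
  qed
  moreover have "(\<integral>y. \<psi> y * w (x - y) \<partial>lborel) = integral (cbox a b) (\<lambda>y. \<psi> y * w (x - y))" for x
    by (rule to_HK) (auto intro!: continuous_intros continuous_on_compose2[OF wc(1)[of UNIV]])
  ultimately show ?thesis by simp
qed

text \<open>The derivative of the convolution in direction \<open>v\<close> is the convolution with the smooth kernel
  \<open>v \<bullet> gradient w\<close>, so the induction on the order generalises over the kernel.\<close>

lemma convolution_smooth:
  fixes \<psi> w :: "'a::euclidean_space \<Rightarrow> real"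
  assumes K: "compact K" "\<And>x. x \<notin> K \<Longrightarrow> \<psi> x = 0" and c: "continuous_on UNIV \<psi>"
  shows "(\<And>j. Ck j w) \<Longrightarrow> Ck k (\<lambda>x. \<integral>y. \<psi> y * w (x - y) \<partial>lborel)"
proof (induction k arbitrary: w)
  case 0
  have "isCont (\<lambda>x. \<integral>y. \<psi> y * w (x - y) \<partial>lborel) x" for x
    using convolution_has_derivative[OF K c 0] has_derivative_continuous by blast
  then show ?case by (simp add: continuous_at_imp_continuous_on)
next
  case (Suc k)
  have 1: "frechet_derivative w (at x) v = v \<bullet> gradient w x" for x v
    using frechet_eq_gradient[OF C1_GDERIV[OF Suc.prems]] .
  have "Ck j (\<lambda>x. v \<bullet> gradient w x)" for v j
    using Suc.prems[of "Suc j"] unfolding Ck.simps 1 by blast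
  from Suc.IH[OF this] show ?case
    by (intro Ck_SucI[OF convolution_has_derivative[OF K c Suc.prems]])
qed

definition mollifier :: "real \<Rightarrow> 'a::euclidean_space \<Rightarrow> real" where
  "mollifier r x = bump 0 r x / (integral\<^sup>L lborel (bump (0::'a) r))"

context
  fixes r :: real
  assumes r: "r > 0"
begin

lemma mollifier_smooth: "Ck k (mollifier r)"
  using Ck_mult[OF Ck_const bump_smooth, of k "inverse (integral\<^sup>L lborel (bump (0::'a) r))" 0 r]
  by (simp add: mollifier_def[abs_def] divide_inverse mult.commute)

lemma mollifier_outside: "norm x \<ge> r \<Longrightarrow> mollifier r x = 0"
  using bump_zero[of r x 0] r by (simp add: mollifier_def)

lemma bump_integrable: "integrable lborel (bump (0::'a::euclidean_space) r)"
  by (rule integrable_compact_support[of "cball 0 r"])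
    (use r Ck_continuous[OF bump_smooth[of 0]] in \<open>auto intro!: bump_zero\<close>)

lemma bump_integral_pos: "(integral\<^sup>L lborel (bump (0::'a::euclidean_space) r)) > 0"
proof -
  have "(integral\<^sup>L lborel (bump (0::'a) r)) \<noteq> 0"
  proof
    assume "(integral\<^sup>L lborel (bump (0::'a) r)) = 0"
    then have "AE y::'a in lborel. bump 0 r y = 0"
      using integral_nonneg_eq_0_iff_AE[OF bump_integrable] bump_nonneg by auto
    then have "AE y::'a in lborel. y \<notin> ball 0 r"
      by eventually_elim (metis bump_pos diff_zero less_irrefl mem_ball_0)
    then have "ball (0::'a) r \<in> null_sets lborel"
      by (subst AE_iff_null_sets) auto
    then have "negligible (ball (0::'a) r)"
      by (simp add: negligible_iff_null_sets null_sets_completionI)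
    then show False
      using r open_not_negligible[of "ball (0::'a) r"] by simp
  qed
  moreover have "(integral\<^sup>L lborel (bump (0::'a) r)) \<ge> 0"
    by (simp add: bump_nonneg)
  ultimately show ?thesis by simp
qed

lemma mollifier_nonneg: "mollifier r (x::'a::euclidean_space) \<ge> 0"
  unfolding mollifier_def using bump_nonneg bump_integral_pos[where 'a='a]
  by (rule divide_nonneg_pos)

lemma mollifier_integral:
  "integrable lborel (\<lambda>y. mollifier r (x - y::'a::euclidean_space))"
  "(\<integral>y. mollifier r (x - y::'a) \<partial>lborel) = 1"
proof -
  have sym: "mollifier r (x - y) = mollifier r (- x + y)" for y
    by (simp add: mollifier_def bump_def norm_minus_commute)
  have mi: "integrable lborel (mollifier r :: 'a \<Rightarrow> real)"
    unfolding mollifier_def[abs_def] using bump_integrable by auto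
  show "integrable lborel (\<lambda>y. mollifier r (x - y))"
    unfolding sym using mi integrable_distr[of "(+) (-x)" lborel borel "mollifier r"] by (simp add: lborel_distr_plus)
  have "(\<integral>y. mollifier r (x - y) \<partial>lborel) = (\<integral>y. mollifier r y \<partial>(lborel :: 'a measure))"
    unfolding sym using mi by (intro integral_lborel_translate) auto
  also have "\<dots> = 1"
    using bump_integral_pos[where 'a='a] by (simp add: mollifier_def)
  finally show "(\<integral>y. mollifier r (x - y) \<partial>lborel) = 1" .
qed

lemma mollify_close:
  fixes f :: "'a::euclidean_space \<Rightarrow> 'b::euclidean_space"
  assumes K: "compact K" "\<And>x. x \<notin> K \<Longrightarrow> f x = 0" and c: "continuous_on UNIV f"
    and e: "\<And>x y. norm (x - y) < r \<Longrightarrow> norm (f y - f x) \<le> e"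
  shows "norm ((\<integral>y. mollifier r (x - y) *\<^sub>R f y \<partial>lborel) - f x) \<le> e"
proof -
  have mc: "continuous_on UNIV (mollifier r :: 'a \<Rightarrow> real)"
    using mollifier_smooth Ck_continuous by blast
  have 1: "integrable lborel (\<lambda>y. mollifier r (x - y) *\<^sub>R f y)"
    by (rule integrable_compact_support[OF K(1)])
      (use K c in \<open>auto intro!: continuous_intros continuous_on_compose2[OF mc]\<close>)
  have "(\<integral>y. mollifier r (x - y) *\<^sub>R f y \<partial>lborel) - f x =
     (\<integral>y. mollifier r (x - y) *\<^sub>R f y \<partial>lborel) - (\<integral>y. mollifier r (x - y) *\<^sub>R f x \<partial>lborel)"
    using mollifier_integral[of x] by simp
  also have "\<dots> = (\<integral>y. mollifier r (x - y) *\<^sub>R (f y - f x) \<partial>lborel)"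
    using 1 mollifier_integral(1)[of x] by (simp add: scaleR_diff_right)
  also have "norm \<dots> \<le> (\<integral>y. mollifier r (x - y) * e \<partial>lborel)"
  proof (rule Bochner_Integration.integral_norm_bound_integral)
    show "integrable lborel (\<lambda>y. mollifier r (x - y) *\<^sub>R (f y - f x))"
      using 1 mollifier_integral(1)[of x] by (simp add: scaleR_diff_right)
    show "norm (mollifier r (x - y) *\<^sub>R (f y - f x)) \<le> mollifier r (x - y) * e" for y
      using e[of x y] mollifier_outside[of "x - y"] mollifier_nonneg[of "x - y"]
      by (cases "norm (x - y) < r") (auto intro: mult_left_mono)
  qed (use mollifier_integral(1)[of x] in auto)
  also have "\<dots> = e" using mollifier_integral[of x] by simp
  finally show ?thesis .
qed

end

lemma compact_support_uniformly_continuous: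
  fixes f :: "'a::euclidean_space \<Rightarrow> 'b::real_normed_vector"
  assumes K: "compact K" "\<And>x. x \<notin> K \<Longrightarrow> f x = 0" and c: "continuous_on UNIV f" and "e > 0"
  obtains d where "d > 0" "\<And>x y. norm (x - y) < d \<Longrightarrow> norm (f y - f x) < e"
proof -
  obtain R where R: "\<And>x. x \<in> K \<Longrightarrow> norm x \<le> R"
    using compact_imp_bounded[OF K(1)] unfolding bounded_iff by auto
  have "uniformly_continuous_on (cball 0 (R+1)) f"
    by (rule compact_uniformly_continuous) (use c continuous_on_subset in auto)
  then obtain d where d: "d > 0" "\<And>x y. x \<in> cball 0 (R+1) \<Longrightarrow> y \<in> cball 0 (R+1) \<Longrightarrow> dist y x < d \<Longrightarrow> dist (f y) (f x) < e"
    unfolding uniformly_continuous_on_def using \<open>e > 0\<close> by metis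
  show ?thesis
  proof (rule that[of "min d 1"])
    fix x y :: 'a assume xy: "norm (x - y) < min d 1"
    show "norm (f y - f x) < e"
    proof (cases "norm x \<le> R \<or> norm y \<le> R")
      case True
      then have "norm x \<le> R + 1" "norm y \<le> R + 1"
        using xy norm_triangle_ineq3[of x y] by auto
      then show ?thesis
        using d(2)[of x y] xy by (simp add: dist_norm norm_minus_commute)
    next
      case False
      then show ?thesis using K(2) R \<open>e > 0\<close> by (metis norm_zero diff_zero)
    qed
  qed (use d in auto)
qed

text \<open>Mollification at a scale \<open>r\<close> below three thresholds: the moduli of continuity of \<open>\<psi>\<close> and of its
  gradient for the accuracy \<open>e\<close>, and the distance from the support to the complement of \<open>\<Omega>\<close>. The
  same estimate serves the function and its gradient because, by parts, the gradient of the mollified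
  function is the mollified gradient.\<close>

lemma Cinf_0_dense_C1_0:
  fixes \<psi> :: "'a::euclidean_space \<Rightarrow> real"
  assumes "open \<Omega>" "\<psi> \<in> C1_0 \<Omega>" "e > 0"
  obtains \<eta> where "\<eta> \<in> Cinf_0 \<Omega>" "\<And>x. \<bar>\<eta> x - \<psi> x\<bar> \<le> e" "\<And>x. norm (gradient \<eta> x - gradient \<psi> x) \<le> e"
proof -
  from C1_0_E[OF assms(2)] obtain K where K: "compact K" "K \<subseteq> \<Omega>" "\<And>x. x \<notin> K \<Longrightarrow> \<psi> x = 0" "\<And>x. x \<notin> K \<Longrightarrow> gradient \<psi> x = 0" by metis
  note D = C1_0_D[OF assms(2)]
  obtain d1 where d1: "d1 > 0" "\<And>x y. norm (x - y) < d1 \<Longrightarrow> norm (\<psi> y - \<psi> x) < e"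
    using compact_support_uniformly_continuous[OF K(1,3) D(3) assms(3)] by metis
  obtain d2 where d2: "d2 > 0" "\<And>x y. norm (x - y) < d2 \<Longrightarrow> norm (gradient \<psi> y - gradient \<psi> x) < e"
    using compact_support_uniformly_continuous[OF K(1,4) D(4) assms(3)] by metis
  obtain d3 where d3: "d3 > 0" "(\<Union>x\<in>K. cball x d3) \<subseteq> \<Omega>"
    using compact_subset_open_imp_cball_epsilon_subset[OF K(1) assms(1) K(2)] by metis
  define r where "r = min d1 (min d2 d3)"
  have r: "r > 0" "r \<le> d1" "r \<le> d2" "r \<le> d3" using d1 d2 d3 by (auto simp: r_def)
  define \<eta> where "\<eta> x = (\<integral>y. \<psi> y * mollifier r (x - y) \<partial>lborel)" for x
  have sm: "Ck k \<eta>" for k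
    unfolding \<eta>_def[abs_def] by (rule convolution_smooth[OF K(1,3) D(3) mollifier_smooth[OF r(1)]])
  define L where "L = {x + y | x y. x \<in> K \<and> y \<in> cball 0 r}"
  have L: "compact L" "L \<subseteq> \<Omega>"
  proof -
    show "compact L" unfolding L_def by (intro compact_sums K) auto
    have "L \<subseteq> (\<Union>x\<in>K. cball x d3)" using r(4) by (auto simp: L_def dist_norm)
    then show "L \<subseteq> \<Omega>" using d3 by auto
  qed
  have z: "\<eta> x = 0" if "x \<notin> L" for x
  proof -
    have "\<psi> y * mollifier r (x - y) = 0" for y
    proof (cases "y \<in> K")
      case True
      then have "\<not> norm (x - y) \<le> r"
        using that unfolding L_def by (auto simp: dist_norm)
      then show ?thesis using mollifier_outside[OF r(1), of "x - y"] by auto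
    qed (use K in auto)
    then show ?thesis by (simp only: \<eta>_def Bochner_Integration.integral_zero)
  qed
  have "\<eta> \<in> Cinf_0 \<Omega>"
    using sm compactly_supportedI[OF L z] by (auto simp: Cinf_0_def)
  moreover have "\<bar>\<eta> x - \<psi> x\<bar> \<le> e" for x
  proof -
    have "norm ((\<integral>y. mollifier r (x - y) *\<^sub>R \<psi> y \<partial>lborel) - \<psi> x) \<le> e"
      by (rule mollify_close[OF r(1) K(1,3) D(3)]) (use d1(2) r(2) in \<open>auto intro: less_imp_le\<close>)
    then show ?thesis by (simp add: \<eta>_def mult.commute)
  qed
  moreover have "norm (gradient \<eta> x - gradient \<psi> x) \<le> e" for x
  proof -
    have ci: "integrable lborel (\<lambda>y. mollifier r (x - y) *\<^sub>R gradient \<psi> y)"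
      by (rule integrable_compact_support[OF K(1)])
        (use K D in \<open>auto intro!: continuous_intros continuous_on_compose2[OF Ck_continuous[OF mollifier_smooth[OF r(1)], of UNIV]]\<close>)
    define w :: "'a \<Rightarrow> real" where "w y = mollifier r (x - y)" for y
    have w1: "GDERIV w y :> - gradient (mollifier r) (x - y)" for y
      unfolding w_def gderiv_def
      by (rule has_derivative_compose[of "\<lambda>y. x - y" "\<lambda>v. - v", OF _ 
          C1_GDERIV[OF mollifier_smooth[OF r(1)], unfolded gderiv_def], THEN has_derivative_eq_rhs])
         (auto intro!: derivative_eq_intros)
    have w2: "continuous_on UNIV (\<lambda>y. - gradient (mollifier r) (x - y))"
      by (intro continuous_intros continuous_on_compose2[OF C1_continuous_gradient[OF mollifier_smooth[OF r(1)]], of UNIV]) auto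
    have ci2: "integrable lborel (\<lambda>y. \<psi> y *\<^sub>R gradient (mollifier r) (x - y))"
      by (rule integrable_compact_support[OF K(1)])
        (use K D in \<open>auto intro!: continuous_intros continuous_on_compose2[OF C1_continuous_gradient[OF mollifier_smooth[OF r(1)]], of UNIV]\<close>)
    have "(\<integral>y. mollifier r (x - y) *\<^sub>R gradient \<psi> y \<partial>lborel)
        = (\<integral>y. \<psi> y *\<^sub>R gradient (mollifier r) (x - y) \<partial>lborel)"
      using integration_by_parts_lborel[OF assms(2) C1_I(1)[OF w1 w2]] C1_I(2)[OF w1 w2]
      by (simp add: w_def)
    moreover have "GDERIV \<eta> x :> (\<integral>y. \<psi> y *\<^sub>R gradient (mollifier r) (x - y) \<partial>lborel)"
      unfolding gderiv_def \<eta>_def[abs_def]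
      by (rule has_derivative_eq_rhs[OF convolution_has_derivative[OF K(1,3) D(3) mollifier_smooth[OF r(1)]]])
        (auto simp flip: integral_inner_right[OF ci2])
    ultimately have "gradient \<eta> x = (\<integral>y. mollifier r (x - y) *\<^sub>R gradient \<psi> y \<partial>lborel)"
      using gradient_eqI by metis
    moreover have "norm ((\<integral>y. mollifier r (x - y) *\<^sub>R gradient \<psi> y \<partial>lborel) - gradient \<psi> x) \<le> e"
      by (rule mollify_close[OF r(1) K(1,4) D(4)]) (use d2(2) r(3) in \<open>auto intro: less_imp_le\<close>)
    ultimately show ?thesis by simp
  qed
  ultimately show ?thesis using that by blast
qed

section \<open>Square-integrable functions\<close>

definition square_integrable :: "'a measure \<Rightarrow> ('a \<Rightarrow> 'b::euclidean_space) \<Rightarrow> bool" where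
  "square_integrable M f \<longleftrightarrow> f \<in> borel_measurable M \<and> integrable M (\<lambda>x. (norm (f x))\<^sup>2)"

text \<open>The square of the \<open>L\<^sup>2\<close> norm; convergence in \<open>L\<^sup>2\<close> is always expressed by \<open>sqnorm\<close> of the difference
  tending to zero.\<close>

definition sqnorm :: "'a measure \<Rightarrow> ('a \<Rightarrow> 'b::euclidean_space) \<Rightarrow> real" where
  "sqnorm M f = (\<integral>x. (norm (f x))\<^sup>2 \<partial>M)"

lemma square_integrableD: "square_integrable M f \<Longrightarrow> f \<in> borel_measurable M" "square_integrable M f \<Longrightarrow> integrable M (\<lambda>x. (norm (f x))\<^sup>2)"
  by (auto simp: square_integrable_def)

lemma sqnorm_nonneg: "sqnorm M f \<ge> 0"
  by (simp add: sqnorm_def)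

lemma square_integrable_dominated:
  assumes "square_integrable M f" "g \<in> borel_measurable M" "AE x in M. norm (g x) \<le> B * norm (f x)"
  shows "square_integrable M g"
proof -
  have "integrable M (\<lambda>x. (norm (g x))\<^sup>2)"
  proof (rule Bochner_Integration.integrable_bound)
    show "integrable M (\<lambda>x. B\<^sup>2 * (norm (f x))\<^sup>2)" using square_integrableD(2)[OF assms(1)] by simp
    show "AE x in M. norm ((norm (g x))\<^sup>2) \<le> norm (B\<^sup>2 * (norm (f x))\<^sup>2)"
      using assms(3) by eventually_elim (auto simp flip: power_mult_distrib intro: power_mono)
  qed (use assms(2) in measurable)
  with assms(2) show ?thesis by (simp add: square_integrable_def)
qed

lemma square_integrable_inner:
  assumes "square_integrable M f" "square_integrable M g"
  shows "integrable M (\<lambda>x. f x \<bullet> g x)"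
proof (rule Bochner_Integration.integrable_bound)
  show "integrable M (\<lambda>x. (norm (f x))\<^sup>2 + (norm (g x))\<^sup>2)"
    using assms by (auto simp: square_integrable_def)
  have "\<bar>f x \<bullet> g x\<bar> \<le> (norm (f x))\<^sup>2 + (norm (g x))\<^sup>2" for x
  proof -
    have "\<bar>f x \<bullet> g x\<bar> \<le> norm (f x) * norm (g x)" by (rule Cauchy_Schwarz_ineq2)
    moreover have "2 * (norm (f x) * norm (g x)) \<le> (norm (f x))\<^sup>2 + (norm (g x))\<^sup>2"
      using sum_squares_bound[of "norm (f x)" "norm (g x)"] by simp
    moreover have "0 \<le> norm (f x) * norm (g x)" by simp
    ultimately show ?thesis by linarith
  qed
  then show "AE x in M. norm (f x \<bullet> g x) \<le> norm ((norm (f x))\<^sup>2 + (norm (g x))\<^sup>2)"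
    by simp
qed (use assms in \<open>auto simp: square_integrable_def\<close>)

lemma square_integrable_add_scale:
  assumes "square_integrable M f" "square_integrable M g"
  shows "square_integrable M (\<lambda>x. f x + c *\<^sub>R g x)"
    "sqnorm M (\<lambda>x. f x + c *\<^sub>R g x) = sqnorm M f + 2 * c * (\<integral>x. f x \<bullet> g x \<partial>M) + c\<^sup>2 * sqnorm M g"
proof -
  have eq: "(norm (f x + c *\<^sub>R g x))\<^sup>2 = (norm (f x))\<^sup>2 + 2 * c * (f x \<bullet> g x) + c\<^sup>2 * (norm (g x))\<^sup>2" for x
    unfolding power2_norm_eq_inner
    by (simp add: inner_add_left inner_add_right inner_commute algebra_simps power2_eq_square)
  show "square_integrable M (\<lambda>x. f x + c *\<^sub>R g x)"
    using assms square_integrable_inner[OF assms] by (auto simp: square_integrable_def eq)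
  show "sqnorm M (\<lambda>x. f x + c *\<^sub>R g x) = sqnorm M f + 2 * c * (\<integral>x. f x \<bullet> g x \<partial>M) + c\<^sup>2 * sqnorm M g"
    using assms square_integrable_inner[OF assms] by (simp add: square_integrable_def sqnorm_def eq)
qed

lemma square_integrable_diff: "square_integrable M f \<Longrightarrow> square_integrable M g \<Longrightarrow> square_integrable M (\<lambda>x. f x - g x)"
  using square_integrable_add_scale(1)[of M f g "-1"] by simp

text \<open>The quadratic polynomial \<open>t \<mapsto> sqnorm (f + t g)\<close> is nonnegative, so its discriminant is not positive.\<close>

lemma square_integrable_Cauchy_Schwarz:
  assumes "square_integrable M f" "square_integrable M g"
  shows "\<bar>\<integral>x. f x \<bullet> g x \<partial>M\<bar> \<le> sqrt (sqnorm M f) * sqrt (sqnorm M g)"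
proof -
  define A B C where "A = sqnorm M f" and "B = sqnorm M g" and "C = (\<integral>x. f x \<bullet> g x \<partial>M)"
  have *: "A + 2 * t * C + t\<^sup>2 * B \<ge> 0" for t
    using sqnorm_nonneg[of M "\<lambda>x. f x + t *\<^sub>R g x"] unfolding square_integrable_add_scale(2)[OF assms] A_def B_def C_def .
  have AB: "A \<ge> 0" "B \<ge> 0" by (auto simp: A_def B_def sqnorm_nonneg)
  have "C\<^sup>2 \<le> A * B"
  proof (cases "B = 0")
    case True
    have "C = 0"
    proof (rule ccontr)
      assume "C \<noteq> 0"
      with *[of "- (A + 1) / (2 * C)"] True show False by (simp add: field_simps)
    qed
    with True show ?thesis by simp
  next
    case False
    with *[of "- C / B"] AB show ?thesis
      by (simp add: field_simps power2_eq_square)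
  qed
  then have "\<bar>C\<bar> \<le> sqrt (A * B)"
    using real_le_rsqrt by fastforce
  then show ?thesis by (simp add: real_sqrt_mult A_def B_def C_def)
qed

lemma inner_tendsto_L2:
  assumes "\<And>n. square_integrable M (f n)" "\<And>n. square_integrable M (g n)" "square_integrable M F" "square_integrable M G"
    and "(\<lambda>n. sqnorm M (\<lambda>x. f n x - F x)) \<longlonglongrightarrow> 0" "(\<lambda>n. sqnorm M (\<lambda>x. g n x - G x)) \<longlonglongrightarrow> 0"
  shows "(\<lambda>n. \<integral>x. f n x \<bullet> g n x \<partial>M) \<longlonglongrightarrow> (\<integral>x. F x \<bullet> G x \<partial>M)"
proof -
  define a b where "a n x = f n x - F x" and "b n x = g n x - G x" for n x
  have ab: "square_integrable M (a n)" "square_integrable M (b n)" for n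
    unfolding a_def[abs_def] b_def[abs_def] using assms by (auto intro: square_integrable_diff)
  define e where "e n = sqrt (sqnorm M (a n)) * sqrt (sqnorm M (b n)) + sqrt (sqnorm M (a n)) * sqrt (sqnorm M G)
      + sqrt (sqnorm M F) * sqrt (sqnorm M (b n))" for n
  have eq: "(\<integral>x. f n x \<bullet> g n x \<partial>M) - (\<integral>x. F x \<bullet> G x \<partial>M)
     = (\<integral>x. a n x \<bullet> b n x \<partial>M) + (\<integral>x. a n x \<bullet> G x \<partial>M) + (\<integral>x. F x \<bullet> b n x \<partial>M)" for n
  proof -
    have "(\<integral>x. f n x \<bullet> g n x \<partial>M) = (\<integral>x. a n x \<bullet> b n x + a n x \<bullet> G x + F x \<bullet> b n x + F x \<bullet> G x \<partial>M)"
      by (rule Bochner_Integration.integral_cong) (auto simp: a_def b_def algebra_simps)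
    then show ?thesis
      using square_integrable_inner[OF ab(1) ab(2), of n n] square_integrable_inner[OF ab(1) assms(4), of n] square_integrable_inner[OF assms(3) ab(2), of n]
         square_integrable_inner[OF assms(3,4)] by simp
  qed
  have le: "norm ((\<integral>x. f n x \<bullet> g n x \<partial>M) - (\<integral>x. F x \<bullet> G x \<partial>M)) \<le> e n" for n
    using square_integrable_Cauchy_Schwarz[OF ab(1) ab(2), of n n] square_integrable_Cauchy_Schwarz[OF ab(1) assms(4), of n] square_integrable_Cauchy_Schwarz[OF assms(3) ab(2), of n]
    unfolding eq e_def real_norm_def by linarith
  have "e \<longlonglongrightarrow> sqrt 0 * sqrt 0 + sqrt 0 * sqrt (sqnorm M G) + sqrt (sqnorm M F) * sqrt 0"
    unfolding e_def using assms(5,6) unfolding a_def[abs_def, symmetric] b_def[abs_def, symmetric]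
    by (intro tendsto_intros) (auto simp: a_def[abs_def] b_def[abs_def])
  then have "e \<longlonglongrightarrow> 0" by simp
  from Lim_null_comparison[OF always_eventually[OF allI[OF le]] this]
  have "(\<lambda>n. (\<integral>x. f n x \<bullet> g n x \<partial>M) - (\<integral>x. F x \<bullet> G x \<partial>M)) \<longlonglongrightarrow> 0" .
  then show ?thesis by (simp add: LIM_zero_iff)
qed

lemma sqnorm_tendsto:
  assumes "\<And>n. square_integrable M (f n)" "square_integrable M F" "(\<lambda>n. sqnorm M (\<lambda>x. f n x - F x)) \<longlonglongrightarrow> 0"
  shows "(\<lambda>n. sqnorm M (f n)) \<longlonglongrightarrow> sqnorm M F"
  using inner_tendsto_L2[OF assms(1,1,2,2,3,3)] by (simp add: sqnorm_def power2_norm_eq_inner)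

lemma L2_AE_subseq:
  fixes f :: "nat \<Rightarrow> 'a \<Rightarrow> 'b::euclidean_space"
  assumes "\<And>n. square_integrable M (f n)" "square_integrable M F" "(\<lambda>n. sqnorm M (\<lambda>x. f n x - F x)) \<longlonglongrightarrow> 0"
  obtains r :: "nat \<Rightarrow> nat" where "strict_mono r" "AE x in M. (\<lambda>n. f (r n) x) \<longlonglongrightarrow> F x"
proof -
  have 1: "integrable M (\<lambda>x. (norm (f n x - F x))\<^sup>2)" for n
    using square_integrable_diff[OF assms(1,2)] by (auto simp: square_integrable_def)
  have 2: "(\<lambda>n. \<integral>x. norm ((norm (f n x - F x))\<^sup>2) \<partial>M) \<longlonglongrightarrow> 0"
    using assms(3) by (simp add: sqnorm_def)
  from tendsto_L1_AE_subseq[OF 1 2]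
  obtain r :: "nat \<Rightarrow> nat" where r: "strict_mono r" "AE x in M. (\<lambda>n. (norm (f (r n) x - F x))\<^sup>2) \<longlonglongrightarrow> 0"
    by blast
  have "AE x in M. (\<lambda>n. f (r n) x) \<longlonglongrightarrow> F x"
    using r(2)
  proof eventually_elim
    case (elim x)
    from tendsto_real_sqrt[OF elim] have "(\<lambda>n. norm (f (r n) x - F x)) \<longlonglongrightarrow> 0" by simp
    then show ?case by (rule LIM_zero_cancel[OF tendsto_norm_zero_cancel])
  qed
  with r(1) show ?thesis by (rule that)
qed

lemma square_integrable_Fatou:
  fixes f :: "nat \<Rightarrow> 'a \<Rightarrow> 'b::euclidean_space"
  assumes "\<And>n. square_integrable M (f n)" "F \<in> borel_measurable M" "AE x in M. (\<lambda>n. f n x) \<longlonglongrightarrow> F x"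
    and C: "\<forall>\<^sub>F n in sequentially. sqnorm M (f n) \<le> C"
  shows "square_integrable M F" "sqnorm M F \<le> C"
proof -
  have m[measurable]: "f n \<in> borel_measurable M" for n using assms(1) by (simp add: square_integrable_def)
  note assms(2)[measurable]
  have "(\<integral>\<^sup>+x. ennreal ((norm (F x))\<^sup>2) \<partial>M) = (\<integral>\<^sup>+x. liminf (\<lambda>n. ennreal ((norm (f n x))\<^sup>2)) \<partial>M)"
  proof (rule nn_integral_cong_AE)
    show "AE x in M. ennreal ((norm (F x))\<^sup>2) = liminf (\<lambda>n. ennreal ((norm (f n x))\<^sup>2))"
      using assms(3)
    proof eventually_elim
      case (elim x)
      then have "(\<lambda>n. ennreal ((norm (f n x))\<^sup>2)) \<longlonglongrightarrow> ennreal ((norm (F x))\<^sup>2)"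
        by (intro tendsto_intros)
      then show ?case by (rule lim_imp_Liminf[OF sequentially_bot, symmetric])
    qed
  qed
  also have "\<dots> \<le> liminf (\<lambda>n. \<integral>\<^sup>+x. ennreal ((norm (f n x))\<^sup>2) \<partial>M)"
    by (rule nn_integral_liminf) auto
  also have "\<dots> = liminf (\<lambda>n. ennreal (sqnorm M (f n)))"
    unfolding sqnorm_def by (intro arg_cong[where f=liminf] ext nn_integral_eq_integral) (use assms(1) in \<open>auto simp: square_integrable_def\<close>)
  also have "\<dots> \<le> ennreal C"
  proof -
    have "\<forall>\<^sub>F n in sequentially. ennreal (sqnorm M (f n)) \<le> ennreal C"
      using C by eventually_elim (simp add: ennreal_leI)
    then show ?thesis
      by (intro Liminf_le) auto
  qed
  finally have le: "(\<integral>\<^sup>+x. ennreal ((norm (F x))\<^sup>2) \<partial>M) \<le> ennreal C" .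
  have "integrable M (\<lambda>x. (norm (F x))\<^sup>2)"
    by (rule integrableI_bounded) (use le_less_trans[OF le ennreal_less_top] in auto)
  then show "square_integrable M F" by (simp add: square_integrable_def)
  have "ennreal (sqnorm M F) \<le> ennreal C"
    using le nn_integral_eq_integral[OF \<open>integrable M (\<lambda>x. (norm (F x))\<^sup>2)\<close>] by (simp add: sqnorm_def)
  moreover have "C \<ge> 0"
    using eventually_happens'[OF _ C] sqnorm_nonneg order_trans by (metis sequentially_bot)
  ultimately show "sqnorm M F \<le> C" by simp
qed

text \<open>Along a subsequence \<open>r\<close> with consecutive distances \<open>d k\<close> below \<open>2^-k\<close> in \<open>L\<^sup>2\<close>, the series
  \<open>\<Sum>k. 2^k * (d k x)\<^sup>2\<close> has finite integral, hence converges almost everywhere; since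
  \<open>d \<le> 2^-k + 2^k * d\<^sup>2\<close>, the subsequence converges pointwise almost everywhere. Fatou's lemma turns the
  pointwise limit into the \<open>L\<^sup>2\<close> limit of the full sequence.\<close>

lemma L2_complete:
  fixes f :: "nat \<Rightarrow> 'a \<Rightarrow> 'b::euclidean_space"
  assumes sq: "\<And>n. square_integrable M (f n)"
    and cauchy: "\<And>e. e > 0 \<Longrightarrow> \<exists>N. \<forall>m\<ge>N. \<forall>n\<ge>N. sqnorm M (\<lambda>x. f m x - f n x) < e"
  obtains F where "square_integrable M F" "(\<lambda>n. sqnorm M (\<lambda>x. f n x - F x)) \<longlonglongrightarrow> 0"
proof -
  have m[measurable]: "f n \<in> borel_measurable M" for n using sq by (simp add: square_integrable_def)
  have "\<exists>N. \<forall>m\<ge>N. \<forall>n\<ge>N. sqnorm M (\<lambda>x. f m x - f n x) < (1/4)^k" for k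
    by (rule cauchy) simp
  then obtain N where N: "\<And>k m n. m \<ge> N k \<Longrightarrow> n \<ge> N k \<Longrightarrow> sqnorm M (\<lambda>x. f m x - f n x) < (1/4)^k"
    by metis
  \<comment> \<open>The recursion makes \<open>r\<close> strictly increasing with \<open>r k \<ge> N k\<close>.\<close>
  define r where "r = rec_nat (N 0) (\<lambda>k p. max (Suc p) (N (Suc k)))"
  have r_Suc: "r (Suc k) = max (Suc (r k)) (N (Suc k))" "r 0 = N 0" for k by (auto simp: r_def)
  have r_N: "r k \<ge> N k" for k by (cases k) (auto simp: r_Suc)
  have r_mono: "strict_mono r" by (intro strict_mono_Suc_iff[THEN iffD2]) (auto simp: r_Suc)
  define d where "d k x = norm (f (r (Suc k)) x - f (r k) x)" for k x
  have d: "(\<integral>\<^sup>+x. ennreal (2^k * (d k x)\<^sup>2) \<partial>M) \<le> ennreal ((1/2)^k)" for k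
  proof -
    have i: "integrable M (\<lambda>x. 2^k * (d k x)\<^sup>2)"
      using square_integrable_diff[OF sq[of "r (Suc k)"] sq[of "r k"]] by (auto simp: square_integrable_def d_def)
    have "(\<integral>\<^sup>+x. ennreal (2^k * (d k x)\<^sup>2) \<partial>M) = ennreal (\<integral>x. 2^k * (d k x)\<^sup>2 \<partial>M)"
      by (rule nn_integral_eq_integral[OF i]) auto
    also have "(\<integral>x. 2^k * (d k x)\<^sup>2 \<partial>M) = 2^k * sqnorm M (\<lambda>x. f (r (Suc k)) x - f (r k) x)"
      by (simp add: sqnorm_def d_def)
    also have "\<dots> \<le> 2^k * (1/4)^k"
      using N[OF order_trans[OF r_N[of k]] r_N[of k]] r_mono
      by (intro mult_left_mono less_imp_le) (auto simp: strict_mono_def less_imp_le)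
    also have "\<dots> = (1/2::real)^k" by (simp flip: power_mult_distrib)
    finally show ?thesis by (simp add: ennreal_leI)
  qed
  have "(\<integral>\<^sup>+x. (\<Sum>k. ennreal (2^k * (d k x)\<^sup>2)) \<partial>M) = (\<Sum>k. \<integral>\<^sup>+x. ennreal (2^k * (d k x)\<^sup>2) \<partial>M)"
    by (rule nn_integral_suminf) (auto simp: d_def)
  also have "\<dots> \<le> (\<Sum>k. ennreal ((1/2)^k))"
    by (intro suminf_le d) auto
  also have "\<dots> < \<infinity>"
    by (subst suminf_ennreal2) auto
  finally have "(\<integral>\<^sup>+x. (\<Sum>k. ennreal (2^k * (d k x)\<^sup>2)) \<partial>M) \<noteq> \<infinity>" by simp
  then have "AE x in M. (\<Sum>k. ennreal (2^k * (d k x)\<^sup>2)) \<noteq> \<infinity>"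
    by (intro nn_integral_PInf_AE) (auto simp: d_def)
  then have conv: "AE x in M. convergent (\<lambda>k. f (r k) x)"
  proof eventually_elim
    case (elim x)
    have s: "summable (\<lambda>k. 2^k * (d k x)\<^sup>2)"
      using elim by (intro summable_suminf_not_top) (auto simp: top_unique)
    have "summable (\<lambda>k. (1/2)^k + 2^k * (d k x)\<^sup>2)"
      by (intro summable_add s summable_geometric) auto
    then have "summable (\<lambda>k. d k x)"
    proof (rule summable_comparison_test')
      fix k
      have "d k x * 1 \<le> (1/2)^k + 2^k * (d k x)\<^sup>2"
      proof (cases "d k x \<le> (1/2)^k")
        case True then show ?thesis by (simp add: add_increasing2)
      next
        case False
        then have "1 \<le> 2^k * d k x" by (simp add: field_simps power_one_over)
        then have "d k x * 1 \<le> d k x * (2^k * d k x)"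
          by (rule mult_left_mono) (simp add: d_def)
        also have "\<dots> \<le> (1/2)^k + 2^k * (d k x)\<^sup>2" by (simp add: power2_eq_square)
        finally show ?thesis .
      qed
      then show "norm (d k x) \<le> (1/2)^k + 2^k * (d k x)\<^sup>2" by (simp add: d_def)
    qed
    then have "summable (\<lambda>k. f (r (Suc k)) x - f (r k) x)"
      unfolding d_def by (rule summable_norm_cancel)
    then have "convergent (\<lambda>n. \<Sum>k<n. f (r (Suc k)) x - f (r k) x)"
      by (simp add: summable_iff_convergent)
    then have "convergent (\<lambda>n. f (r n) x - f (r 0) x)"
      by (simp only: sum_lessThan_telescope[of "\<lambda>k. f (r k) x"])
    then have "convergent (\<lambda>n. (f (r n) x - f (r 0) x) + f (r 0) x)"
      by (intro convergent_add convergent_const)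
    then show ?case by simp
  qed
  define F where "F x = lim (\<lambda>k. f (r k) x)" for x
  have F: "AE x in M. (\<lambda>k. f (r k) x) \<longlonglongrightarrow> F x"
    using conv by eventually_elim (simp add: F_def convergent_LIMSEQ_iff)
  have Fm[measurable]: "F \<in> borel_measurable M"
    unfolding F_def[abs_def] by (rule borel_measurable_lim_metric) simp
  have close: "square_integrable M (\<lambda>x. f n x - F x) \<and> sqnorm M (\<lambda>x. f n x - F x) \<le> e"
    if "\<forall>m\<ge>K. \<forall>n\<ge>K. sqnorm M (\<lambda>x. f m x - f n x) < e" "n \<ge> K" for e n K
  proof -
    have 1: "AE x in M. (\<lambda>k. f n x - f (r k) x) \<longlonglongrightarrow> f n x - F x"
      using F by eventually_elim (intro tendsto_intros)
    have 2: "\<forall>\<^sub>F k in sequentially. sqnorm M (\<lambda>x. f n x - f (r k) x) \<le> e"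
    proof (rule eventually_sequentiallyI)
      fix k assume "k \<ge> K"
      then have "r k \<ge> K" using seq_suble[OF r_mono, of k] by simp
      with that show "sqnorm M (\<lambda>x. f n x - f (r k) x) \<le> e" by (simp add: less_imp_le)
    qed
    show ?thesis
      using square_integrable_Fatou[OF square_integrable_diff[OF sq sq] _ 1 2] by simp
  qed
  have "square_integrable M F"
  proof -
    have "square_integrable M (\<lambda>x. f (N 0) x - F x)"
      using close[of "N 0" "(1/4)^0" "N 0"] N[of 0] by auto
    from square_integrable_diff[OF sq[of "N 0"] this] show ?thesis by simp
  qed
  moreover have "(\<lambda>n. sqnorm M (\<lambda>x. f n x - F x)) \<longlonglongrightarrow> 0"
  proof (rule LIMSEQ_I)
    fix e :: real assume "e > 0"
    then obtain K where "\<forall>m\<ge>K. \<forall>n\<ge>K. sqnorm M (\<lambda>x. f m x - f n x) < e / 2"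
      using cauchy[of "e / 2"] by auto
    note K = close[OF this]
    have "norm (sqnorm M (\<lambda>x. f n x - F x) - 0) < e" if "n \<ge> K" for n
      using K[OF that] \<open>e > 0\<close> sqnorm_nonneg[of M "\<lambda>x. f n x - F x"] by simp
    then show "\<exists>K. \<forall>n\<ge>K. norm (sqnorm M (\<lambda>x. f n x - F x) - 0) < e" by blast
  qed
  ultimately show ?thesis by (rule that)
qed

lemma bounded_mult_tendsto_L2:
  fixes g :: "nat \<Rightarrow> 'a \<Rightarrow> real"
  assumes f: "square_integrable M f" and g: "\<And>n. g n \<in> borel_measurable M" "G \<in> borel_measurable M"
    "AE x in M. (\<lambda>n. g n x) \<longlonglongrightarrow> G x" "\<And>n. AE x in M. \<bar>g n x\<bar> \<le> B"
  shows "\<And>n. square_integrable M (\<lambda>x. g n x *\<^sub>R f x)" "square_integrable M (\<lambda>x. G x *\<^sub>R f x)"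
    "(\<lambda>n. sqnorm M (\<lambda>x. g n x *\<^sub>R f x - G x *\<^sub>R f x)) \<longlonglongrightarrow> 0"
proof -
  note [measurable] = g(1,2) square_integrableD(1)[OF f]
  have b: "AE x in M. \<forall>n. \<bar>g n x\<bar> \<le> B" using g(4) by (simp add: AE_all_countable)
  have GB: "AE x in M. \<bar>G x\<bar> \<le> B"
    using g(3) b
  proof eventually_elim
    case (elim x)
    show ?case by (rule LIMSEQ_le_const2[OF tendsto_rabs[OF elim(1)]]) (use elim(2) in auto)
  qed
  show "square_integrable M (\<lambda>x. g n x *\<^sub>R f x)" for n
    by (rule square_integrable_dominated[OF f, of _ B]) (use g(4)[of n] in \<open>auto elim!: eventually_mono simp: mult_right_mono\<close>)
  show "square_integrable M (\<lambda>x. G x *\<^sub>R f x)"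
    by (rule square_integrable_dominated[OF f, of _ B]) (use GB in \<open>auto elim!: eventually_mono simp: mult_right_mono\<close>)
  have "(\<lambda>n. sqnorm M (\<lambda>x. g n x *\<^sub>R f x - G x *\<^sub>R f x)) \<longlonglongrightarrow> (\<integral>x. 0 \<partial>M)"
    unfolding sqnorm_def
  proof (rule integral_dominated_convergence[where w="\<lambda>x. (2 * B)\<^sup>2 * (norm (f x))\<^sup>2"])
    show "integrable M (\<lambda>x. (2 * B)\<^sup>2 * (norm (f x))\<^sup>2)" using square_integrableD(2)[OF f] by simp
    show "AE x in M. (\<lambda>n. (norm (g n x *\<^sub>R f x - G x *\<^sub>R f x))\<^sup>2) \<longlonglongrightarrow> 0"
      using g(3)
    proof eventually_elim
      case (elim x)
      then have "(\<lambda>n. (norm (g n x *\<^sub>R f x - G x *\<^sub>R f x))\<^sup>2) \<longlonglongrightarrow> (norm (G x *\<^sub>R f x - G x *\<^sub>R f x))\<^sup>2"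
        by (intro tendsto_intros)
      then show ?case by simp
    qed
    show "AE x in M. norm ((norm (g n x *\<^sub>R f x - G x *\<^sub>R f x))\<^sup>2) \<le> (2 * B)\<^sup>2 * (norm (f x))\<^sup>2" for n
      using g(4)[of n] GB
    proof eventually_elim
      case (elim x)
      have "norm (g n x *\<^sub>R f x - G x *\<^sub>R f x) = \<bar>g n x - G x\<bar> * norm (f x)"
        by (simp flip: scaleR_diff_left)
      also have "\<dots> \<le> (2 * B) * norm (f x)" using elim by (intro mult_right_mono) auto
      finally have "(norm (g n x *\<^sub>R f x - G x *\<^sub>R f x))\<^sup>2 \<le> (2 * B * norm (f x))\<^sup>2"
        by (rule power_mono) simp
      then show ?case by (simp add: power_mult_distrib)
    qed
  qed auto
  then show "(\<lambda>n. sqnorm M (\<lambda>x. g n x *\<^sub>R f x - G x *\<^sub>R f x)) \<longlonglongrightarrow> 0" by simp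
qed

section \<open>Sobolev functions on an open set of finite measure\<close>

lemma L2_iff_square_integrable: "f \<in> L2 S \<longleftrightarrow> square_integrable (lebesgue_on S) f"
  by (simp add: L2_def square_integrable_def)

lemma L2_norm_eq: "L2_norm S f = sqrt (sqnorm (lebesgue_on S) f)"
  by (simp add: L2_norm_def sqnorm_def)

lemma borel_measurable_lebesgue_on_mono:
  assumes "f \<in> borel_measurable (lebesgue_on S)" "T \<subseteq> S"
  shows "f \<in> borel_measurable (lebesgue_on T)"
  using measurable_restrict_mono[OF assms] .

lemma integrable_lebesgue_on_mono:
  fixes f :: "'a::euclidean_space \<Rightarrow> 'b::euclidean_space"
  assumes "integrable (lebesgue_on S) f" "T \<subseteq> S" "S \<in> sets lebesgue" "T \<in> sets lebesgue"
  shows "integrable (lebesgue_on T) f"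
proof -
  have "integrable lebesgue (\<lambda>x. indicator S x *\<^sub>R f x)"
    using assms by (subst (asm) integrable_restrict_space) auto
  then have "integrable lebesgue (\<lambda>x. indicator T x *\<^sub>R indicator S x *\<^sub>R f x)"
    using assms(4) by (rule integrable_mult_indicator[rotated])
  moreover have "(\<lambda>x. indicator T x *\<^sub>R indicator S x *\<^sub>R f x) = (\<lambda>x. indicator T x *\<^sub>R f x)"
    using assms(2) by (auto simp: indicator_def fun_eq_iff)
  ultimately show ?thesis
    using assms(4) by (subst integrable_restrict_space) auto
qed

lemma compact_sets_lebesgue: "compact K \<Longrightarrow> K \<in> sets lebesgue"
  using lmeasurable_compact fmeasurableD by blast

lemma square_integrable_lebesgue_on_mono:
  assumes "square_integrable (lebesgue_on S) f" "T \<subseteq> S" "S \<in> sets lebesgue" "T \<in> sets lebesgue"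
  shows "square_integrable (lebesgue_on T) f"
  using assms integrable_lebesgue_on_mono[of S "\<lambda>x. (norm (f x))\<^sup>2" T] borel_measurable_lebesgue_on_mono[of f S T]
  unfolding square_integrable_def by blast

lemma continuous_measurable_lebesgue_on:
  assumes "continuous_on UNIV f"
  shows "f \<in> borel_measurable (lebesgue_on S)"
  using borel_measurable_continuous_onI[OF assms]
  by (intro measurable_restrict_space1 measurable_completion) simp

lemma square_integrable_integrable:
  assumes "finite_measure M" "square_integrable M f"
  shows "integrable M f"
proof (rule Bochner_Integration.integrable_bound)
  interpret finite_measure M by fact
  show "integrable M (\<lambda>x. 1 + (norm (f x))\<^sup>2)" using square_integrableD(2)[OF assms(2)] by simp
  have "norm (f x) \<le> 1 + (norm (f x))\<^sup>2" for x
  proof -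
    have "2 * norm (f x) \<le> 1 + (norm (f x))\<^sup>2"
      using sum_squares_bound[of 1 "norm (f x)"] by simp
    then show ?thesis using norm_ge_zero[of "f x"] by linarith
  qed
  then show "AE x in M. norm (f x) \<le> norm (1 + (norm (f x))\<^sup>2)"
    by (auto simp: add_nonneg_nonneg)
qed (rule square_integrableD(1)[OF assms(2)])

lemma square_integrable_bounded:
  assumes "finite_measure M" "f \<in> borel_measurable M" "\<And>x. norm (f x) \<le> B"
  shows "square_integrable M f"
proof -
  interpret finite_measure M by fact
  have "integrable M (\<lambda>x. (norm (f x))\<^sup>2)"
    by (rule integrable_const_bound[where B="B\<^sup>2"]) (use assms in \<open>auto intro!: power_mono\<close>)
  with assms show ?thesis by (simp add: square_integrable_def)
qed

locale finite_open_set =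
  fixes \<Omega> :: "'a::euclidean_space set"
  assumes open_\<Omega>: "open \<Omega>" and finite_\<Omega>: "emeasure lebesgue \<Omega> < \<infinity>"
begin

abbreviation "M \<equiv> lebesgue_on \<Omega>"

lemma sets_\<Omega>: "\<Omega> \<in> sets lebesgue"
  using open_\<Omega> by simp

sublocale finite_measure M
  by (rule finite_measure_lebesgue_on) (use finite_\<Omega> sets_\<Omega> in \<open>auto simp: fmeasurable_def\<close>)

lemma finite_M: "finite_measure M"
  by (rule finite_measure_axioms)

lemma integrable_L1_loc: "integrable M f \<Longrightarrow> f \<in> L1_loc \<Omega>"
  unfolding L1_loc_def using integrable_lebesgue_on_mono[of \<Omega> f] sets_\<Omega> compact_sets_lebesgue by auto

lemma square_integrable_L2_loc: "square_integrable M f \<Longrightarrow> f \<in> L2_loc \<Omega>"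
  unfolding L2_loc_def L2_iff_square_integrable using square_integrable_lebesgue_on_mono[of \<Omega> f] sets_\<Omega> compact_sets_lebesgue by auto

lemma test_measurable:
  assumes "\<psi> \<in> C1_0 \<Omega>"
  shows "\<psi> \<in> borel_measurable M" "gradient \<psi> \<in> borel_measurable M"
  by (rule continuous_measurable_lebesgue_on[OF C1_0_D(3)[OF assms]])
     (rule continuous_measurable_lebesgue_on[OF C1_0_D(4)[OF assms]])

lemma test_square_integrable:
  assumes "\<psi> \<in> C1_0 \<Omega>"
  shows "square_integrable M \<psi>" "square_integrable M (gradient \<psi>)"
proof -
  obtain B where B: "\<And>x. \<bar>\<psi> x\<bar> \<le> B" "\<And>x. norm (gradient \<psi> x) \<le> B"
    using C1_0_bounded[OF assms] by metis
  show "square_integrable M \<psi>"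
    by (rule square_integrable_bounded[OF finite_M test_measurable(1)[OF assms]]) (use B in auto)
  show "square_integrable M (gradient \<psi>)"
    by (rule square_integrable_bounded[OF finite_M test_measurable(2)[OF assms]]) (use B in auto)
qed

lemma sqnorm_le_bound:
  assumes "\<And>x. norm (f x) \<le> e" "square_integrable M f"
  shows "sqnorm M f \<le> e\<^sup>2 * measure M (space M)"
proof -
  have "sqnorm M f \<le> (\<integral>x. e\<^sup>2 \<partial>M)"
    unfolding sqnorm_def by (rule integral_mono) (use assms in \<open>auto simp: square_integrable_def intro: power_mono\<close>)
  then show ?thesis by (simp add: mult.commute)
qed

text \<open>The pair \<open>(u, G)\<close> is the limit in the Sobolev norm of the test functions \<open>\<psi> n\<close> and their
  gradients. The class \<open>C\<^sup>1\<close> is the one in which admissibility is tested, and it is stable under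
  composition with the \<open>C\<^sup>1\<close> functions of one variable used below.\<close>

definition sobolev_lim :: "(nat \<Rightarrow> 'a \<Rightarrow> real) \<Rightarrow> ('a \<Rightarrow> real) \<Rightarrow> ('a \<Rightarrow> 'a) \<Rightarrow> bool" where
  "sobolev_lim \<psi> u G \<longleftrightarrow> (\<forall>n. \<psi> n \<in> C1_0 \<Omega>) \<and> square_integrable M u \<and> square_integrable M G \<and>
     (\<lambda>n. sqnorm M (\<lambda>x. \<psi> n x - u x)) \<longlonglongrightarrow> 0 \<and> (\<lambda>n. sqnorm M (\<lambda>x. gradient (\<psi> n) x - G x)) \<longlonglongrightarrow> 0"

lemma C1_0_smooth_approx:
  assumes "\<psi> \<in> C1_0 \<Omega>"
  obtains \<eta> where "\<And>n. \<eta> n \<in> Cinf_0 \<Omega>" "sobolev_lim \<eta> \<psi> (gradient \<psi>)"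
proof -
  have "\<exists>\<eta>\<in>Cinf_0 \<Omega>. (\<forall>x. \<bar>\<eta> x - \<psi> x\<bar> \<le> 1 / real (Suc n)) \<and> (\<forall>x. norm (gradient \<eta> x - gradient \<psi> x) \<le> 1 / real (Suc n))" for n
    using Cinf_0_dense_C1_0[OF open_\<Omega> assms, of "1 / real (Suc n)"] by (metis of_nat_0_less_iff zero_less_Suc zero_less_divide_1_iff)
  then obtain \<eta> where \<eta>: "\<And>n. \<eta> n \<in> Cinf_0 \<Omega>" "\<And>n x. \<bar>\<eta> n x - \<psi> x\<bar> \<le> 1 / real (Suc n)"
    "\<And>n x. norm (gradient (\<eta> n) x - gradient \<psi> x) \<le> 1 / real (Suc n)" by metis
  have C: "\<eta> n \<in> C1_0 \<Omega>" for n using \<eta>(1) Cinf_0_subset by blast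
  have "(\<lambda>n. (1 / real (Suc n))\<^sup>2 * measure M (space M)) \<longlonglongrightarrow> 0\<^sup>2 * measure M (space M)"
    using LIMSEQ_inverse_real_of_nat by (intro tendsto_intros) (simp add: divide_inverse)
  then have lim: "(\<lambda>n. (1 / real (Suc n))\<^sup>2 * measure M (space M)) \<longlonglongrightarrow> 0" by simp
  have bb: "sqnorm M (\<lambda>x. \<eta> n x - \<psi> x) \<le> (1 / real (Suc n))\<^sup>2 * measure M (space M)"
    "sqnorm M (\<lambda>x. gradient (\<eta> n) x - gradient \<psi> x) \<le> (1 / real (Suc n))\<^sup>2 * measure M (space M)" for n
    by (rule sqnorm_le_bound, use \<eta>(2,3) in \<open>simp del: of_nat_Suc\<close>,
        rule square_integrable_diff[OF test_square_integrable(1)[OF C] test_square_integrable(1)[OF assms]]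
          square_integrable_diff[OF test_square_integrable(2)[OF C] test_square_integrable(2)[OF assms]])+
  have "sobolev_lim \<eta> \<psi> (gradient \<psi>)"
    unfolding sobolev_lim_def
  proof (intro conjI allI C test_square_integrable[OF assms])
    show "(\<lambda>n. sqnorm M (\<lambda>x. \<eta> n x - \<psi> x)) \<longlonglongrightarrow> 0"
      by (rule tendsto_sandwich[OF always_eventually[OF allI] always_eventually[OF allI] tendsto_const lim])
        (rule sqnorm_nonneg bb)+
    show "(\<lambda>n. sqnorm M (\<lambda>x. gradient (\<eta> n) x - gradient \<psi> x)) \<longlonglongrightarrow> 0"
      by (rule tendsto_sandwich[OF always_eventually[OF allI] always_eventually[OF allI] tendsto_const lim])
        (rule sqnorm_nonneg bb)+
  qed
  with \<eta>(1) show ?thesis by (rule that)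
qed

lemma W12_0_sobolev_lim:
  assumes "(u, G) \<in> W12_0 \<Omega>"
  obtains \<psi> where "sobolev_lim \<psi> u G"
proof -
  have sq: "square_integrable M u" "square_integrable M G" using assms by (auto simp: W12_0_def L2_iff_square_integrable)
  have "\<exists>\<psi>\<in>Cinf_0 \<Omega>. L2_norm \<Omega> (\<lambda>x. u x - \<psi> x) + L2_norm \<Omega> (\<lambda>x. G x - gradient \<psi> x) < 1 / real (Suc n)" for n
    using assms by (auto simp: W12_0_def)
  then obtain \<psi> where \<psi>: "\<And>n. \<psi> n \<in> Cinf_0 \<Omega>"
    "\<And>n. L2_norm \<Omega> (\<lambda>x. u x - \<psi> n x) + L2_norm \<Omega> (\<lambda>x. G x - gradient (\<psi> n) x) < 1 / real (Suc n)"
    by metis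
  have swap: "sqnorm M (\<lambda>x. f x - g x) = sqnorm M (\<lambda>x. g x - f x)" for f g :: "'a \<Rightarrow> 'c::euclidean_space"
    by (simp add: sqnorm_def norm_minus_commute)
  have b: "sqrt (sqnorm M (\<lambda>x. \<psi> n x - u x)) \<le> 1 / real (Suc n)" 
      "sqrt (sqnorm M (\<lambda>x. gradient (\<psi> n) x - G x)) \<le> 1 / real (Suc n)" for n
    using \<psi>(2)[of n] real_sqrt_ge_zero[OF sqnorm_nonneg[of M "\<lambda>x. \<psi> n x - u x"]]
      real_sqrt_ge_zero[OF sqnorm_nonneg[of M "\<lambda>x. gradient (\<psi> n) x - G x"]]
    unfolding L2_norm_eq swap[of u] swap[of G] by linarith+
  have lim: "(\<lambda>n. (1 / real (Suc n))\<^sup>2) \<longlonglongrightarrow> 0"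
    using tendsto_power[OF LIMSEQ_inverse_real_of_nat, of 2] by (simp add: divide_inverse)
  have bb: "sqnorm M (\<lambda>x. \<psi> n x - u x) \<le> (1 / real (Suc n))\<^sup>2" "sqnorm M (\<lambda>x. gradient (\<psi> n) x - G x) \<le> (1 / real (Suc n))\<^sup>2" for n
    by (rule sqrt_le_D[OF b(1)[of n]], rule sqrt_le_D[OF b(2)[of n]])
  have "sobolev_lim \<psi> u G"
    unfolding sobolev_lim_def
  proof (intro conjI allI sq)
    show "\<psi> n \<in> C1_0 \<Omega>" for n using \<psi>(1) Cinf_0_subset by blast
    show "(\<lambda>n. sqnorm M (\<lambda>x. \<psi> n x - u x)) \<longlonglongrightarrow> 0"
      by (rule tendsto_sandwich[OF always_eventually[OF allI] always_eventually[OF allI] tendsto_const lim])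
        (rule sqnorm_nonneg bb)+
    show "(\<lambda>n. sqnorm M (\<lambda>x. gradient (\<psi> n) x - G x)) \<longlonglongrightarrow> 0"
      by (rule tendsto_sandwich[OF always_eventually[OF allI] always_eventually[OF allI] tendsto_const lim])
        (rule sqnorm_nonneg bb)+
  qed
  then show ?thesis by (rule that)
qed

lemma Cinf_0_W12_0:
  assumes "\<psi> \<in> Cinf_0 \<Omega>"
  shows "(\<psi>, gradient \<psi>) \<in> W12_0 \<Omega>"
proof -
  have C: "\<psi> \<in> C1_0 \<Omega>" using assms Cinf_0_subset by blast
  note sq = test_square_integrable[OF C]
  have "weak_gradient \<Omega> \<psi> (gradient \<psi>)"
    unfolding weak_gradient_def
    using integrable_L1_loc[OF square_integrable_integrable[OF finite_M sq(1)]] integrable_L1_loc[OF square_integrable_integrable[OF finite_M sq(2)]]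
      integration_by_parts[OF open_\<Omega> _ C1_0_D(1)[OF C]] Cinf_0_subset by blast
  moreover have "\<exists>\<eta>\<in>Cinf_0 \<Omega>. L2_norm \<Omega> (\<lambda>x. \<psi> x - \<eta> x) + L2_norm \<Omega> (\<lambda>x. gradient \<psi> x - gradient \<eta> x) < e"
    if "e > 0" for e
    using assms that by (intro bexI[of _ \<psi>]) (auto simp: L2_norm_def)
  ultimately show ?thesis
    using sq by (simp add: W12_0_def L2_iff_square_integrable)
qed

lemma sqnorm_eq_0_iff:
  assumes "square_integrable M f"
  shows "sqnorm M f = 0 \<longleftrightarrow> (AE x in M. f x = 0)"
  unfolding sqnorm_def using integral_nonneg_eq_0_iff_AE[OF square_integrableD(2)[OF assms]] by simp

lemma sobolev_limD:
  assumes "sobolev_lim \<psi> u G"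
  shows "\<psi> n \<in> C1_0 \<Omega>" "square_integrable M u" "square_integrable M G" "square_integrable M (\<psi> n)" "square_integrable M (gradient (\<psi> n))"
    "(\<lambda>n. sqnorm M (\<lambda>x. \<psi> n x - u x)) \<longlonglongrightarrow> 0" "(\<lambda>n. sqnorm M (\<lambda>x. gradient (\<psi> n) x - G x)) \<longlonglongrightarrow> 0"
    "(\<lambda>n. sqnorm M (\<psi> n)) \<longlonglongrightarrow> sqnorm M u" "(\<lambda>n. sqnorm M (gradient (\<psi> n))) \<longlonglongrightarrow> sqnorm M G"
proof -
  show 1: "\<psi> n \<in> C1_0 \<Omega>" "square_integrable M u" "square_integrable M G" 
    "(\<lambda>n. sqnorm M (\<lambda>x. \<psi> n x - u x)) \<longlonglongrightarrow> 0" "(\<lambda>n. sqnorm M (\<lambda>x. gradient (\<psi> n) x - G x)) \<longlonglongrightarrow> 0" for n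
    using assms by (auto simp: sobolev_lim_def)
  show 2: "square_integrable M (\<psi> n)" "square_integrable M (gradient (\<psi> n))" for n
    using test_square_integrable[OF 1(1)] by auto
  show "(\<lambda>n. sqnorm M (\<psi> n)) \<longlonglongrightarrow> sqnorm M u" by (rule sqnorm_tendsto[OF 2(1) 1(2,4)])
  show "(\<lambda>n. sqnorm M (gradient (\<psi> n))) \<longlonglongrightarrow> sqnorm M G" by (rule sqnorm_tendsto[OF 2(2) 1(3,5)])
qed

lemma Rayleigh_W12_0:
  assumes "(u, G) \<in> W12_0 \<Omega>" "ennreal lam \<le> first_eigenvalue \<Omega>"
  shows "lam * sqnorm M u \<le> sqnorm M G"
proof (cases "sqnorm M u = 0")
  case True
  then show ?thesis by (simp add: sqnorm_nonneg)
next
  case False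
  have sq: "square_integrable M u" using assms by (auto simp: W12_0_def L2_iff_square_integrable)
  have "first_eigenvalue \<Omega> \<le> ennreal (sqnorm M G / sqnorm M u)"
    unfolding first_eigenvalue_def sqnorm_def real_norm_def
    by (rule INF_lower2[of "(u, G)"]) (use assms False sqnorm_eq_0_iff[OF sq] in auto)
  with assms(2) have "ennreal lam \<le> ennreal (sqnorm M G / sqnorm M u)" by (rule order_trans)
  then have "lam \<le> sqnorm M G / sqnorm M u"
    by (simp add: sqnorm_nonneg)
  moreover have "sqnorm M u > 0" using False sqnorm_nonneg[of M u] by linarith
  ultimately show ?thesis by (simp add: field_simps)
qed

text \<open>The Rayleigh quotient inequality, which the definition of the first eigenvalue gives for smooth test
  functions, passes to \<open>C\<^sup>1\<close> test functions by density.\<close>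

lemma Rayleigh_C1_0:
  assumes "\<psi> \<in> C1_0 \<Omega>" "ennreal lam \<le> first_eigenvalue \<Omega>"
  shows "lam * sqnorm M \<psi> \<le> sqnorm M (gradient \<psi>)"
proof -
  obtain \<eta> where \<eta>: "\<And>n. \<eta> n \<in> Cinf_0 \<Omega>" "sobolev_lim \<eta> \<psi> (gradient \<psi>)"
    using C1_0_smooth_approx[OF assms(1)] by blast
  show ?thesis
    by (rule LIMSEQ_le[OF tendsto_mult[OF tendsto_const sobolev_limD(8)[OF \<eta>(2)]] sobolev_limD(9)[OF \<eta>(2)]])
      (use Rayleigh_W12_0[OF Cinf_0_W12_0[OF \<eta>(1)] assms(2)] in auto)
qed

section \<open>Testing an equation with functions of its solution\<close>

lemma sobolev_lim_AE:
  assumes "sobolev_lim \<psi> u G"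
  obtains r :: "nat \<Rightarrow> nat" where "sobolev_lim (\<lambda>n. \<psi> (r n)) u G" "AE x in M. (\<lambda>n. \<psi> (r n) x) \<longlonglongrightarrow> u x"
proof -
  note D = sobolev_limD[OF assms]
  obtain r :: "nat \<Rightarrow> nat" where r: "strict_mono r" "AE x in M. (\<lambda>n. \<psi> (r n) x) \<longlonglongrightarrow> u x"
    using L2_AE_subseq[OF D(4,2,6)] by blast
  have "sobolev_lim (\<lambda>n. \<psi> (r n)) u G"
    using D(1-3) LIMSEQ_subseq_LIMSEQ[OF D(6) r(1)] LIMSEQ_subseq_LIMSEQ[OF D(7) r(1)]
    by (simp add: sobolev_lim_def o_def)
  then show ?thesis using r(2) by (rule that)
qed

text \<open>Testing the weak equation \<open>- div G = h\<close> with \<open>\<zeta> * g u\<close>, as if the chain rule held for \<open>u\<close>. For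
  the approximations \<open>\<psi> n\<close> of \<open>u\<close> the function \<open>\<zeta> * g (\<psi> n)\<close> is an honest test function. Along an
  almost everywhere convergent subsequence the bounded factors \<open>g (\<psi> n)\<close> and \<open>g' (\<psi> n)\<close> converge
  pointwise, so their products with the fixed functions \<open>G\<close> and \<open>h\<close> converge in \<open>L\<^sup>2\<close>, while the gradients
  of \<open>\<psi> n\<close> converge to \<open>G\<close> in \<open>L\<^sup>2\<close>.\<close>

lemma equation_tested_with_composite:
  assumes lim: "sobolev_lim \<psi> u G"
    and eqn: "\<And>\<eta>. \<eta> \<in> C1_0 \<Omega> \<Longrightarrow> (\<integral>x. G x \<bullet> gradient \<eta> x \<partial>M) = (\<integral>x. h x * \<eta> x \<partial>M)"
    and h: "square_integrable M h"
    and g: "\<And>t. (g has_real_derivative g' t) (at t)" "continuous_on UNIV g'" "\<And>t. \<bar>g t\<bar> \<le> B" "\<And>t. \<bar>g' t\<bar> \<le> B"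
    and \<zeta>: "\<zeta> \<in> C1_0 \<Omega>"
  shows "(\<integral>x. g (u x) * (gradient \<zeta> x \<bullet> G x) + \<zeta> x * g' (u x) * (norm (G x))\<^sup>2 \<partial>M)
       = (\<integral>x. h x * (\<zeta> x * g (u x)) \<partial>M)"
proof -
  obtain r :: "nat \<Rightarrow> nat" where r: "sobolev_lim (\<lambda>n. \<psi> (r n)) u G" "AE x in M. (\<lambda>n. \<psi> (r n) x) \<longlonglongrightarrow> u x"
    using sobolev_lim_AE[OF lim] by blast
  define p where "p n = \<psi> (r n)" for n
  note D = sobolev_limD[OF r(1)[folded p_def]]
  note ae = r(2)[folded p_def]
  have gc: "continuous_on UNIV g"
    by (intro continuous_at_imp_continuous_on ballI DERIV_isCont[OF g(1)])
  have gm[measurable]: "g \<in> borel_measurable borel" "g' \<in> borel_measurable borel"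
    using gc g(2) by (auto intro: borel_measurable_continuous_onI)
  have m[measurable]: "p n \<in> borel_measurable M" "u \<in> borel_measurable M" "\<zeta> \<in> borel_measurable M"
      "G \<in> borel_measurable M" "gradient \<zeta> \<in> borel_measurable M" for n
    using square_integrableD(1)[OF D(2)] square_integrableD(1)[OF D(3)] square_integrableD(1)[OF D(4)] test_measurable[OF \<zeta>] by auto
  obtain C where C: "\<And>x. \<bar>\<zeta> x\<bar> \<le> C" "C > 0"
    using C1_0_bounded[OF \<zeta>] by metis
  have B: "B \<ge> 0" using g(3)[of 0] by linarith
  have gl: "AE x in M. (\<lambda>n. g (p n x)) \<longlonglongrightarrow> g (u x)"
    using ae by eventually_elim (rule isCont_tendsto_compose[OF DERIV_isCont[OF g(1)]])
  have g'l: "AE x in M. (\<lambda>n. \<zeta> x * g' (p n x)) \<longlonglongrightarrow> \<zeta> x * g' (u x)"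
    using ae
  proof eventually_elim
    case (elim x)
    have "isCont g' (u x)" using g(2) by (simp add: continuous_on_eq_continuous_at)
    from isCont_tendsto_compose[OF this elim] show ?case by (intro tendsto_intros)
  qed
  have g'b: "AE x in M. \<bar>\<zeta> x * g' (p n x)\<bar> \<le> C * B" for n
    using C g(4) by (auto simp: abs_mult intro!: mult_mono)
  note sq\<zeta> = test_square_integrable[OF \<zeta>]
  have const: "(\<lambda>n. sqnorm M (\<lambda>x. f x - f x)) \<longlonglongrightarrow> 0" for f :: "'a \<Rightarrow> 'c::euclidean_space"
    by (simp add: sqnorm_def)
  have gb: "AE x in M. \<bar>g (p n x)\<bar> \<le> B" for n using g(3) by auto
  note b1 = bounded_mult_tendsto_L2[OF D(3) _ _ gl gb]
  note b2 = bounded_mult_tendsto_L2[OF D(3) _ _ g'l g'b]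
  note b3 = bounded_mult_tendsto_L2[OF h _ _ gl gb]
  have l1: "(\<lambda>n. \<integral>x. (g (p n x) *\<^sub>R G x) \<bullet> gradient \<zeta> x \<partial>M) \<longlonglongrightarrow> (\<integral>x. (g (u x) *\<^sub>R G x) \<bullet> gradient \<zeta> x \<partial>M)"
    by (rule inner_tendsto_L2[OF b1(1) sq\<zeta>(2) b1(2) sq\<zeta>(2) b1(3) const]) measurable
  have l2: "(\<lambda>n. \<integral>x. ((\<zeta> x * g' (p n x)) *\<^sub>R G x) \<bullet> gradient (p n) x \<partial>M)
      \<longlonglongrightarrow> (\<integral>x. ((\<zeta> x * g' (u x)) *\<^sub>R G x) \<bullet> G x \<partial>M)"
    by (rule inner_tendsto_L2[OF b2(1) D(5) b2(2) D(3) b2(3) D(7)]) measurable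
  have l3: "(\<lambda>n. \<integral>x. (g (p n x) *\<^sub>R h x) \<bullet> \<zeta> x \<partial>M) \<longlonglongrightarrow> (\<integral>x. (g (u x) *\<^sub>R h x) \<bullet> \<zeta> x \<partial>M)"
    by (rule inner_tendsto_L2[OF b3(1) sq\<zeta>(1) b3(2) sq\<zeta>(1) b3(3) const]) measurable
  have eq: "(\<integral>x. (g (p n x) *\<^sub>R G x) \<bullet> gradient \<zeta> x \<partial>M) + (\<integral>x. ((\<zeta> x * g' (p n x)) *\<^sub>R G x) \<bullet> gradient (p n) x \<partial>M)
    = (\<integral>x. (g (p n x) *\<^sub>R h x) \<bullet> \<zeta> x \<partial>M)" for n
  proof -
    have 1: "GDERIV (\<lambda>x. g (p n x)) x :> g' (p n x) *\<^sub>R gradient (p n) x" for x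
      by (rule GDERIV_DERIV_compose[OF C1_0_D(2)[OF D(1)] g(1)])
    have 2: "continuous_on UNIV (\<lambda>x. g' (p n x) *\<^sub>R gradient (p n) x)"
      by (intro continuous_intros continuous_on_compose2[OF g(2)] C1_0_D(3,4)[OF D(1)]) auto
    \<comment> \<open>The function \<open>g (p n)\<close> need not have compact support; only its product with \<open>\<zeta>\<close> is a test function.\<close>
    note c1 = C1_I[OF 1 2]
    note t = C1_mult_C1_0[OF \<zeta> c1(1)]
    have i1: "integrable M (\<lambda>x. (g (p n x) *\<^sub>R G x) \<bullet> gradient \<zeta> x)"
      by (rule square_integrable_inner[OF b1(1) sq\<zeta>(2)]) measurable
    have i2: "integrable M (\<lambda>x. ((\<zeta> x * g' (p n x)) *\<^sub>R G x) \<bullet> gradient (p n) x)"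
      by (rule square_integrable_inner[OF b2(1) D(5)]) measurable
    have "(\<integral>x. (g (p n x) *\<^sub>R G x) \<bullet> gradient \<zeta> x \<partial>M) + (\<integral>x. ((\<zeta> x * g' (p n x)) *\<^sub>R G x) \<bullet> gradient (p n) x \<partial>M)
      = (\<integral>x. G x \<bullet> gradient (\<lambda>x. \<zeta> x * g (p n x)) x \<partial>M)"
      unfolding t(2) c1(2) Bochner_Integration.integral_add[OF i1 i2, symmetric]
      by (rule Bochner_Integration.integral_cong) (auto simp: inner_add_right)
    also have "\<dots> = (\<integral>x. h x * (\<zeta> x * g (p n x)) \<partial>M)"
      by (rule eqn[OF t(1)])
    also have "\<dots> = (\<integral>x. (g (p n x) *\<^sub>R h x) \<bullet> \<zeta> x \<partial>M)"
      by (rule Bochner_Integration.integral_cong) auto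
    finally show ?thesis .
  qed
  have "(\<integral>x. (g (u x) *\<^sub>R G x) \<bullet> gradient \<zeta> x \<partial>M) + (\<integral>x. ((\<zeta> x * g' (u x)) *\<^sub>R G x) \<bullet> G x \<partial>M)
      = (\<integral>x. (g (u x) *\<^sub>R h x) \<bullet> \<zeta> x \<partial>M)"
    using LIMSEQ_unique[OF tendsto_add[OF l1 l2, unfolded eq] l3] .
  moreover have i1: "integrable M (\<lambda>x. (g (u x) *\<^sub>R G x) \<bullet> gradient \<zeta> x)"
    by (rule square_integrable_inner[OF b1(2) sq\<zeta>(2)]) measurable
  moreover have i2: "integrable M (\<lambda>x. ((\<zeta> x * g' (u x)) *\<^sub>R G x) \<bullet> G x)"
    by (rule square_integrable_inner[OF b2(2) D(3)]) measurable
  ultimately have "(\<integral>x. (g (u x) *\<^sub>R G x) \<bullet> gradient \<zeta> x + ((\<zeta> x * g' (u x)) *\<^sub>R G x) \<bullet> G x \<partial>M)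
      = (\<integral>x. (g (u x) *\<^sub>R h x) \<bullet> \<zeta> x \<partial>M)"
    by simp
  then show ?thesis
    by (simp add: power2_norm_eq_inner inner_commute mult_ac)
qed

text \<open>The function \<open>1 / (t + e)\<close> on the positive axis, continued to the negative axis by
  \<open>2 / e - 1 / (e - t)\<close>: a bounded \<open>C\<^sup>1\<close> function with bounded derivative on the whole line, because the
  approximations of a nonnegative Sobolev function may take negative values.\<close>

lemma reciprocal_extension:
  fixes e :: real
  assumes "e > 0"
  defines "g \<equiv> \<lambda>t. 1/e - t / (e * (e + \<bar>t\<bar>))" and "g' \<equiv> \<lambda>t. - (1 / (e + \<bar>t\<bar>)\<^sup>2)"
  shows "(g has_real_derivative g' t) (at t)" "continuous_on UNIV g'" "\<bar>g t\<bar> \<le> 2/e + 1/e\<^sup>2" "\<bar>g' t\<bar> \<le> 2/e + 1/e\<^sup>2"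
    "t \<ge> 0 \<Longrightarrow> g t = 1 / (t + e)"
proof -
  have pos: "e + \<bar>t\<bar> > 0" for t using assms(1) by simp
  have g_pos: "g t = 1 / (e + t)" if "t \<ge> 0" for t
  proof -
    have "1 / e - 1 / (e + t) = t / (e * (e + t))"
      using assms(1) that by (simp add: diff_frac_eq)
    with that show ?thesis by (simp add: g_def)
  qed
  have g_neg: "g t = 2 / e - 1 / (e - t)" if "t < 0" for t
  proof -
    have "1 / (e - t) - 1 / e = t / (e * (e - t))"
      using assms(1) that by (simp add: diff_frac_eq mult.commute)
    with that show ?thesis by (simp add: g_def)
  qed
  show "(g has_real_derivative g' t) (at t)"
  proof -
    consider "t > 0" | "t < 0" | "t = 0" by linarith
    then show ?thesis
    proof cases
      case 1
      have "((\<lambda>t. 1 / (e + t)) has_real_derivative g' t) (at t)"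
        unfolding g'_def using 1 assms(1)
        by (auto intro!: derivative_eq_intros simp: power2_eq_square add.commute)
      then show ?thesis
        by (rule has_field_derivative_transform_within_open[where S="{0<..}"])
          (use 1 in \<open>auto simp: g_pos\<close>)
    next
      case 2
      have "((\<lambda>t. 2 / e - 1 / (e - t)) has_real_derivative g' t) (at t)"
        unfolding g'_def using 2 assms(1)
        by (auto intro!: derivative_eq_intros simp: power2_eq_square)
      then show ?thesis
        by (rule has_field_derivative_transform_within_open[where S="{..<0}"])
          (use 2 in \<open>auto simp: g_neg\<close>)
    next
      case 3
      have "((\<lambda>h. - (1 / (e * (e + \<bar>h\<bar>)))) \<longlongrightarrow> - (1 / (e * (e + \<bar>0\<bar>)))) (at 0)"
        using assms(1) by (intro tendsto_intros) auto
      then have "((\<lambda>h. (g h - g 0) / h) \<longlongrightarrow> g' 0) (at 0)"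
        by (rule Lim_transform_eventually[THEN tendsto_eq_rhs])
          (use assms(1) in \<open>auto simp: g_def g'_def eventually_at_filter power2_eq_square\<close>)
      then show ?thesis using 3 by (simp add: has_field_derivative_iff)
    qed
  qed
  show "continuous_on UNIV g'"
    unfolding g'_def using pos by (intro continuous_intros) (auto simp: less_imp_neq[symmetric])
  have "\<bar>t / (e * (e + \<bar>t\<bar>))\<bar> \<le> 1/e"
  proof -
    have "\<bar>t\<bar> / (e + \<bar>t\<bar>) \<le> 1" using pos[of t] assms(1) by (simp add: divide_le_eq_1)
    then have "\<bar>t\<bar> / (e + \<bar>t\<bar>) / e \<le> 1 / e" using assms(1) by (intro divide_right_mono) auto
    then show ?thesis using pos[of t] assms(1) by (simp add: abs_mult mult.commute)
  qed
  moreover have "2 / e = 1 / e + 1 / e" "1 / e > 0" "1 / e\<^sup>2 \<ge> 0" using assms(1) by simp_all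
  ultimately show "\<bar>g t\<bar> \<le> 2/e + 1/e\<^sup>2"
    unfolding g_def abs_le_iff by linarith
  have "1 / (e + \<bar>t\<bar>)\<^sup>2 \<le> 1/e\<^sup>2"
    using assms(1) by (intro divide_left_mono power_mono) auto
  then show "\<bar>g' t\<bar> \<le> 2/e + 1/e\<^sup>2"
    using assms(1) by (simp add: g'_def add_increasing)
  show "g t = 1 / (t + e)" if "t \<ge> 0"
    using g_pos[OF that] by (simp add: add.commute)
qed

text \<open>Testing with \<open>\<zeta> / (u + e)\<close> is the computation behind the duality: it turns a linear equation for
  \<open>u\<close> into an equation for the logarithmic gradient \<open>G / (u + e)\<close> of \<open>u + e\<close>.\<close>

lemma equation_tested_with_reciprocal:
  assumes lim: "sobolev_lim \<psi> u G"
    and eqn: "\<And>\<eta>. \<eta> \<in> C1_0 \<Omega> \<Longrightarrow> (\<integral>x. G x \<bullet> gradient \<eta> x \<partial>M) = (\<integral>x. h x * \<eta> x \<partial>M)"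
    and h: "square_integrable M h" and \<zeta>: "\<zeta> \<in> C1_0 \<Omega>" and e: "e > 0" and pos: "AE x in M. u x \<ge> 0"
  shows "(\<integral>x. (gradient \<zeta> x \<bullet> G x) / (u x + e) - \<zeta> x * (norm (G x))\<^sup>2 / (u x + e)\<^sup>2 \<partial>M)
       = (\<integral>x. h x * \<zeta> x / (u x + e) \<partial>M)"
proof -
  note [measurable] = square_integrableD(1)[OF sobolev_limD(2)[OF lim]] square_integrableD(1)[OF sobolev_limD(3)[OF lim]]
    square_integrableD(1)[OF h] test_measurable[OF \<zeta>]
  note g = reciprocal_extension[OF e]
  have "(\<integral>x. (gradient \<zeta> x \<bullet> G x) / (u x + e) - \<zeta> x * (norm (G x))\<^sup>2 / (u x + e)\<^sup>2 \<partial>M)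
    = (\<integral>x. (1/e - u x / (e * (e + \<bar>u x\<bar>))) * (gradient \<zeta> x \<bullet> G x) + \<zeta> x * - (1 / (e + \<bar>u x\<bar>)\<^sup>2) * (norm (G x))\<^sup>2 \<partial>M)"
  proof (rule integral_cong_AE)
    show "AE x in M. (gradient \<zeta> x \<bullet> G x) / (u x + e) - \<zeta> x * (norm (G x))\<^sup>2 / (u x + e)\<^sup>2
      = (1/e - u x / (e * (e + \<bar>u x\<bar>))) * (gradient \<zeta> x \<bullet> G x) + \<zeta> x * - (1 / (e + \<bar>u x\<bar>)\<^sup>2) * (norm (G x))\<^sup>2"
      using pos
    proof eventually_elim
      case (elim x)
      show ?case
        by (simp only: g(5)[OF elim]) (simp add: elim add.commute[of e])
    qed
  qed measurable
  also have "\<dots> = (\<integral>x. h x * (\<zeta> x * (1/e - u x / (e * (e + \<bar>u x\<bar>)))) \<partial>M)"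
    by (rule equation_tested_with_composite[OF lim eqn h g(1-4) \<zeta>])
  also have "\<dots> = (\<integral>x. h x * \<zeta> x / (u x + e) \<partial>M)"
  proof (rule integral_cong_AE)
    show "AE x in M. h x * (\<zeta> x * (1/e - u x / (e * (e + \<bar>u x\<bar>)))) = h x * \<zeta> x / (u x + e)"
      using pos
    proof eventually_elim
      case (elim x)
      show ?case by (simp only: g(5)[OF elim]) simp
    qed
  qed measurable
  finally show ?thesis .
qed

section \<open>The lower bound for the dual problem\<close>

lemma G2_le_ennrealD:
  assumes "G2 s \<xi> \<le> ennreal m" "m \<ge> 0"
  shows "s \<le> 0" "(norm \<xi>)\<^sup>2 \<le> m * - s"
  using assms by (auto simp: G2_def top_unique field_simps split: if_splits)

text \<open>The pointwise inequality of the lower bound. It is Young's inequality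
  \<open>2 * c * (p \<bullet> \<xi>) \<le> m * (norm p)\<^sup>2 + c\<^sup>2 * (norm \<xi>)\<^sup>2 / m\<close> with the last term absorbed by \<open>- s * c\<^sup>2\<close>,
  written so as to cover \<open>m = 0\<close>.\<close>

lemma completing_square:
  fixes p \<xi> :: "'b::euclidean_space"
  assumes "m \<ge> 0" "s \<le> 0" "(norm \<xi>)\<^sup>2 \<le> m * - s"
  shows "2 * c * (p \<bullet> \<xi>) + s * c\<^sup>2 \<le> m * (norm p)\<^sup>2"
proof (cases "m = 0")
  case True
  with assms have "\<xi> = 0" by simp
  then show ?thesis using assms(2) True by (simp add: mult_nonpos_nonneg)
next
  case False
  then have m: "m > 0" using assms by simp
  have "m * (2 * c * (p \<bullet> \<xi>)) = (norm (m *\<^sub>R p))\<^sup>2 + c\<^sup>2 * (norm \<xi>)\<^sup>2 - (norm (m *\<^sub>R p - c *\<^sub>R \<xi>))\<^sup>2"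
    by (simp only: power2_norm_eq_inner) (simp add: inner_diff_left inner_diff_right inner_commute power2_eq_square algebra_simps)
  also have "\<dots> \<le> m\<^sup>2 * (norm p)\<^sup>2 + c\<^sup>2 * (m * - s)"
  proof -
    have "(norm (m *\<^sub>R p))\<^sup>2 = m\<^sup>2 * (norm p)\<^sup>2" by (simp add: power_mult_distrib)
    moreover have "c\<^sup>2 * (norm \<xi>)\<^sup>2 \<le> c\<^sup>2 * (m * - s)" by (rule mult_left_mono[OF assms(3)]) simp
    moreover have "(norm (m *\<^sub>R p - c *\<^sub>R \<xi>))\<^sup>2 \<ge> 0" by simp
    ultimately show ?thesis by linarith
  qed
  also have "\<dots> = m * (m * (norm p)\<^sup>2 - s * c\<^sup>2)"
    by (simp add: power2_eq_square algebra_simps)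
  finally have "2 * c * (p \<bullet> \<xi>) \<le> m * (norm p)\<^sup>2 - s * c\<^sup>2"
    using m by (rule mult_left_le_imp_le)
  then show ?thesis by simp
qed

text \<open>An admissible pair is tested with \<open>\<psi>\<^sup>2\<close>; the integrand on the left is then bounded pointwise by
  \<open>m * (norm (gradient \<psi>))\<^sup>2\<close>.\<close>

lemma admissible_Poincare:
  assumes adm: "(f, \<phi>) \<in> admissible \<Omega>" and le: "AE x in M. G2 (f x) (\<phi> x) \<le> ennreal m" and m: "m \<ge> 0"
    and \<psi>: "\<psi> \<in> C1_0 \<Omega>"
  shows "sqnorm M \<psi> \<le> m * sqnorm M (gradient \<psi>)"
proof -
  note t = C1_mult_C1_0[OF \<psi> C1_0_D(1)[OF \<psi>]]
  have ge: "(\<integral>x. (gradient (\<lambda>x. \<psi> x * \<psi> x) x \<bullet> \<phi> x + f x * (\<psi> x * \<psi> x)) \<partial>M) \<ge> (\<integral>x. \<psi> x * \<psi> x \<partial>M)"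
    using adm t(1) unfolding admissible_def by (auto simp del: mult_eq_0_iff)
  have pt: "AE x in M. gradient (\<lambda>x. \<psi> x * \<psi> x) x \<bullet> \<phi> x + f x * (\<psi> x * \<psi> x) \<le> m * (norm (gradient \<psi> x))\<^sup>2"
    using le
  proof eventually_elim
    case (elim x)
    show ?case
      using completing_square[OF m G2_le_ennrealD[OF elim m], of "\<psi> x" "gradient \<psi> x"]
      by (simp add: t(2) inner_add_left power2_eq_square)
  qed
  have "(\<integral>x. (gradient (\<lambda>x. \<psi> x * \<psi> x) x \<bullet> \<phi> x + f x * (\<psi> x * \<psi> x)) \<partial>M) \<le> m * sqnorm M (gradient \<psi>)"
  \<comment> \<open>If the integrand is not integrable, its integral is zero by convention and the bound is trivial.\<close>
  proof (cases "integrable M (\<lambda>x. gradient (\<lambda>x. \<psi> x * \<psi> x) x \<bullet> \<phi> x + f x * (\<psi> x * \<psi> x))")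
    case True
    have "(\<integral>x. (gradient (\<lambda>x. \<psi> x * \<psi> x) x \<bullet> \<phi> x + f x * (\<psi> x * \<psi> x)) \<partial>M) \<le> (\<integral>x. m * (norm (gradient \<psi> x))\<^sup>2 \<partial>M)"
      by (rule integral_mono_AE[OF True _ pt]) (use square_integrableD(2)[OF test_square_integrable(2)[OF \<psi>]] in simp)
    then show ?thesis by (simp add: sqnorm_def)
  next
    case False
    show ?thesis unfolding not_integrable_integral_eq[OF False]
      by (rule mult_nonneg_nonneg[OF m sqnorm_nonneg])
  qed
  moreover have "(\<integral>x. \<psi> x * \<psi> x \<partial>M) = sqnorm M \<psi>"
    by (simp add: sqnorm_def power2_eq_square)
  ultimately show ?thesis using ge by linarith
qed

text \<open>A finite value \<open>m\<close> of the dual functional is a Poincare constant for test functions, hence for all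
  of \<open>W12_0\<close>, so every Rayleigh quotient is at least \<open>1 / m\<close>. For \<open>m = 0\<close> there are no nonzero
  Sobolev functions at all and the first eigenvalue is infinite.\<close>

lemma inverse_eigenvalue_le_Linf_norm:
  assumes adm: "(f, \<phi>) \<in> admissible \<Omega>"
  shows "1 / first_eigenvalue \<Omega> \<le> Linf_norm \<Omega> (\<lambda>x. G2 (f x) (\<phi> x))"
proof (cases "Linf_norm \<Omega> (\<lambda>x. G2 (f x) (\<phi> x))")
  case top
  then show ?thesis by simp
next
  case (real m)
  have le: "AE x in M. G2 (f x) (\<phi> x) \<le> ennreal m"
    using esssup_AE[of "\<lambda>x. G2 (f x) (\<phi> x)" M] real(2) by (simp add: Linf_norm_def)
  have W: "sqnorm M u \<le> m * sqnorm M G" if uG: "(u, G) \<in> W12_0 \<Omega>" for u G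
  proof -
    obtain \<psi> where lim: "sobolev_lim \<psi> u G" using W12_0_sobolev_lim[OF uG] by blast
    note D = sobolev_limD[OF lim]
    show ?thesis
      by (rule LIMSEQ_le[OF D(8) tendsto_mult[OF tendsto_const D(9)]])
        (use admissible_Poincare[OF adm le real(1) D(1)] in auto)
  qed
  have quot: "\<exists>q>0. sqnorm M G / sqnorm M u = q \<and> 1 \<le> m * q"
    if "(u, G) \<in> W12_0 \<Omega>" "\<not> (AE x in M. u x = 0)" for u G
  proof -
    have "square_integrable M u" using that by (auto simp: W12_0_def L2_iff_square_integrable)
    then have u: "sqnorm M u > 0" using that(2) sqnorm_eq_0_iff sqnorm_nonneg[of M u] by force
    with W[OF that(1)] have "1 \<le> m * (sqnorm M G / sqnorm M u)" by (simp add: field_simps)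
    moreover from this have "sqnorm M G / sqnorm M u > 0"
      using sqnorm_nonneg[of M G] u by (cases "sqnorm M G = 0") auto
    ultimately show ?thesis by blast
  qed
  have quot_eq: "(\<integral>x. (norm (G x))\<^sup>2 \<partial>M) / (\<integral>x. \<bar>u x\<bar>\<^sup>2 \<partial>M) = sqnorm M G / sqnorm M u"
    for u :: "'a \<Rightarrow> real" and G :: "'a \<Rightarrow> 'a" by (simp add: sqnorm_def)
  show ?thesis
  proof (cases "m = 0")
    case True
    then have "{(u, Du) \<in> W12_0 \<Omega>. \<not> (AE x in M. u x = 0)} = {}"
      using quot by fastforce
    then have "first_eigenvalue \<Omega> = top" 
      unfolding first_eigenvalue_def by (simp only: image_empty Inf_empty)
    then show ?thesis by simp
  next
    case False
    with real have m: "m > 0" by simp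
    have ge: "ennreal (1 / m) \<le> first_eigenvalue \<Omega>"
      unfolding first_eigenvalue_def
    proof (rule INF_greatest)
      fix p assume p: "p \<in> {(u, Du) \<in> W12_0 \<Omega>. \<not> (AE x in M. u x = 0)}"
      obtain u G where uG: "p = (u, G)" by (cases p)
      obtain q where "q > 0" "sqnorm M G / sqnorm M u = q" "1 \<le> m * q" using quot[of u G] p uG by auto
      then have "1 / m \<le> sqnorm M G / sqnorm M u" using m by (simp add: field_simps)
      then show "ennreal (1 / m) \<le> (case p of (u, Du) \<Rightarrow> ennreal ((\<integral>x. (norm (Du x))\<^sup>2 \<partial>M) / (\<integral>x. \<bar>u x\<bar>\<^sup>2 \<partial>M)))"
        unfolding uG prod.case quot_eq by (rule ennreal_leI)
    qed
    show ?thesis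
    proof (cases "first_eigenvalue \<Omega>")
      case (real l)
      with ge m have "1 / m \<le> l" by simp
      moreover from this have "l > 0" using m by (meson divide_pos_pos less_le_trans zero_less_one)
      ultimately have "1 / ennreal l \<le> ennreal m"
        using m by (simp add: divide_ennreal[of 1 l, simplified] field_simps ennreal_leI)
      then show ?thesis using real \<open>Linf_norm \<Omega> _ = _\<close> by simp
    qed simp
  qed
qed

section \<open>The upper bound for the dual problem\<close>

text \<open>The bilinear form of the operator \<open>- \<Delta> - lam\<close>.\<close>

definition energy_form :: "real \<Rightarrow> ('a \<Rightarrow> real) \<Rightarrow> ('a \<Rightarrow> real) \<Rightarrow> real" where
  "energy_form lam a b = (\<integral>x. gradient a x \<bullet> gradient b x \<partial>M) - lam * (\<integral>x. a x * b x \<partial>M)"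

text \<open>Twice the energy whose Euler-Lagrange equation is \<open>- \<Delta> u - lam * u = 1\<close>.\<close>

definition torsion_energy :: "real \<Rightarrow> ('a \<Rightarrow> real) \<Rightarrow> real" where
  "torsion_energy lam a = energy_form lam a a - 2 * (\<integral>x. a x \<partial>M)"

lemma energy_form_self: "energy_form lam a a = sqnorm M (gradient a) - lam * sqnorm M a"
  by (simp add: energy_form_def sqnorm_def power2_norm_eq_inner) (simp add: power2_eq_square)

lemma test_integrable: "a \<in> C1_0 \<Omega> \<Longrightarrow> integrable M a"
  by (rule square_integrable_integrable[OF finite_M test_square_integrable(1)])

lemma test_products:
  assumes "a \<in> C1_0 \<Omega>" "b \<in> C1_0 \<Omega>"
  shows "integrable M (\<lambda>x. a x * b x)" "integrable M (\<lambda>x. gradient a x \<bullet> gradient b x)"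
  using square_integrable_inner[OF test_square_integrable(1)[OF assms(1)] test_square_integrable(1)[OF assms(2)]]
    square_integrable_inner[OF test_square_integrable(2)[OF assms(1)] test_square_integrable(2)[OF assms(2)]] by auto

lemma energy_form_lincomb:
  fixes p q :: real
  assumes a: "a \<in> C1_0 \<Omega>" and b: "b \<in> C1_0 \<Omega>"
  defines "c \<equiv> \<lambda>x. p * a x + q * b x"
  shows "energy_form lam c c = p\<^sup>2 * energy_form lam a a + 2 * p * q * energy_form lam a b + q\<^sup>2 * energy_form lam b b"
    "torsion_energy lam c = p\<^sup>2 * energy_form lam a a + 2 * p * q * energy_form lam a b + q\<^sup>2 * energy_form lam b b
        - 2 * p * (\<integral>x. a x \<partial>M) - 2 * q * (\<integral>x. b x \<partial>M)"
proof -
  note I = test_products[OF a a] test_products[OF a b] test_products[OF b b] test_integrable[OF a] test_integrable[OF b]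
  have 1: "(\<integral>x. c x * c x \<partial>M) = p\<^sup>2 * (\<integral>x. a x * a x \<partial>M) + 2 * p * q * (\<integral>x. a x * b x \<partial>M) + q\<^sup>2 * (\<integral>x. b x * b x \<partial>M)"
  proof -
    have "(\<integral>x. c x * c x \<partial>M) = (\<integral>x. p\<^sup>2 * (a x * a x) + 2 * p * q * (a x * b x) + q\<^sup>2 * (b x * b x) \<partial>M)"
      by (rule Bochner_Integration.integral_cong) (auto simp: c_def algebra_simps power2_eq_square)
    then show ?thesis using I by simp
  qed
  have 2: "(\<integral>x. gradient c x \<bullet> gradient c x \<partial>M) = p\<^sup>2 * (\<integral>x. gradient a x \<bullet> gradient a x \<partial>M)
     + 2 * p * q * (\<integral>x. gradient a x \<bullet> gradient b x \<partial>M) + q\<^sup>2 * (\<integral>x. gradient b x \<bullet> gradient b x \<partial>M)"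
  proof -
    have "(\<integral>x. gradient c x \<bullet> gradient c x \<partial>M) = (\<integral>x. p\<^sup>2 * (gradient a x \<bullet> gradient a x)
        + 2 * p * q * (gradient a x \<bullet> gradient b x) + q\<^sup>2 * (gradient b x \<bullet> gradient b x) \<partial>M)"
      unfolding c_def C1_0_lincomb(2)[OF a b]
      by (rule Bochner_Integration.integral_cong)
        (auto simp: inner_add_left inner_add_right inner_commute algebra_simps power2_eq_square)
    then show ?thesis using I by simp
  qed
  have 3: "(\<integral>x. c x \<partial>M) = p * (\<integral>x. a x \<partial>M) + q * (\<integral>x. b x \<partial>M)"
    unfolding c_def using I by simp
  show E: "energy_form lam c c = p\<^sup>2 * energy_form lam a a + 2 * p * q * energy_form lam a b + q\<^sup>2 * energy_form lam b b"
    unfolding energy_form_def 1 2 by (simp add: algebra_simps)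
  show "torsion_energy lam c = p\<^sup>2 * energy_form lam a a + 2 * p * q * energy_form lam a b + q\<^sup>2 * energy_form lam b b
        - 2 * p * (\<integral>x. a x \<partial>M) - 2 * q * (\<integral>x. b x \<partial>M)"
    unfolding torsion_energy_def E 3 by (simp add: algebra_simps)
qed

text \<open>Below the first eigenvalue the form controls both \<open>L\<^sup>2\<close> norms: the Rayleigh inequality at \<open>lam'\<close>
  leaves the gap \<open>lam' - lam\<close>.\<close>

lemma energy_form_coercive:
  assumes "\<psi> \<in> C1_0 \<Omega>" "0 < lam" "lam < lam'" "ennreal lam' \<le> first_eigenvalue \<Omega>"
  shows "(lam' - lam) * sqnorm M \<psi> \<le> energy_form lam \<psi> \<psi>"
    "(1 - lam / lam') * sqnorm M (gradient \<psi>) \<le> energy_form lam \<psi> \<psi>"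
proof -
  have R: "lam' * sqnorm M \<psi> \<le> sqnorm M (gradient \<psi>)" by (rule Rayleigh_C1_0[OF assms(1,4)])
  then show "(lam' - lam) * sqnorm M \<psi> \<le> energy_form lam \<psi> \<psi>"
    by (simp add: energy_form_self algebra_simps)
  have "lam * sqnorm M \<psi> = (lam / lam') * (lam' * sqnorm M \<psi>)" using assms by simp
  also have "\<dots> \<le> (lam / lam') * sqnorm M (gradient \<psi>)" using R assms by (intro mult_left_mono) auto
  finally show "(1 - lam / lam') * sqnorm M (gradient \<psi>) \<le> energy_form lam \<psi> \<psi>"
    unfolding energy_form_self left_diff_distrib by simp
qed

lemma torsion_energy_bounded_below:
  assumes "\<psi> \<in> C1_0 \<Omega>" "0 < lam" "lam < lam'" "ennreal lam' \<le> first_eigenvalue \<Omega>"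
  shows "- measure M (space M) / (lam' - lam) \<le> torsion_energy lam \<psi>"
proof -
  define V s d where "V = sqrt (measure M (space M))" and "s = sqrt (sqnorm M \<psi>)" and "d = lam' - lam"
  have d: "d > 0" using assms by (simp add: d_def)
  have "square_integrable M (\<lambda>x. 1::real)" by (simp add: square_integrable_def)
  from square_integrable_Cauchy_Schwarz[OF test_square_integrable(1)[OF assms(1)] this]
  have "\<bar>\<integral>x. \<psi> x \<partial>M\<bar> \<le> s * V"
    by (simp add: sqnorm_def s_def V_def)
  then have "(\<integral>x. \<psi> x \<partial>M) \<le> s * V" by linarith
  moreover have "d * s\<^sup>2 \<le> energy_form lam \<psi> \<psi>"
    unfolding s_def d_def real_sqrt_pow2[OF sqnorm_nonneg] by (rule energy_form_coercive(1)[OF assms])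
  moreover have "- (V\<^sup>2 / d) \<le> d * s\<^sup>2 - 2 * (s * V)"
  proof -
    \<comment> \<open>The minimum over \<open>s\<close> of the parabola \<open>d * s\<^sup>2 - 2 * s * V\<close> is \<open>- V\<^sup>2 / d\<close>.\<close>
    have "0 \<le> (d * s - V)\<^sup>2 / d" using d by simp
    also have "\<dots> = d * s\<^sup>2 - 2 * (s * V) + V\<^sup>2 / d"
      using d by (simp add: power2_diff power2_eq_square field_simps)
    finally show ?thesis by simp
  qed
  ultimately have "- (V\<^sup>2 / d) \<le> torsion_energy lam \<psi>"
    unfolding torsion_energy_def by linarith
  then show ?thesis by (simp add: V_def d_def)
qed

text \<open>Replacing \<open>v\<close> by its absolute value does not increase the energy. To remain in the class \<open>C\<^sup>1\<close> the
  absolute value is smoothed to \<open>sqrt (v\<^sup>2 + \<delta>\<^sup>2) - \<delta>\<close>: this function is nonnegative, lies within \<open>\<delta>\<close>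
  of the absolute value, and has a gradient no longer than that of \<open>v\<close>. The loss is of order \<open>\<delta>\<close>.\<close>

lemma torsion_energy_smooth_abs:
  assumes v: "v \<in> C1_0 \<Omega>" and lam: "lam > 0" and e: "e > 0"
  obtains w where "w \<in> C1_0 \<Omega>" "\<And>x. w x \<ge> 0" "torsion_energy lam w \<le> torsion_energy lam v + e"
proof -
  obtain B where B: "B > 0" "\<And>x. \<bar>v x\<bar> \<le> B" using C1_0_bounded[OF v] by metis
  define V where "V = measure M (space M)"
  have V: "V \<ge> 0" by (simp add: V_def)
  define \<delta> where "\<delta> = e / (2 * lam * B * V + 2 * V + 1)"
  have den: "2 * lam * B * V + 2 * V + 1 > 0" using lam B V by (simp add: add_nonneg_pos)
  then have \<delta>: "\<delta> > 0" using e by (simp add: \<delta>_def)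
  define g where "g t = sqrt (t\<^sup>2 + \<delta>\<^sup>2) - \<delta>" for t
  define g' where "g' t = t / sqrt (t\<^sup>2 + \<delta>\<^sup>2)" for t
  have pos: "t\<^sup>2 + \<delta>\<^sup>2 > 0" for t :: real using \<delta> by (simp add: add_nonneg_pos)
  have g: "(g has_real_derivative g' t) (at t)" for t
    unfolding g_def[abs_def] g'_def using pos[of t]
    by (auto intro!: derivative_eq_intros simp: field_simps)
  have g'c: "continuous_on UNIV g'"
    unfolding g'_def[abs_def] using pos by (intro continuous_intros) (auto simp: less_imp_neq[symmetric])
  have g0: "g 0 = 0" using \<delta> by (simp add: g_def)
  have gn: "g t \<ge> 0" for t using \<delta> by (simp add: g_def real_le_rsqrt)
  have gu: "g t \<le> \<bar>t\<bar>" for t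
    using sqrt_add_le_add_sqrt[of "t\<^sup>2" "\<delta>\<^sup>2"] \<delta> by (simp add: g_def)
  have gl: "\<bar>t\<bar> - \<delta> \<le> g t" for t
    by (simp add: g_def real_le_rsqrt)
  have g'b: "\<bar>g' t\<bar> \<le> 1" for t
  proof -
    have "\<bar>t\<bar> \<le> sqrt (t\<^sup>2 + \<delta>\<^sup>2)" by (rule real_le_rsqrt) simp
    then show ?thesis using pos[of t] by (simp add: g'_def abs_divide divide_le_eq_1)
  qed
  define w where "w = (\<lambda>x. g (v x))"
  note w = C1_0_compose[OF v g g'c w_def g0]
  have 1: "sqnorm M (gradient w) \<le> sqnorm M (gradient v)"
    unfolding sqnorm_def
  proof (rule integral_mono)
    show "(norm (gradient w x))\<^sup>2 \<le> (norm (gradient v x))\<^sup>2" for x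
      unfolding w(2) using mult_right_mono[OF g'b[of "v x"], of "norm (gradient v x)"]
      by (intro power_mono) auto
  qed (use square_integrableD(2)[OF test_square_integrable(2)[OF v]] square_integrableD(2)[OF test_square_integrable(2)[OF w(1)]] in auto)
  have 2: "sqnorm M v \<le> sqnorm M w + 2 * \<delta> * B * V"
  proof -
    have "sqnorm M v \<le> (\<integral>x. (norm (w x))\<^sup>2 + 2 * \<delta> * B \<partial>M)"
      unfolding sqnorm_def
    proof (rule integral_mono)
      fix x
      have "\<bar>v x\<bar>\<^sup>2 - (w x)\<^sup>2 = (\<bar>v x\<bar> - w x) * (\<bar>v x\<bar> + w x)"
        by (simp add: power2_eq_square algebra_simps)
      also have "\<dots> \<le> \<delta> * (2 * B)"
        using gl[of "v x"] gu[of "v x"] gn[of "v x"] B(2)[of x] \<delta> B(1)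
        by (intro mult_mono) (auto simp: w_def)
      finally show "(norm (v x))\<^sup>2 \<le> (norm (w x))\<^sup>2 + 2 * \<delta> * B" by simp
    qed (use square_integrableD(2)[OF test_square_integrable(1)[OF v]] square_integrableD(2)[OF test_square_integrable(1)[OF w(1)]] in auto)
    then show ?thesis
      using square_integrableD(2)[OF test_square_integrable(1)[OF w(1)]] by (simp add: sqnorm_def V_def mult_ac)
  qed
  have 3: "(\<integral>x. v x \<partial>M) \<le> (\<integral>x. w x \<partial>M) + \<delta> * V"
  proof -
    have "(\<integral>x. v x \<partial>M) \<le> (\<integral>x. w x + \<delta> \<partial>M)"
    proof (rule integral_mono)
      show "v x \<le> w x + \<delta>" for x using gl[of "v x"] by (auto simp: w_def)
    qed (use test_integrable[OF v] test_integrable[OF w(1)] in auto)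
    then show ?thesis using test_integrable[OF w(1)] by (simp add: V_def mult_ac)
  qed
  have "lam * sqnorm M v \<le> lam * (sqnorm M w + 2 * \<delta> * B * V)" using 2 lam by (intro mult_left_mono) auto
  then have "torsion_energy lam w \<le> torsion_energy lam v + \<delta> * (2 * lam * B * V + 2 * V)"
    unfolding torsion_energy_def energy_form_self using 1 3 by (simp add: algebra_simps)
  also have "\<delta> * (2 * lam * B * V + 2 * V) \<le> \<delta> * (2 * lam * B * V + 2 * V + 1)"
    using \<delta> by (intro mult_left_mono) auto
  also have "\<dots> = e" using den by (simp add: \<delta>_def)
  finally have "torsion_energy lam w \<le> torsion_energy lam v + e" by simp
  then show ?thesis using that[OF w(1)] gn by (simp add: w_def)
qed

text \<open>The direct method for \<open>- \<Delta> u = lam * u + 1\<close>. A minimizing sequence of nonnegative test functions is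
  Cauchy in the Sobolev norm by the parallelogram identity and coercivity, its limit is nonnegative, and
  comparing energies along \<open>w n + t * \<eta>\<close> for all real \<open>t\<close> gives the equation.\<close>

lemma torsion_function_exists:
  assumes lam: "0 < lam" "lam < lam'" "ennreal lam' \<le> first_eigenvalue \<Omega>"
  obtains \<psi> u G where "sobolev_lim \<psi> u G" "AE x in M. u x \<ge> 0"
    "\<And>\<eta>. \<eta> \<in> C1_0 \<Omega> \<Longrightarrow> (\<integral>x. G x \<bullet> gradient \<eta> x \<partial>M) = (\<integral>x. (lam * u x + 1) * \<eta> x \<partial>M)"
proof -
  let ?J = "torsion_energy lam" and ?E = "energy_form lam"
  define m where "m = Inf (?J ` C1_0 \<Omega>)"
  have bdd: "bdd_below (?J ` C1_0 \<Omega>)"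
    using torsion_energy_bounded_below[OF _ lam] by (intro bdd_belowI2) auto
  have ne: "(\<lambda>x. 0) \<in> C1_0 \<Omega>"
    by (rule C1_0_I(1)[of _ "\<lambda>x. 0" "{}"]) (auto simp: GDERIV_const)
  have m_le: "m \<le> ?J a" if "a \<in> C1_0 \<Omega>" for a
    unfolding m_def using bdd that by (intro cInf_lower) auto
  have "\<exists>w. w \<in> C1_0 \<Omega> \<and> (\<forall>x. w x \<ge> 0) \<and> ?J w \<le> m + 2 / real (Suc n)" for n
  proof -
    have "\<exists>j\<in>?J ` C1_0 \<Omega>. j < m + 1 / real (Suc n)"
      unfolding m_def by (rule cInf_lessD) (use ne in auto)
    then obtain v where v: "v \<in> C1_0 \<Omega>" "?J v < m + 1 / real (Suc n)" by auto
    obtain w where w: "w \<in> C1_0 \<Omega>" "\<And>x. w x \<ge> 0" "?J w \<le> ?J v + 1 / real (Suc n)"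
      by (rule torsion_energy_smooth_abs[OF v(1) lam(1), of "1 / real (Suc n)"]) auto
    have "2 / real (Suc n) = 1 / real (Suc n) + 1 / real (Suc n)" by simp
    then have "?J w \<le> m + 2 / real (Suc n)" using v(2) w(3) by linarith
    then show ?thesis using w(1,2) by blast
  qed
  then obtain w where w: "\<And>n. w n \<in> C1_0 \<Omega>" "\<And>n x. w n x \<ge> 0" "\<And>n. ?J (w n) \<le> m + 2 / real (Suc n)"
    by metis
  have J_lim: "(\<lambda>n. ?J (w n)) \<longlonglongrightarrow> m"
  proof (rule tendsto_sandwich[OF always_eventually[OF allI] always_eventually[OF allI] tendsto_const])
    show "m \<le> ?J (w n)" for n by (rule m_le[OF w(1)])
    show "?J (w n) \<le> m + 2 * inverse (real (Suc n))" for n using w(3)[of n] by (simp add: divide_inverse)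
    show "(\<lambda>n. m + 2 * inverse (real (Suc n))) \<longlonglongrightarrow> m"
      using tendsto_add[OF tendsto_const[of m] tendsto_mult[OF tendsto_const[of 2] LIMSEQ_inverse_real_of_nat]] by simp
  qed
  \<comment> \<open>The parallelogram identity for the midpoint of \<open>w i\<close> and \<open>w j\<close>.\<close>
  have par: "?E (\<lambda>x. w i x - w j x) (\<lambda>x. w i x - w j x) \<le> 2 * (?J (w i) + ?J (w j) - 2 * m)" for i j
  proof -
    have "m \<le> ?J (\<lambda>x. (1/2) * w i x + (1/2) * w j x)"
      by (rule m_le[OF C1_0_lincomb(1)[OF w(1) w(1)]])
    then show ?thesis
      using energy_form_lincomb(1)[OF w(1) w(1), of lam 1 i "-1" j] energy_form_lincomb(2)[OF w(1) w(1), of lam "1/2" i "1/2" j]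
      by (simp add: torsion_energy_def power2_eq_square)
  qed
  have gradd: "gradient (\<lambda>x. w i x - w j x) = (\<lambda>x. gradient (w i) x - gradient (w j) x)"
    "(\<lambda>x. w i x - w j x) \<in> C1_0 \<Omega>" for i j
    using C1_0_lincomb[OF w(1) w(1), of 1 i "-1" j] by simp_all
  define d where "d = min (lam' - lam) (1 - lam / lam')"
  have d: "d > 0" using lam by (simp add: d_def)
  have cauchy: "\<exists>N. \<forall>i\<ge>N. \<forall>j\<ge>N. sqnorm M (\<lambda>x. w i x - w j x) < e \<and> sqnorm M (\<lambda>x. gradient (w i) x - gradient (w j) x) < e"
    if e: "e > 0" for e
  proof -
    have "\<forall>\<^sub>F n in sequentially. ?J (w n) < m + d * e / 4"
      using J_lim by (rule order_tendstoD) (use d e in simp)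
    then obtain N where N: "\<And>n. n \<ge> N \<Longrightarrow> ?J (w n) < m + d * e / 4"
      unfolding eventually_sequentially by blast
    have "sqnorm M (\<lambda>x. w i x - w j x) < e \<and> sqnorm M (\<lambda>x. gradient (w i) x - gradient (w j) x) < e"
      if "i \<ge> N" "j \<ge> N" for i j
    proof -
      have lt: "?E (\<lambda>x. w i x - w j x) (\<lambda>x. w i x - w j x) < d * e"
      proof -
        have "2 * (?J (w i) + ?J (w j) - 2 * m) < d * e"
          using add_strict_mono[OF N[OF that(1)] N[OF that(2)]] by (simp add: field_simps)
        with par[of i j] show ?thesis by (rule le_less_trans)
      qed
      have "d * sqnorm M (\<lambda>x. w i x - w j x) \<le> (lam' - lam) * sqnorm M (\<lambda>x. w i x - w j x)"
        by (rule mult_right_mono) (auto simp: d_def sqnorm_nonneg)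
      also note energy_form_coercive(1)[OF gradd(2) lam]
      also note lt
      finally have 1: "sqnorm M (\<lambda>x. w i x - w j x) < e" using d by simp
      have "d * sqnorm M (gradient (\<lambda>x. w i x - w j x)) \<le> (1 - lam / lam') * sqnorm M (gradient (\<lambda>x. w i x - w j x))"
        by (rule mult_right_mono) (auto simp: d_def sqnorm_nonneg)
      also note energy_form_coercive(2)[OF gradd(2) lam]
      also note lt
      finally have 2: "sqnorm M (gradient (\<lambda>x. w i x - w j x)) < e" using d by simp
      show ?thesis using 1 2 unfolding gradd(1) by simp
    qed
    then show ?thesis by blast
  qed
  obtain u where u: "square_integrable M u" "(\<lambda>n. sqnorm M (\<lambda>x. w n x - u x)) \<longlonglongrightarrow> 0"
  proof (rule L2_complete[of M w])
    show "square_integrable M (w n)" for n by (rule test_square_integrable(1)[OF w(1)])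
    show "\<exists>N. \<forall>i\<ge>N. \<forall>j\<ge>N. sqnorm M (\<lambda>x. w i x - w j x) < e" if "e > 0" for e
      using cauchy[OF that] by meson
  qed
  obtain G where G: "square_integrable M G" "(\<lambda>n. sqnorm M (\<lambda>x. gradient (w n) x - G x)) \<longlonglongrightarrow> 0"
  proof (rule L2_complete[of M "\<lambda>n. gradient (w n)"])
    show "square_integrable M (gradient (w n))" for n by (rule test_square_integrable(2)[OF w(1)])
    show "\<exists>N. \<forall>i\<ge>N. \<forall>j\<ge>N. sqnorm M (\<lambda>x. gradient (w i) x - gradient (w j) x) < e" if "e > 0" for e
      using cauchy[OF that] by meson
  qed
  have lim: "sobolev_lim w u G" using w(1) u G by (simp add: sobolev_lim_def)
  have nonneg: "AE x in M. u x \<ge> 0"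
  proof -
    obtain r :: "nat \<Rightarrow> nat" where "AE x in M. (\<lambda>n. w (r n) x) \<longlonglongrightarrow> u x"
      using sobolev_lim_AE[OF lim] by blast
    then show ?thesis
      by eventually_elim (erule LIMSEQ_le_const, use w(2) in auto)
  qed
  have EL: "(\<integral>x. G x \<bullet> gradient \<eta> x \<partial>M) = (\<integral>x. (lam * u x + 1) * \<eta> x \<partial>M)" if \<eta>: "\<eta> \<in> C1_0 \<Omega>" for \<eta>
  proof -
    note D = sobolev_limD[OF lim] and sq = test_square_integrable[OF \<eta>]
    have const: "(\<lambda>n. sqnorm M (\<lambda>x. f x - f x)) \<longlonglongrightarrow> 0" for f :: "'a \<Rightarrow> 'c::euclidean_space"
      by (simp add: sqnorm_def)
    define E where "E = (\<integral>x. G x \<bullet> gradient \<eta> x \<partial>M) - lam * (\<integral>x. u x * \<eta> x \<partial>M)"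
    define I where "I = (\<integral>x. \<eta> x \<partial>M)"
    have El: "(\<lambda>n. ?E (w n) \<eta>) \<longlonglongrightarrow> E"
      unfolding energy_form_def E_def
      using inner_tendsto_L2[OF D(5) sq(2) D(3) sq(2) D(7) const]
        inner_tendsto_L2[OF D(4) sq(1) D(2) sq(1) D(6) const]
      by (intro tendsto_intros) (simp_all add: inner_real_def)
    have ineq: "0 \<le> 2 * t * (E - I) + t\<^sup>2 * ?E \<eta> \<eta>" for t
    proof -
      have "m \<le> ?J (w n) + 2 * t * (?E (w n) \<eta> - I) + t\<^sup>2 * ?E \<eta> \<eta>" for n
        using m_le[OF C1_0_lincomb(1)[OF w(1)[of n] \<eta>, of 1 t]] energy_form_lincomb(2)[OF w(1) \<eta>, of lam 1 n t]
        by (simp add: torsion_energy_def I_def algebra_simps)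
      moreover have "(\<lambda>n. ?J (w n) + 2 * t * (?E (w n) \<eta> - I) + t\<^sup>2 * ?E \<eta> \<eta>) \<longlonglongrightarrow> m + 2 * t * (E - I) + t\<^sup>2 * ?E \<eta> \<eta>"
        by (intro tendsto_intros J_lim El)
      ultimately have "m \<le> m + 2 * t * (E - I) + t\<^sup>2 * ?E \<eta> \<eta>"
        by (intro LIMSEQ_le_const) auto
      then show ?thesis by simp
    qed
    have "E = I"
    proof (rule ccontr)
      assume "E \<noteq> I"
      define c q where "c = E - I" and "q = ?E \<eta> \<eta>"
      have c: "c \<noteq> 0" using \<open>E \<noteq> I\<close> by (simp add: c_def)
      have q: "q \<ge> 0"
        unfolding q_def
        by (rule order_trans[OF _ energy_form_coercive(1)[OF \<eta> lam]]) (use lam in \<open>simp add: sqnorm_nonneg\<close>)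
      \<comment> \<open>The quadratic polynomial \<open>2 * c * t + q * t\<^sup>2\<close> is negative at \<open>t = - c / (q + 1)\<close>; the shift by one covers \<open>q = 0\<close>.\<close>
      have "2 * (- c / (q + 1)) * c + (- c / (q + 1))\<^sup>2 * q = - (c\<^sup>2 * (q + 2)) / (q + 1)\<^sup>2"
        using q by (simp add: power2_eq_square divide_simps) (simp add: algebra_simps)
      moreover have "c\<^sup>2 * (q + 2) / (q + 1)\<^sup>2 > 0" using c q by (intro divide_pos_pos mult_pos_pos) auto
      ultimately show False using ineq[of "- c / (q + 1)"] unfolding c_def[symmetric] q_def[symmetric] by simp
    qed
    have "(\<integral>x. (lam * u x + 1) * \<eta> x \<partial>M) = (\<integral>x. lam * (u x * \<eta> x) + \<eta> x \<partial>M)"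
      by (rule Bochner_Integration.integral_cong) (auto simp: algebra_simps)
    also have "\<dots> = lam * (\<integral>x. u x * \<eta> x \<partial>M) + I"
      using square_integrable_inner[OF D(2) sq(1)] test_integrable[OF \<eta>] by (simp add: I_def)
    finally show ?thesis using \<open>E = I\<close> by (simp add: E_def)
  qed
  show ?thesis using lim nonneg EL by (rule that)
qed

text \<open>For \<open>\<phi> = DU / (\<mu> U)\<close> and \<open>f = - (norm DU)\<^sup>2 / (\<mu> U\<^sup>2)\<close> the quotient \<open>(norm \<phi>)\<^sup>2 / \<bar>f\<bar>\<close> is the
  constant \<open>1 / \<mu>\<close> wherever \<open>DU\<close> does not vanish; elsewhere both entries are zero and \<open>G2 0 0 = 0\<close>.\<close>

lemma Linf_norm_G2_log_gradient_le:
  assumes "\<mu> > 0" "U \<in> borel_measurable M" "DU \<in> borel_measurable M" "AE x in M. U x > 0"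
  shows "Linf_norm \<Omega> (\<lambda>x. G2 (- (1 / \<mu>) * ((norm (DU x))\<^sup>2 / (U x)\<^sup>2)) ((1 / \<mu>) *\<^sub>R (DU x /\<^sub>R U x))) \<le> ennreal (1 / \<mu>)"
  unfolding Linf_norm_def
proof (rule esssup_I)
  note [measurable] = assms(2,3)
  show "(\<lambda>x. G2 (- (1 / \<mu>) * ((norm (DU x))\<^sup>2 / (U x)\<^sup>2)) ((1 / \<mu>) *\<^sub>R (DU x /\<^sub>R U x))) \<in> borel_measurable M"
    unfolding G2_def by measurable
  show "AE x in M. G2 (- (1 / \<mu>) * ((norm (DU x))\<^sup>2 / (U x)\<^sup>2)) ((1 / \<mu>) *\<^sub>R (DU x /\<^sub>R U x)) \<le> ennreal (1 / \<mu>)"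
    using assms(4)
  proof eventually_elim
    case (elim x)
    show ?case
    proof (cases "DU x = 0")
      case False
      define s where "s = (1 / \<mu>) * ((norm (DU x))\<^sup>2 / (U x)\<^sup>2)"
      have s: "s > 0" using False elim assms(1) by (simp add: s_def)
      have "(norm ((1 / \<mu>) *\<^sub>R (DU x /\<^sub>R U x)))\<^sup>2 = (1 / \<mu>) * s"
        by (simp add: s_def power_mult_distrib power_divide power2_eq_square divide_inverse mult_ac)
      then have "(norm ((1 / \<mu>) *\<^sub>R (DU x /\<^sub>R U x)))\<^sup>2 / \<bar>- s\<bar> = 1 / \<mu>" using s by simp
      then have "G2 (- s) ((1 / \<mu>) *\<^sub>R (DU x /\<^sub>R U x)) = ennreal (1 / \<mu>)"
        using s unfolding G2_def by simp
      then show ?thesis by (simp add: s_def)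
    qed (simp add: G2_def)
  qed
qed

text \<open>If \<open>- \<Delta> u = lam * u + 1\<close> with \<open>u \<ge> 0\<close>, then \<open>w = u + 1 / lam\<close> satisfies \<open>- \<Delta> w = lam * w\<close> and is
  bounded below by \<open>1 / lam\<close>. Its logarithmic gradient therefore yields an admissible pair exactly as a
  positive eigenfunction would, with the value \<open>1 / lam\<close>, and the lower bound on \<open>w\<close> makes the pair
  integrable.\<close>

lemma dual_value_le_inverse:
  assumes lam: "0 < lam" "lam < lam'" "ennreal lam' \<le> first_eigenvalue \<Omega>"
  shows "(INF (f, \<phi>) \<in> admissible \<Omega>. Linf_norm \<Omega> (\<lambda>x. G2 (f x) (\<phi> x))) \<le> ennreal (1 / lam)"
proof -
  obtain \<psi> u G where lim: "sobolev_lim \<psi> u G" and nonneg: "AE x in M. u x \<ge> 0"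
    and eqn: "\<And>\<eta>. \<eta> \<in> C1_0 \<Omega> \<Longrightarrow> (\<integral>x. G x \<bullet> gradient \<eta> x \<partial>M) = (\<integral>x. (lam * u x + 1) * \<eta> x \<partial>M)"
    using torsion_function_exists[OF lam] by blast
  note sq = sobolev_limD(2,3)[OF lim]
  define w where "w x = u x + 1 / lam" for x
  define f where "f x = - (1 / lam) * ((norm (G x))\<^sup>2 / (w x)\<^sup>2)" for x
  define \<phi> where "\<phi> x = (1 / lam) *\<^sub>R (G x /\<^sub>R w x)" for x
  note [measurable] = square_integrableD(1)[OF sq(1)] square_integrableD(1)[OF sq(2)]
  have wm[measurable]: "w \<in> borel_measurable M" unfolding w_def[abs_def] by measurable
  have wpos: "AE x in M. w x \<ge> 1 / lam" using nonneg by eventually_elim (simp add: w_def)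
  have winv: "AE x in M. w x > 0 \<and> 1 / w x \<le> lam"
    using wpos
  proof eventually_elim
    case (elim x)
    then have "w x > 0" using lam(1) by (meson divide_pos_pos less_le_trans zero_less_one)
    moreover from this have "1 / w x \<le> lam" using elim lam(1) by (simp add: field_simps)
    ultimately show ?case ..
  qed
  have f_int: "integrable M f"
  proof (rule Bochner_Integration.integrable_bound)
    show "integrable M (\<lambda>x. lam * (norm (G x))\<^sup>2)" using square_integrableD(2)[OF sq(2)] by simp
    show "AE x in M. norm (f x) \<le> norm (lam * (norm (G x))\<^sup>2)"
      using winv
    proof eventually_elim
      case (elim x)
      have "(1 / w x)\<^sup>2 \<le> lam\<^sup>2" using elim by (intro power_mono) auto
      then have "(1 / lam) * ((1 / w x)\<^sup>2 * (norm (G x))\<^sup>2) \<le> (1 / lam) * (lam\<^sup>2 * (norm (G x))\<^sup>2)"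
        using lam(1) by (intro mult_left_mono mult_right_mono) auto
      then show ?case using lam(1) by (simp add: f_def power_divide power2_eq_square)
    qed
  qed (unfold f_def[abs_def], measurable)
  have \<phi>_sq: "square_integrable M \<phi>"
  proof (rule square_integrable_dominated[OF sq(2), of _ 1])
    show "AE x in M. norm (\<phi> x) \<le> 1 * norm (G x)"
      using winv
    proof eventually_elim
      case (elim x)
      have "(1 / lam) * (1 / w x) \<le> (1 / lam) * lam" using elim lam(1) by (intro mult_left_mono) auto
      then have "((1 / lam) * (1 / w x)) * norm (G x) \<le> 1 * norm (G x)"
        using lam(1) by (intro mult_right_mono) auto
      then show ?case using elim lam(1) by (simp add: \<phi>_def divide_inverse mult_ac)
    qed
  qed (unfold \<phi>_def[abs_def], measurable)
  have "(f, \<phi>) \<in> admissible \<Omega>"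
    unfolding admissible_def mem_Collect_eq prod.case
  proof (intro conjI ballI impI)
    show "f \<in> L1_loc \<Omega>" by (rule integrable_L1_loc[OF f_int])
    show "\<phi> \<in> L2_loc \<Omega>" by (rule square_integrable_L2_loc[OF \<phi>_sq])
    fix \<zeta> assume \<zeta>: "\<zeta> \<in> C1_0 \<Omega>"
    note [measurable] = test_measurable[OF \<zeta>]
    have h: "square_integrable M (\<lambda>x. lam * u x + 1)"
    proof -
      have "square_integrable M (\<lambda>x. 1::real)" by (simp add: square_integrable_def)
      from square_integrable_add_scale(1)[OF this sq(1), of lam] show ?thesis by (simp add: add.commute)
    qed
    have "(\<integral>x. \<zeta> x \<partial>M) = (1 / lam) * (\<integral>x. lam * \<zeta> x \<partial>M)" using lam(1) by simp
    also have "(\<integral>x. lam * \<zeta> x \<partial>M) = (\<integral>x. (lam * u x + 1) * \<zeta> x / (u x + 1 / lam) \<partial>M)"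
    proof (rule integral_cong_AE)
      show "AE x in M. lam * \<zeta> x = (lam * u x + 1) * \<zeta> x / (u x + 1 / lam)"
        using winv
      proof eventually_elim
        case (elim x)
        have "lam * u x + 1 = lam * w x" using lam(1) by (simp add: w_def distrib_left)
        with elim show ?case unfolding w_def[symmetric] by simp
      qed
    qed measurable
    also have "\<dots> = (\<integral>x. (gradient \<zeta> x \<bullet> G x) / (u x + 1 / lam) - \<zeta> x * (norm (G x))\<^sup>2 / (u x + 1 / lam)\<^sup>2 \<partial>M)"
      by (rule equation_tested_with_reciprocal[OF lim eqn h \<zeta> _ nonneg, symmetric]) (use lam in auto)
    also have "(1 / lam) * \<dots> = (\<integral>x. (1 / lam) * ((gradient \<zeta> x \<bullet> G x) / (u x + 1 / lam) - \<zeta> x * (norm (G x))\<^sup>2 / (u x + 1 / lam)\<^sup>2) \<partial>M)"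
      by simp
    also have "\<dots> = (\<integral>x. (gradient \<zeta> x \<bullet> \<phi> x + f x * \<zeta> x) \<partial>M)"
      by (rule Bochner_Integration.integral_cong)
        (auto simp: \<phi>_def f_def w_def divide_inverse algebra_simps)
    finally show "(\<integral>x. \<zeta> x \<partial>M) \<le> (\<integral>x. (gradient \<zeta> x \<bullet> \<phi> x + f x * \<zeta> x) \<partial>M)" by simp
  qed
  then have "(INF (f, \<phi>) \<in> admissible \<Omega>. Linf_norm \<Omega> (\<lambda>x. G2 (f x) (\<phi> x))) \<le> Linf_norm \<Omega> (\<lambda>x. G2 (f x) (\<phi> x))"
    by (rule INF_lower2) simp
  also have "\<dots> \<le> ennreal (1 / lam)"
    unfolding f_def \<phi>_def
    by (rule Linf_norm_G2_log_gradient_le[OF lam(1)]) (use winv in \<open>auto elim: eventually_mono\<close>)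
  finally show ?thesis .
qed

text \<open>A gap between the two sides would contain a real number \<open>c\<close>; then \<open>1 / c\<close> lies strictly below the
  first eigenvalue and the upper bound at \<open>lam = 1 / c\<close> is violated. This argument covers an infinite
  eigenvalue and, since no \<open>c\<close> lies above \<open>1 / 0 = \<infinity>\<close>, a vanishing one.\<close>

lemma inverse_eigenvalue_eq_dual_value:
  "1 / first_eigenvalue \<Omega> = (INF (f, \<phi>) \<in> admissible \<Omega>. Linf_norm \<Omega> (\<lambda>x. G2 (f x) (\<phi> x)))" (is "?L = ?I")
proof (rule antisym)
  show "?L \<le> ?I"
    by (rule INF_greatest) (use inverse_eigenvalue_le_Linf_norm in auto)
  show "?I \<le> ?L"
  proof (rule ccontr)
    assume "\<not> ?I \<le> ?L"
    then have "?L < ?I" by (rule not_le_imp_less)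
    from dense[OF this] obtain c' where c': "?L < c'" "c' < ?I" by (elim exE conjE)
    then have "c' < top" using top.not_eq_extremum by fastforce
    then obtain c where c: "c' = ennreal c" "c \<ge> 0" by (cases c') auto
    have "c > 0" using c c' by (cases "c = 0") auto
    have "ennreal (1 / c) < first_eigenvalue \<Omega>"
    proof (cases "first_eigenvalue \<Omega>")
      case (real l)
      have "l \<noteq> 0" using real c' c by (intro notI) simp
      then have l: "l > 0" using real by simp
      then have "ennreal (1 / l) < ennreal c"
        using c' c real by (simp add: divide_ennreal[of 1 l, simplified])
      then have "1 / l < c" using l by (simp add: ennreal_less_iff)
      then have "1 / c < l" using l \<open>c > 0\<close> by (simp add: field_simps)
      then show ?thesis using real \<open>c > 0\<close> by (simp add: ennreal_less_iff)
    qed simp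
    from dense[OF this] obtain z where z: "ennreal (1 / c) < z" "z < first_eigenvalue \<Omega>" by (elim exE conjE)
    then obtain lam' where lam': "z = ennreal lam'" "lam' \<ge> 0" by (cases z) auto
    have "1 / c < lam'" using z lam' \<open>c > 0\<close> by (simp add: ennreal_less_iff)
    then have "?I \<le> ennreal (1 / (1 / c))"
      using dual_value_le_inverse[of "1 / c" lam'] \<open>c > 0\<close> z lam' by simp
    then show False using c' c by simp
  qed
qed

section \<open>The minimizer built from a positive eigenfunction\<close>

text \<open>The eigenvalue equation is required for smooth test functions only; density extends it to \<open>C\<^sup>1\<close>.\<close>

lemma eigenfunction_test:
  assumes ef: "first_eigenfunction \<Omega> U DU" and \<eta>: "\<eta> \<in> C1_0 \<Omega>"
  shows "(\<integral>x. DU x \<bullet> gradient \<eta> x \<partial>M) = (\<integral>x. (enn2real (first_eigenvalue \<Omega>) * U x) * \<eta> x \<partial>M)"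
proof -
  have sq: "square_integrable M U" "square_integrable M DU"
    using ef by (auto simp: first_eigenfunction_def W12_0_def L2_iff_square_integrable)
  obtain p where p: "\<And>n. p n \<in> Cinf_0 \<Omega>" "sobolev_lim p \<eta> (gradient \<eta>)"
    using C1_0_smooth_approx[OF \<eta>] by blast
  note D = sobolev_limD[OF p(2)]
  have const: "(\<lambda>n. sqnorm M (\<lambda>x. f x - f x)) \<longlonglongrightarrow> 0" for f :: "'a \<Rightarrow> 'c::euclidean_space"
    by (simp add: sqnorm_def)
  have 1: "(\<lambda>n. \<integral>x. DU x \<bullet> gradient (p n) x \<partial>M) \<longlonglongrightarrow> (\<integral>x. DU x \<bullet> gradient \<eta> x \<partial>M)"
    by (rule inner_tendsto_L2[OF sq(2) D(5) sq(2) D(3) const D(7)])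
  have 2: "(\<lambda>n. enn2real (first_eigenvalue \<Omega>) * (\<integral>x. U x \<bullet> p n x \<partial>M)) \<longlonglongrightarrow> enn2real (first_eigenvalue \<Omega>) * (\<integral>x. U x \<bullet> \<eta> x \<partial>M)"
    by (rule tendsto_mult[OF tendsto_const inner_tendsto_L2[OF sq(1) D(4) sq(1) D(2) const D(6)]])
  have "(\<integral>x. DU x \<bullet> gradient (p n) x \<partial>M) = enn2real (first_eigenvalue \<Omega>) * (\<integral>x. U x \<bullet> p n x \<partial>M)" for n
    using ef p(1)[of n] by (simp add: first_eigenfunction_def)
  with 1 2 have "(\<integral>x. DU x \<bullet> gradient \<eta> x \<partial>M) = enn2real (first_eigenvalue \<Omega>) * (\<integral>x. U x \<bullet> \<eta> x \<partial>M)"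
    using LIMSEQ_unique by fastforce
  then show ?thesis by (simp add: mult.assoc)
qed

text \<open>If the eigenvalue were zero, testing the equation with approximations of \<open>U\<close> would give \<open>DU = 0\<close>.
  Integrating the bounded function \<open>arctan (x \<bullet> b)\<close> by parts against these approximations then shows that
  the integral of \<open>U / (1 + (x \<bullet> b)\<^sup>2)\<close> vanishes, which contradicts \<open>U > 0\<close>. Finiteness of the measure enters
  through the square-integrability of \<open>arctan\<close>.\<close>

lemma eigenvalue_finite_pos:
  assumes ef: "first_eigenfunction \<Omega> U DU" and pos: "AE x in M. U x > 0"
  shows "enn2real (first_eigenvalue \<Omega>) > 0" "first_eigenvalue \<Omega> = ennreal (enn2real (first_eigenvalue \<Omega>))"
proof -
  have W: "(U, DU) \<in> W12_0 \<Omega>" and nz: "\<not> (AE x in M. U x = 0)"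
    using ef by (auto simp: first_eigenfunction_def)
  obtain \<psi> where lim: "sobolev_lim \<psi> U DU" using W12_0_sobolev_lim[OF W] by blast
  note D = sobolev_limD[OF lim]
  have "first_eigenvalue \<Omega> \<le> ennreal ((\<integral>x. (norm (DU x))\<^sup>2 \<partial>M) / (\<integral>x. \<bar>U x\<bar>\<^sup>2 \<partial>M))"
    unfolding first_eigenvalue_def by (rule INF_lower2[of "(U, DU)"]) (use W nz in auto)
  then have "first_eigenvalue \<Omega> < top" using ennreal_less_top le_less_trans by blast
  then show fin: "first_eigenvalue \<Omega> = ennreal (enn2real (first_eigenvalue \<Omega>))" by simp
  show "enn2real (first_eigenvalue \<Omega>) > 0"
  proof (rule ccontr)
    assume "\<not> enn2real (first_eigenvalue \<Omega>) > 0"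
    then have zero: "enn2real (first_eigenvalue \<Omega>) = 0"
      using enn2real_nonneg[of "first_eigenvalue \<Omega>"] by linarith
    have const: "(\<lambda>n. sqnorm M (\<lambda>x. f x - f x)) \<longlonglongrightarrow> 0" for f :: "'a \<Rightarrow> 'c::euclidean_space"
      by (simp add: sqnorm_def)
    have "(\<lambda>n. \<integral>x. DU x \<bullet> gradient (\<psi> n) x \<partial>M) \<longlonglongrightarrow> (\<integral>x. DU x \<bullet> DU x \<partial>M)"
      by (rule inner_tendsto_L2[OF D(3) D(5) D(3) D(3) const D(7)])
    moreover have "(\<integral>x. DU x \<bullet> gradient (\<psi> n) x \<partial>M) = 0" for n
      using eigenfunction_test[OF ef D(1)] zero by simp
    ultimately have "(\<integral>x. DU x \<bullet> DU x \<partial>M) = 0" using LIMSEQ_unique[OF _ tendsto_const] by fastforce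
    then have "sqnorm M DU = 0" by (simp add: sqnorm_def power2_norm_eq_inner)
    then have DU0: "AE x in M. DU x = 0" using sqnorm_eq_0_iff[OF D(3)] by blast
    obtain b :: 'a where b: "b \<in> Basis" using nonempty_Basis by blast
    define F where "F x = arctan (x \<bullet> b)" for x :: 'a
    have Fb: "\<bar>F x\<bar> \<le> pi / 2" for x
      unfolding F_def using arctan_lbound[of "x \<bullet> b"] arctan_ubound[of "x \<bullet> b"] by linarith
    define p where "p x = 1 / (1 + (x \<bullet> b)\<^sup>2)" for x :: 'a
    have den: "1 + (x \<bullet> b)\<^sup>2 > 0" for x :: 'a by (simp add: add_pos_nonneg)
    have F1: "GDERIV F x :> p x *\<^sub>R b" for x
      unfolding F_def[abs_def] p_def
      by (rule GDERIV_DERIV_compose[of "\<lambda>x. x \<bullet> b" x b arctan])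
        (auto simp: gderiv_def divide_inverse intro!: derivative_eq_intros)
    have pc: "continuous_on UNIV p" unfolding p_def[abs_def] 
      by (intro continuous_intros) (use den in \<open>auto simp: less_imp_neq[symmetric]\<close>)
    have F2: "continuous_on UNIV (\<lambda>x. p x *\<^sub>R b)" by (intro continuous_intros pc)
    note F = C1_I[OF F1 F2]
    have sqF: "square_integrable M (\<lambda>x. F x *\<^sub>R b)"
    proof (rule square_integrable_bounded[OF finite_M, of _ "pi / 2"])
      show "(\<lambda>x. F x *\<^sub>R b) \<in> borel_measurable M"
        by (intro continuous_measurable_lebesgue_on continuous_intros Ck_continuous[OF F(1)])
      show "norm (F x *\<^sub>R b) \<le> pi / 2" for x
        using Fb[of x] b by simp
    qed
    have sqp: "square_integrable M p"
    proof (rule square_integrable_bounded[OF finite_M continuous_measurable_lebesgue_on[OF pc], of 1])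
      show "norm (p x) \<le> 1" for x using den[of x] by (simp add: p_def)
    qed
    have l1: "(\<lambda>n. \<integral>x. (F x *\<^sub>R b) \<bullet> gradient (\<psi> n) x \<partial>M) \<longlonglongrightarrow> (\<integral>x. (F x *\<^sub>R b) \<bullet> DU x \<partial>M)"
      by (rule inner_tendsto_L2[OF sqF D(5) sqF D(3) const D(7)])
    have l2: "(\<lambda>n. \<integral>x. p x \<bullet> \<psi> n x \<partial>M) \<longlonglongrightarrow> (\<integral>x. p x \<bullet> U x \<partial>M)"
      by (rule inner_tendsto_L2[OF sqp D(4) sqp D(2) const D(6)])
    have parts: "(\<integral>x. (F x *\<^sub>R b) \<bullet> gradient (\<psi> n) x \<partial>M) = - (\<integral>x. p x \<bullet> \<psi> n x \<partial>M)" for n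
    proof -
      have i: "integrable M (\<lambda>x. F x *\<^sub>R gradient (\<psi> n) x)"
      proof (rule square_integrable_integrable[OF finite_M square_integrable_dominated[OF D(5), of _ "pi / 2"]])
        show "(\<lambda>x. F x *\<^sub>R gradient (\<psi> n) x) \<in> borel_measurable M"
          by (intro continuous_measurable_lebesgue_on continuous_intros Ck_continuous[OF F(1)] C1_0_D(4)[OF D(1)])
        show "AE x in M. norm (F x *\<^sub>R gradient (\<psi> n) x) \<le> pi / 2 * norm (gradient (\<psi> n) x)"
          unfolding norm_scaleR real_norm_def by (intro AE_I2 mult_right_mono Fb norm_ge_zero)
      qed
      have i': "integrable M (\<lambda>x. \<psi> n x *\<^sub>R p x *\<^sub>R b)"
      proof (rule square_integrable_integrable[OF finite_M square_integrable_dominated[OF D(4), of _ 1]])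
        show "(\<lambda>x. \<psi> n x *\<^sub>R p x *\<^sub>R b) \<in> borel_measurable M"
          by (intro continuous_measurable_lebesgue_on continuous_intros pc C1_0_D(3)[OF D(1)])
        show "AE x in M. norm (\<psi> n x *\<^sub>R p x *\<^sub>R b) \<le> 1 * norm (\<psi> n x)"
        proof (rule AE_I2)
          fix x
          have "norm (p x *\<^sub>R b) \<le> 1" using b den[of x] by (simp add: p_def)
          then show "norm (\<psi> n x *\<^sub>R p x *\<^sub>R b) \<le> 1 * norm (\<psi> n x)"
            unfolding norm_scaleR[of "\<psi> n x"] real_norm_def mult_1 by (rule mult_left_le) simp
        qed
      qed
      have "(\<integral>x. (F x *\<^sub>R b) \<bullet> gradient (\<psi> n) x \<partial>M) = b \<bullet> (\<integral>x. F x *\<^sub>R gradient (\<psi> n) x \<partial>M)"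
        by (subst integral_inner_right[symmetric]) (use i in auto)
      also have "\<dots> = - (b \<bullet> (\<integral>x. \<psi> n x *\<^sub>R p x *\<^sub>R b \<partial>M))"
        using integration_by_parts[OF open_\<Omega> D(1)[of n] F(1)] F(2) by simp
      also have "b \<bullet> (\<integral>x. \<psi> n x *\<^sub>R p x *\<^sub>R b \<partial>M) = (\<integral>x. p x \<bullet> \<psi> n x \<partial>M)"
        by (subst integral_inner_right[symmetric]) (use i' b in \<open>auto simp: inner_Basis mult.commute\<close>)
      finally show ?thesis .
    qed
    have "(\<integral>x. (F x *\<^sub>R b) \<bullet> DU x \<partial>M) = 0"
      by (rule integral_eq_zero_AE) (use DU0 in \<open>auto elim: eventually_mono\<close>)
    with LIMSEQ_unique[OF l1[unfolded parts] tendsto_minus[OF l2]]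
    have "(\<integral>x. p x \<bullet> U x \<partial>M) = 0" by simp
    moreover have "AE x in M. 0 \<le> p x \<bullet> U x"
      using pos by eventually_elim (use den in \<open>simp add: p_def less_imp_le\<close>)
    ultimately have "AE x in M. p x \<bullet> U x = 0"
      using integral_nonneg_eq_0_iff_AE[OF square_integrable_inner[OF sqp D(2)]] by blast
    then have "AE x in M. U x = 0"
    proof eventually_elim
      case (elim x)
      then show ?case using den[of x] by (simp add: p_def)
    qed
    with nz show False by blast
  qed
qed

text \<open>The logarithmic Caccioppoli estimate. Testing the equation with \<open>\<zeta>\<^sup>2 / (U + e)\<close>, whose right-hand side
  is nonnegative, and applying Cauchy-Schwarz bounds the \<open>L\<^sup>2\<close> norm of \<open>\<zeta> * DU / (U + e)\<close> by twice that of
  the gradient of \<open>\<zeta>\<close>, uniformly in \<open>e\<close>; Fatou's lemma lets \<open>e\<close> tend to zero. This gives local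
  integrability of the optimal pair although \<open>U\<close> is only known to be positive almost everywhere.\<close>

lemma eigenfunction_Caccioppoli:
  assumes ef: "first_eigenfunction \<Omega> U DU" and pos: "AE x in M. U x > 0" and \<zeta>: "\<zeta> \<in> C1_0 \<Omega>"
  shows "square_integrable M (\<lambda>x. (\<zeta> x / U x) *\<^sub>R DU x)"
proof -
  have W: "(U, DU) \<in> W12_0 \<Omega>" using ef by (auto simp: first_eigenfunction_def)
  obtain \<psi> where lim: "sobolev_lim \<psi> U DU" using W12_0_sobolev_lim[OF W] by blast
  note D = sobolev_limD[OF lim]
  define \<mu> where "\<mu> = enn2real (first_eigenvalue \<Omega>)"
  have \<mu>: "\<mu> \<ge> 0" by (simp add: \<mu>_def)
  have nonneg: "AE x in M. U x \<ge> 0" using pos by eventually_elim simp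
  note [measurable] = square_integrableD(1)[OF D(2)] square_integrableD(1)[OF D(3)] test_measurable[OF \<zeta>]
  have h: "square_integrable M (\<lambda>x. \<mu> * U x)"
    by (rule square_integrable_dominated[OF D(2), of _ \<mu>]) (use \<mu> in \<open>auto simp: abs_mult\<close>)
  obtain B where B: "B > 0" "\<And>x. \<bar>\<zeta> x\<bar> \<le> B" using C1_0_bounded[OF \<zeta>] by metis
  define a where "a e x = (\<zeta> x / (U x + e)) *\<^sub>R DU x" for e x
  have sqa: "square_integrable M (a e)" if e: "e > 0" for e
  proof (rule square_integrable_dominated[OF D(3), of _ "B / e"])
    show "a e \<in> borel_measurable M" unfolding a_def[abs_def] by measurable
    show "AE x in M. norm (a e x) \<le> B / e * norm (DU x)"
      using nonneg
    proof eventually_elim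
      case (elim x)
      have "\<bar>\<zeta> x\<bar> / (U x + e) \<le> B / e" using B elim e by (intro frac_le) auto
      then have "\<bar>\<zeta> x\<bar> / (U x + e) * norm (DU x) \<le> B / e * norm (DU x)" by (rule mult_right_mono) simp
      then show ?case using elim e by (simp add: a_def abs_divide)
    qed
  qed
  have bound: "sqnorm M (a e) \<le> 4 * sqnorm M (gradient \<zeta>)" if e: "e > 0" for e
  proof -
    note t = C1_mult_C1_0[OF \<zeta> C1_0_D(1)[OF \<zeta>]]
    have "(\<integral>x. (gradient (\<lambda>x. \<zeta> x * \<zeta> x) x \<bullet> DU x) / (U x + e) - \<zeta> x * \<zeta> x * (norm (DU x))\<^sup>2 / (U x + e)\<^sup>2 \<partial>M)
       = (\<integral>x. \<mu> * U x * (\<zeta> x * \<zeta> x) / (U x + e) \<partial>M)"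
      by (rule equation_tested_with_reciprocal[OF lim _ h t(1) e nonneg]) (use eigenfunction_test[OF ef] in \<open>simp add: \<mu>_def\<close>)
    also have "\<dots> \<ge> 0"
      by (rule integral_nonneg_AE) (use nonneg \<mu> e in \<open>auto elim!: eventually_mono\<close>)
    finally have "0 \<le> (\<integral>x. (gradient (\<lambda>x. \<zeta> x * \<zeta> x) x \<bullet> DU x) / (U x + e) - \<zeta> x * \<zeta> x * (norm (DU x))\<^sup>2 / (U x + e)\<^sup>2 \<partial>M)" .
    also have "\<dots> = (\<integral>x. 2 * (gradient \<zeta> x \<bullet> a e x) - (norm (a e x))\<^sup>2 \<partial>M)"
      by (rule Bochner_Integration.integral_cong)
        (auto simp: t(2) a_def inner_add_left power_mult_distrib power_divide power2_eq_square)
    also have "\<dots> = 2 * (\<integral>x. gradient \<zeta> x \<bullet> a e x \<partial>M) - sqnorm M (a e)"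
      using square_integrable_inner[OF test_square_integrable(2)[OF \<zeta>] sqa[OF e]] square_integrableD(2)[OF sqa[OF e]] by (simp add: sqnorm_def)
    finally have le: "sqnorm M (a e) \<le> 2 * (sqrt (sqnorm M (gradient \<zeta>)) * sqrt (sqnorm M (a e)))"
      using square_integrable_Cauchy_Schwarz[OF test_square_integrable(2)[OF \<zeta>] sqa[OF e]] by linarith
    have "sqrt (sqnorm M (a e)) \<le> 2 * sqrt (sqnorm M (gradient \<zeta>))"
    proof (cases "sqnorm M (a e) = 0")
      case False
      then have s: "sqrt (sqnorm M (a e)) > 0" using sqnorm_nonneg[of M "a e"] by simp
      have "sqrt (sqnorm M (a e)) * sqrt (sqnorm M (a e)) = sqnorm M (a e)"
        using sqnorm_nonneg[of M "a e"] by simp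
      with le have "sqrt (sqnorm M (a e)) * sqrt (sqnorm M (a e)) \<le> (2 * sqrt (sqnorm M (gradient \<zeta>))) * sqrt (sqnorm M (a e))"
        by linarith
      then show ?thesis using s by (rule mult_right_le_imp_le)
    qed (simp add: sqnorm_nonneg)
    then have "(sqrt (sqnorm M (a e)))\<^sup>2 \<le> (2 * sqrt (sqnorm M (gradient \<zeta>)))\<^sup>2"
      by (rule power_mono) (simp add: sqnorm_nonneg)
    then show ?thesis
      unfolding power_mult_distrib real_sqrt_pow2[OF sqnorm_nonneg] by simp
  qed
  show ?thesis
  proof (rule square_integrable_Fatou(1)[of M "\<lambda>n. a (inverse (real (Suc n)))" _ "4 * sqnorm M (gradient \<zeta>)"])
    show "square_integrable M (a (inverse (real (Suc n))))" for n by (rule sqa) simp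
    show "(\<lambda>x. (\<zeta> x / U x) *\<^sub>R DU x) \<in> borel_measurable M" by measurable
    show "AE x in M. (\<lambda>n. a (inverse (real (Suc n))) x) \<longlonglongrightarrow> (\<zeta> x / U x) *\<^sub>R DU x"
      using pos
    proof eventually_elim
      case (elim x)
      have "(\<lambda>n. a (inverse (real (Suc n))) x) \<longlonglongrightarrow> (\<zeta> x / (U x + 0)) *\<^sub>R DU x"
        unfolding a_def using elim by (intro tendsto_intros LIMSEQ_inverse_real_of_nat) auto
      then show ?case by simp
    qed
    show "\<forall>\<^sub>F n in sequentially. sqnorm M (a (inverse (real (Suc n)))) \<le> 4 * sqnorm M (gradient \<zeta>)"
      by (intro always_eventually allI bound) simp
  qed
qed

lemma log_gradient_local:
  assumes ef: "first_eigenfunction \<Omega> U DU" and pos: "AE x in M. U x > 0" and K: "compact K" "K \<subseteq> \<Omega>"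
  obtains v where "square_integrable M v" "\<And>x. x \<in> K \<Longrightarrow> norm (DU x /\<^sub>R U x) \<le> norm (v x :: 'a)"
proof -
  obtain \<kappa> where \<kappa>: "\<kappa> \<in> C1_0 \<Omega>" "\<And>x. x \<in> K \<Longrightarrow> \<kappa> x \<ge> 1"
    using cutoff_exists[OF open_\<Omega> K] by metis
  show ?thesis
  proof (rule that[OF eigenfunction_Caccioppoli[OF ef pos \<kappa>(1)]])
    fix x assume "x \<in> K"
    then have "1 * norm (DU x /\<^sub>R U x) \<le> \<bar>\<kappa> x\<bar> * norm (DU x /\<^sub>R U x)"
      using \<kappa>(2) by (intro mult_right_mono) force+
    then show "norm (DU x /\<^sub>R U x) \<le> norm ((\<kappa> x / U x) *\<^sub>R DU x)"
      by (simp add: divide_inverse mult_ac abs_mult)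
  qed
qed

text \<open>The equation for \<open>DU / (U + e)\<close> passes to the limit \<open>e \<rightarrow> 0\<close> by dominated convergence; on the
  support of \<open>\<zeta>\<close> the locally square-integrable logarithmic gradient provides the dominating function.\<close>

lemma log_gradient_equation:
  assumes ef: "first_eigenfunction \<Omega> U DU" and pos: "AE x in M. U x > 0" and \<zeta>: "\<zeta> \<in> C1_0 \<Omega>"
  shows "(\<integral>x. (gradient \<zeta> x \<bullet> DU x) / U x - \<zeta> x * (norm (DU x))\<^sup>2 / (U x)\<^sup>2 \<partial>M)
       = (\<integral>x. enn2real (first_eigenvalue \<Omega>) * \<zeta> x \<partial>M)"
proof -
  have W: "(U, DU) \<in> W12_0 \<Omega>" using ef by (auto simp: first_eigenfunction_def)
  obtain \<psi> where lim: "sobolev_lim \<psi> U DU" using W12_0_sobolev_lim[OF W] by blast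
  note D = sobolev_limD[OF lim]
  define \<mu> where "\<mu> = enn2real (first_eigenvalue \<Omega>)"
  have \<mu>: "\<mu> \<ge> 0" by (simp add: \<mu>_def)
  have nonneg: "AE x in M. U x \<ge> 0" using pos by eventually_elim simp
  note [measurable] = square_integrableD(1)[OF D(2)] square_integrableD(1)[OF D(3)] test_measurable[OF \<zeta>]
  have h: "square_integrable M (\<lambda>x. \<mu> * U x)"
    by (rule square_integrable_dominated[OF D(2), of _ \<mu>]) (use \<mu> in \<open>auto simp: abs_mult\<close>)
  obtain K where K: "compact K" "K \<subseteq> \<Omega>" "\<And>x. x \<notin> K \<Longrightarrow> \<zeta> x = 0" "\<And>x. x \<notin> K \<Longrightarrow> gradient \<zeta> x = 0"
    using C1_0_E[OF \<zeta>] by metis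
  obtain B where B: "B > 0" "\<And>x. \<bar>\<zeta> x\<bar> \<le> B" "\<And>x. norm (gradient \<zeta> x) \<le> B" using C1_0_bounded[OF \<zeta>] by metis
  obtain v where v: "square_integrable M v" "\<And>x. x \<in> K \<Longrightarrow> norm (DU x /\<^sub>R U x) \<le> norm (v x :: 'a)"
    using log_gradient_local[OF ef pos K(1,2)] by blast
  define e where "e n = inverse (real (Suc n))" for n
  have e: "e n > 0" "e \<longlonglongrightarrow> 0" for n
    unfolding e_def[abs_def] by (simp, rule LIMSEQ_inverse_real_of_nat)
  define q where "q n x = (gradient \<zeta> x \<bullet> DU x) / (U x + e n) - \<zeta> x * (norm (DU x))\<^sup>2 / (U x + e n)\<^sup>2" for n x
  have "(\<lambda>n. \<integral>x. q n x \<partial>M) \<longlonglongrightarrow> (\<integral>x. (gradient \<zeta> x \<bullet> DU x) / U x - \<zeta> x * (norm (DU x))\<^sup>2 / (U x)\<^sup>2 \<partial>M)"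
  proof (rule integral_dominated_convergence[where w="\<lambda>x. B * norm (v x) + B * (norm (v x))\<^sup>2"])
    show "integrable M (\<lambda>x. B * norm (v x) + B * (norm (v x))\<^sup>2)"
      using square_integrableD(2)[OF v(1)] integrable_norm[OF square_integrable_integrable[OF finite_M v(1)]] by simp
    show "AE x in M. (\<lambda>n. q n x) \<longlonglongrightarrow> (gradient \<zeta> x \<bullet> DU x) / U x - \<zeta> x * (norm (DU x))\<^sup>2 / (U x)\<^sup>2"
      using pos
    proof eventually_elim
      case (elim x)
      have "(\<lambda>n. q n x) \<longlonglongrightarrow> (gradient \<zeta> x \<bullet> DU x) / (U x + 0) - \<zeta> x * (norm (DU x))\<^sup>2 / (U x + 0)\<^sup>2"
        unfolding q_def using elim by (intro tendsto_intros e(2)) auto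
      then show ?case by simp
    qed
    show "AE x in M. norm (q n x) \<le> B * norm (v x) + B * (norm (v x))\<^sup>2" for n
      using pos
    proof eventually_elim
      case (elim x)
      show ?case
      proof (cases "x \<in> K")
        case False
        then show ?thesis using K(3,4) B(1) by (simp add: q_def)
      next
        case True
        define y where "y = norm (DU x) / (U x + e n)"
        have y0: "y \<ge> 0" using elim e(1)[of n] by (simp add: y_def)
        have "y \<le> norm (DU x) / U x" unfolding y_def using elim e(1)[of n] by (intro divide_left_mono) auto
        also have "\<dots> = norm (DU x /\<^sub>R U x)" using elim by (simp add: divide_inverse mult.commute)
        also have "\<dots> \<le> norm (v x)" by (rule v(2)[OF True])
        finally have y: "y \<le> norm (v x)" .
        have "\<bar>(gradient \<zeta> x \<bullet> DU x) / (U x + e n)\<bar> \<le> norm (gradient \<zeta> x) * y"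
          using Cauchy_Schwarz_ineq2[of "gradient \<zeta> x" "DU x"] elim e(1)[of n]
          by (simp add: y_def abs_divide divide_right_mono)
        also have "\<dots> \<le> B * norm (v x)" using B y y0 by (intro mult_mono) auto
        finally have 1: "\<bar>(gradient \<zeta> x \<bullet> DU x) / (U x + e n)\<bar> \<le> B * norm (v x)" .
        have "\<bar>\<zeta> x * (norm (DU x))\<^sup>2 / (U x + e n)\<^sup>2\<bar> = \<bar>\<zeta> x\<bar> * y\<^sup>2"
          by (simp add: y_def abs_mult power_divide)
        also have "\<dots> \<le> B * (norm (v x))\<^sup>2" using B y y0 by (intro mult_mono power_mono) auto
        finally show ?thesis using 1 unfolding q_def real_norm_def by linarith
      qed
    qed
  qed (unfold q_def, measurable)
  moreover have "(\<lambda>n. \<integral>x. q n x \<partial>M) \<longlonglongrightarrow> (\<integral>x. \<mu> * \<zeta> x \<partial>M)"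
  proof -
    have eq: "(\<integral>x. q n x \<partial>M) = (\<integral>x. \<mu> * U x * \<zeta> x / (U x + e n) \<partial>M)" for n
      unfolding q_def
      by (rule equation_tested_with_reciprocal[OF lim _ h \<zeta> e(1) nonneg]) (use eigenfunction_test[OF ef] in \<open>simp add: \<mu>_def\<close>)
    have "(\<lambda>n. \<integral>x. \<mu> * U x * \<zeta> x / (U x + e n) \<partial>M) \<longlonglongrightarrow> (\<integral>x. \<mu> * \<zeta> x \<partial>M)"
    proof (rule integral_dominated_convergence[where w="\<lambda>x. \<mu> * B"])
      show "AE x in M. (\<lambda>n. \<mu> * U x * \<zeta> x / (U x + e n)) \<longlonglongrightarrow> \<mu> * \<zeta> x"
        using pos
      proof eventually_elim
        case (elim x)
        have "(\<lambda>n. \<mu> * U x * \<zeta> x / (U x + e n)) \<longlonglongrightarrow> \<mu> * U x * \<zeta> x / (U x + 0)"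
          using elim by (intro tendsto_intros e(2)) auto
        then show ?case using elim by simp
      qed
      show "AE x in M. norm (\<mu> * U x * \<zeta> x / (U x + e n)) \<le> \<mu> * B" for n
        using pos
      proof eventually_elim
        case (elim x)
        have "U x / (U x + e n) \<le> 1" using elim e(1)[of n] by simp
        then have "(\<mu> * \<bar>\<zeta> x\<bar>) * (U x / (U x + e n)) \<le> (\<mu> * B) * 1"
          using \<mu> B elim e(1)[of n] by (intro mult_mono) auto
        then show ?case using \<mu> elim e(1)[of n] by (simp add: abs_mult abs_divide mult_ac)
      qed
    qed auto
    then show ?thesis unfolding eq .
  qed
  ultimately show ?thesis unfolding \<mu>_def by (rule LIMSEQ_unique)
qed

lemma log_gradient_minimizer:
  assumes ef: "first_eigenfunction \<Omega> U DU" and pos: "AE x in M. U x > 0"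
  defines "\<mu> \<equiv> enn2real (first_eigenvalue \<Omega>)"
  defines "\<phi> \<equiv> \<lambda>x. (1 / \<mu>) *\<^sub>R (DU x /\<^sub>R U x)" and "f \<equiv> \<lambda>x. - (1 / \<mu>) * ((norm (DU x))\<^sup>2 / (U x)\<^sup>2)"
  shows "(f, \<phi>) \<in> admissible \<Omega>" "Linf_norm \<Omega> (\<lambda>x. G2 (f x) (\<phi> x)) \<le> 1 / first_eigenvalue \<Omega>"
proof -
  have sq: "square_integrable M U" "square_integrable M DU"
    using ef by (auto simp: first_eigenfunction_def W12_0_def L2_iff_square_integrable)
  note [measurable] = square_integrableD(1)[OF sq(1)] square_integrableD(1)[OF sq(2)]
  have \<mu>: "\<mu> > 0" "first_eigenvalue \<Omega> = ennreal \<mu>"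
    using eigenvalue_finite_pos[OF ef pos] by (simp_all add: \<mu>_def)
  have "Linf_norm \<Omega> (\<lambda>x. G2 (f x) (\<phi> x)) \<le> ennreal (1 / \<mu>)"
    unfolding f_def \<phi>_def
    by (rule Linf_norm_G2_log_gradient_le[OF \<mu>(1) square_integrableD(1)[OF sq(1)] square_integrableD(1)[OF sq(2)] pos])
  also have "\<dots> = 1 / first_eigenvalue \<Omega>"
    using \<mu>(1) unfolding \<mu>(2) by (simp add: divide_ennreal[of 1 \<mu>, simplified])
  finally show "Linf_norm \<Omega> (\<lambda>x. G2 (f x) (\<phi> x)) \<le> 1 / first_eigenvalue \<Omega>" .
  have m: "f \<in> borel_measurable M" "\<phi> \<in> borel_measurable M"
    unfolding f_def \<phi>_def by measurable
  have loc: "integrable (lebesgue_on K) f \<and> square_integrable (lebesgue_on K) \<phi>" if K: "compact K" "K \<subseteq> \<Omega>" for K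
  proof -
    obtain v where v: "square_integrable M v" "\<And>x. x \<in> K \<Longrightarrow> norm (DU x /\<^sub>R U x) \<le> norm (v x :: 'a)"
      using log_gradient_local[OF ef pos K] by blast
    have vK: "square_integrable (lebesgue_on K) v"
      by (rule square_integrable_lebesgue_on_mono[OF v(1) K(2) sets_\<Omega> compact_sets_lebesgue[OF K(1)]])
    have "square_integrable (lebesgue_on K) \<phi>"
    proof (rule square_integrable_dominated[OF vK borel_measurable_lebesgue_on_mono[OF m(2) K(2)], of "1 / \<mu>"])
      show "AE x in lebesgue_on K. norm (\<phi> x) \<le> 1 / \<mu> * norm (v x)"
      proof (rule AE_I2)
        fix x assume "x \<in> space (lebesgue_on K)"
        then have "(1 / \<mu>) * norm (DU x /\<^sub>R U x) \<le> (1 / \<mu>) * norm (v x)"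
          using v(2)[of x] \<mu>(1) by (intro mult_left_mono) auto
        then show "norm (\<phi> x) \<le> 1 / \<mu> * norm (v x)" using \<mu>(1) by (simp add: \<phi>_def)
      qed
    qed
    moreover have "integrable (lebesgue_on K) f"
    proof (rule Bochner_Integration.integrable_bound)
      show "integrable (lebesgue_on K) (\<lambda>x. (1 / \<mu>) * (norm (v x))\<^sup>2)" using square_integrableD(2)[OF vK] by simp
      show "f \<in> borel_measurable (lebesgue_on K)" by (rule borel_measurable_lebesgue_on_mono[OF m(1) K(2)])
      show "AE x in lebesgue_on K. norm (f x) \<le> norm ((1 / \<mu>) * (norm (v x))\<^sup>2)"
      proof (rule AE_I2)
        fix x assume "x \<in> space (lebesgue_on K)"
        then have "(norm (DU x /\<^sub>R U x))\<^sup>2 \<le> (norm (v x))\<^sup>2" using v(2)[of x] by (intro power_mono) auto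
        then have "(1 / \<mu>) * (norm (DU x /\<^sub>R U x))\<^sup>2 \<le> (1 / \<mu>) * (norm (v x))\<^sup>2"
          using \<mu>(1) by (intro mult_left_mono) auto
        moreover have "norm (f x) = (1 / \<mu>) * (norm (DU x /\<^sub>R U x))\<^sup>2"
          using \<mu>(1) by (simp add: f_def power_mult_distrib power_inverse divide_inverse mult_ac abs_mult)
        ultimately show "norm (f x) \<le> norm ((1 / \<mu>) * (norm (v x))\<^sup>2)" using \<mu>(1) by simp
      qed
    qed
    ultimately show ?thesis by blast
  qed
  show "(f, \<phi>) \<in> admissible \<Omega>"
    unfolding admissible_def mem_Collect_eq prod.case
  proof (intro conjI ballI impI)
    show "f \<in> L1_loc \<Omega>" using loc by (simp add: L1_loc_def)
    show "\<phi> \<in> L2_loc \<Omega>" using loc by (simp add: L2_loc_def L2_iff_square_integrable)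
    fix \<zeta> assume \<zeta>: "\<zeta> \<in> C1_0 \<Omega>"
    have "(\<integral>x. \<zeta> x \<partial>M) = (1 / \<mu>) * (\<integral>x. \<mu> * \<zeta> x \<partial>M)" using \<mu>(1) by simp
    also have "\<dots> = (1 / \<mu>) * (\<integral>x. (gradient \<zeta> x \<bullet> DU x) / U x - \<zeta> x * (norm (DU x))\<^sup>2 / (U x)\<^sup>2 \<partial>M)"
      using log_gradient_equation[OF ef pos \<zeta>] by (simp add: \<mu>_def)
    also have "\<dots> = (\<integral>x. (1 / \<mu>) * ((gradient \<zeta> x \<bullet> DU x) / U x - \<zeta> x * (norm (DU x))\<^sup>2 / (U x)\<^sup>2) \<partial>M)"
      by simp
    also have "\<dots> = (\<integral>x. (gradient \<zeta> x \<bullet> \<phi> x + f x * \<zeta> x) \<partial>M)"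
      by (rule Bochner_Integration.integral_cong)
        (auto simp: \<phi>_def f_def divide_inverse algebra_simps)
    finally show "(\<integral>x. \<zeta> x \<partial>M) \<le> (\<integral>x. (gradient \<zeta> x \<bullet> \<phi> x + f x * \<zeta> x) \<partial>M)" by simp
  qed
qed

end

section \<open>The duality formula\<close>

theorem theorem1p3:
  fixes \<Omega> :: "'a::euclidean_space set"
  assumes "open \<Omega>" and "emeasure lebesgue \<Omega> < \<infinity>"
  shows "1 / first_eigenvalue \<Omega> = (INF (f, \<phi>) \<in> admissible \<Omega>. Linf_norm \<Omega> (\<lambda>x. G2 (f x) (\<phi> x))) \<and>
    (\<forall>U DU. first_eigenfunction \<Omega> U DU \<and> (AE x in lebesgue_on \<Omega>. U x > 0) \<longrightarrow>
      (let \<mu> = enn2real (first_eigenvalue \<Omega>);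
           \<phi>\<^sub>0 = (\<lambda>x. (1 / \<mu>) *\<^sub>R (DU x /\<^sub>R U x));
           f\<^sub>0 = (\<lambda>x. - (1 / \<mu>) * ((norm (DU x))\<^sup>2 / (U x)\<^sup>2))
       in is_arg_min (\<lambda>(f, \<phi>). Linf_norm \<Omega> (\<lambda>x. G2 (f x) (\<phi> x)))
            (\<lambda>p. p \<in> admissible \<Omega>) (f\<^sub>0, \<phi>\<^sub>0)))"
proof -
  interpret finite_open_set \<Omega>
    using assms by unfold_locales
  show ?thesis
  proof (intro conjI allI impI inverse_eigenvalue_eq_dual_value)
    fix U DU
    assume "first_eigenfunction \<Omega> U DU \<and> (AE x in lebesgue_on \<Omega>. U x > 0)"
    then have ef: "first_eigenfunction \<Omega> U DU" and pos: "AE x in lebesgue_on \<Omega>. U x > 0" by auto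
    note m = log_gradient_minimizer[OF ef pos]
    show "let \<mu> = enn2real (first_eigenvalue \<Omega>);
           \<phi>\<^sub>0 = (\<lambda>x. (1 / \<mu>) *\<^sub>R (DU x /\<^sub>R U x));
           f\<^sub>0 = (\<lambda>x. - (1 / \<mu>) * ((norm (DU x))\<^sup>2 / (U x)\<^sup>2))
       in is_arg_min (\<lambda>(f, \<phi>). Linf_norm \<Omega> (\<lambda>x. G2 (f x) (\<phi> x)))
            (\<lambda>p. p \<in> admissible \<Omega>) (f\<^sub>0, \<phi>\<^sub>0)"
      unfolding Let_def is_arg_min_def
      using m inverse_eigenvalue_le_Linf_norm by (force simp: not_less intro: order_trans)
  qed
qed

end
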